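(* There is a unique bilinear pairing $\langle\cdot,\cdot\rangle:{}_{D'}\mathbf W\times{}_D\mathbf W\to\mathbb C$ such that $\langle\mathbf 1',\mathbf 1\rangle=1$ and such that for all $\chi\in{}_D\mathbf W$, $\chi'\in{}_{D'}\mathbf W$: (i) for $z\in D$, as sections of $K$ on $D$, $\langle\chi',e(z)\chi\rangle=-\langle i'(z)\chi',\chi\rangle$; (ii) for $z'\in D'$, as sections of $K$ on $D'$, $\langle e'(z')\chi',\chi\rangle=-\langle\chi',i(z')\chi\rangle$; (iii) for every regular vector field $X$ on $\mathbb P$ and every natural number $N$, for $z\in D$ and $z'\in D'$, $$\langle\chi',\boldsymbol{\mathcal L}_X^Ne(z)\chi\rangle=\mathcal L_X^N\langle\chi',e(z)\chi\rangle=-\mathcal L_X^N\langle i'(z)\chi',\chi\rangle=-\langle\boldsymbol{\mathcal L}_X^Ni'(z)\chi',\chi\rangle,$$ $$\langle\boldsymbol{\mathcal L}_X^Ne'(z')\chi',\chi\rangle=\mathcal L_X^N\langle e'(z')\chi',\chi\rangle=-\mathcal L_X^N\langle\chi',i(z')\chi\rangle=-\langle\chi',\boldsymbol{\mathcal L}_X^Ni(z')\chi\rangle .$$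
   Context: $\mathbb P$ is a complex projective line, $K$ its canonical bundle. $\gamma\subset\mathbb P$ is a smooth simple closed curve separating $\mathbb P$ into two domains $D$ and $D'$ (each biholomorphic to a disc). ${}_D\mathbf K$ (resp. ${}_{D'}\mathbf K$) is the space of meromorphic 1-forms on $\mathbb P$ with all residues zero and all poles in $D$ (resp. $D'$); ${}_D\mathbf W=S^*({}_D\mathbf K)$, ${}_{D'}\mathbf W=S^*({}_{D'}\mathbf K)$, with vacuum vectors $\mathbf 1$ and $\mathbf 1'$ (the element $1\in\mathbb C$ of each). For $z\in D$, $e(z):{}_D\mathbf W\to{}_D\mathbf W\otimes K_z$ is multiplication by $e_z=-\frac{du}{(u-u(z))^2}\otimes du_z$, where $u$ is any coordinate (meromorphic function with exactly one, simple, pole) regular at $z$; $e_z$ does not depend on $u$. For $z\notin D$, $i(z):{}_D\mathbf W\to{}_D\mathbf W\otimes K_z$ is the derivation with $i(z)\mathbf 1=0$ and $i(z)\alpha=-\alpha(z)$ for $\alpha\in{}_D\mathbf K$. Likewise, with the roles of $D$ and $D'$ exchanged, $e'(z')$ (for $z'\in D'$) and $i'(z)$ (for $z\notin D'$) act on ${}_{D'}\mathbf W$ by the same formulas. $\boldsymbol{\mathcal L}_X$ denotes the derivative (Lie derivative in the variable $z$) of an operator-valued section of $K$ along a regular vector field $X$; $\mathcal L_X$ is the Lie derivative of scalar-valued sections of $K$. *)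

theory Defs
  imports
    "HOL-Complex_Analysis.Complex_Analysis"
    "HOL-Algebra.QuotRing"
    "HOL-Library.Poly_Mapping"
begin

section \<open>The complex projective line\<close>

datatype pline = Fin complex | Infty

text \<open>\<open>par p\<close> is the standard local parametrisation centred at \<open>p\<close>: the affine coordinate shifted
  to vanish at \<open>p\<close>, or its reciprocal at \<open>Infty\<close>.  \<open>crd p\<close> is the corresponding local coordinate
  (its value at the single point outside the chart is junk).\<close>

fun par :: "pline \<Rightarrow> complex \<Rightarrow> pline" where
  "par (Fin a) w = Fin (a + w)"
| "par Infty w = (if w = 0 then Infty else Fin (1 / w))"

fun crd :: "pline \<Rightarrow> pline \<Rightarrow> complex" where
  "crd (Fin a) (Fin z) = z - a"
| "crd (Fin a) Infty = 0"
| "crd Infty (Fin z) = 1 / z"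
| "crd Infty Infty = 0"

instantiation pline :: topological_space
begin

definition open_pline :: "pline set \<Rightarrow> bool" where
  "open_pline S \<longleftrightarrow> (\<forall>p\<in>S. \<forall>\<^sub>F w in nhds 0. par p w \<in> S)"

instance
proof
  show "open (UNIV :: pline set)"
    by (simp add: open_pline_def)
next
  fix S T :: "pline set"
  assume "open S" "open T"
  then show "open (S \<inter> T)"
    by (simp add: open_pline_def eventually_conj_iff)
next
  fix K :: "pline set set"
  assume "\<forall>S\<in>K. open S"
  then show "open (\<Union>K)"
    unfolding open_pline_def by (blast intro: eventually_mono)
qed

end

text \<open>Smooth simple closed curves, as 1-periodic regular parametrisations.\<close>

definition smooth_near :: "(real \<Rightarrow> complex) \<Rightarrow> real \<Rightarrow> bool" where
  "smooth_near f t \<longleftrightarrow> (\<exists>\<epsilon>>0. \<forall>n. \<forall>s\<in>ball t \<epsilon>.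
     ((\<lambda>g x. vector_derivative g (at x)) ^^ n) f differentiable (at s))"

definition smooth_simple_closed_curve :: "(real \<Rightarrow> pline) \<Rightarrow> bool" where
  "smooth_simple_closed_curve \<gamma> \<longleftrightarrow>
     continuous_on UNIV \<gamma> \<and>
     (\<forall>s t. \<gamma> s = \<gamma> t \<longleftrightarrow> s - t \<in> \<int>) \<and>
     (\<forall>t. smooth_near (\<lambda>s. crd (\<gamma> t) (\<gamma> s)) t \<and>
          vector_derivative (\<lambda>s. crd (\<gamma> t) (\<gamma> s)) (at t) \<noteq> 0)"


section \<open>Meromorphic functions and coordinates\<close>

text \<open>Meromorphic functions are normalised as in \<^const>\<open>nicely_meromorphic_on\<close>: removable
  singularities are removed, and the value at a pole is the dummy value 0.\<close>

definition mero_fun :: "(pline \<Rightarrow> complex) \<Rightarrow> bool" where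
  "mero_fun u \<longleftrightarrow> (\<forall>p. (u \<circ> par p) nicely_meromorphic_on {0})"

definition fun_pole :: "(pline \<Rightarrow> complex) \<Rightarrow> pline \<Rightarrow> bool" where
  "fun_pole u p \<longleftrightarrow> is_pole (u \<circ> par p) 0"

definition coordinate :: "(pline \<Rightarrow> complex) \<Rightarrow> bool" where
  "coordinate u \<longleftrightarrow> mero_fun u \<and> (\<exists>!p. fun_pole u p) \<and>
     (\<forall>p. fun_pole u p \<longrightarrow> zorder (u \<circ> par p) 0 = -1)"


section \<open>Sections of the canonical bundle and vector fields\<close>

text \<open>Each fibre \<open>K\<^sub>p\<close> is identified with the complex numbers by means of the generator
  \<open>dw\<close> (at \<open>p\<close>), where \<open>w = crd p\<close>; that is, \<open>dz\<close> at a finite point and \<open>d(1/z)\<close> at \<open>Infty\<close>.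
  Hence a section of \<open>K\<close> is a function \<open>pline \<Rightarrow> complex\<close> and, for a vector space \<open>E\<close>,
  a section of \<open>E \<otimes> K\<close> is an \<open>E\<close>-valued function; likewise a vector field is represented by its
  coefficients with respect to \<open>\<partial>/\<partial>w\<close>.
  Contraction of a form and a vector field is then the pointwise product.

  \<open>jac p w\<close> is the derivative, at the point \<open>par p w\<close>, of the coordinate \<open>crd (par p w)\<close>
  with respect to \<open>crd p\<close>.\<close>

fun jac :: "pline \<Rightarrow> complex \<Rightarrow> complex" where
  "jac (Fin a) w = 1"
| "jac Infty w = (if w = 0 then 1 else - 1 / w\<^sup>2)"

text \<open>Coefficients of a form and of a vector field in the whole chart \<open>par p\<close>.\<close>

definition pull :: "pline \<Rightarrow> (pline \<Rightarrow> complex) \<Rightarrow> complex \<Rightarrow> complex" where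
  "pull p \<omega> w = \<omega> (par p w) * jac p w"

definition pull_vec :: "pline \<Rightarrow> (pline \<Rightarrow> complex) \<Rightarrow> complex \<Rightarrow> complex" where
  "pull_vec p X w = X (par p w) / jac p w"

definition regular_vector_field :: "(pline \<Rightarrow> complex) \<Rightarrow> bool" where
  "regular_vector_field X \<longleftrightarrow> (\<forall>p. pull_vec p X analytic_on {0})"

text \<open>On a curve the Lie derivative of a 1-form is \<open>\<L>\<^sub>X \<omega> = d(\<iota>\<^sub>X \<omega>)\<close>,
  that is \<open>(X f)' dw\<close> for \<open>\<omega> = f dw\<close>.\<close>

definition lie_section :: "(pline \<Rightarrow> complex) \<Rightarrow> (pline \<Rightarrow> complex) \<Rightarrow> pline \<Rightarrow> complex" where
  "lie_section X \<omega> p = deriv (\<lambda>w. X (par p w) * \<omega> (par p w)) 0"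


section \<open>The vector space of meromorphic 1-forms\<close>

typedef mform = "{\<omega>. \<forall>p. pull p \<omega> nicely_meromorphic_on {0}}"
  morphisms coeff Abs_mform
  by (intro exI[of _ "\<lambda>_. 0"]) (auto simp: pull_def[abs_def])

text \<open>\<open>mform_of f\<close> is the meromorphic form that agrees with \<open>f\<close> up to removable singularities.
  The vector space operations have to be normalised this way, because poles may cancel.\<close>

definition mform_of :: "(pline \<Rightarrow> complex) \<Rightarrow> mform" where
  "mform_of f = Abs_mform (\<lambda>p. remove_sings (pull p f) 0)"

lemma jac_0 [simp]: "jac p 0 = 1" by (cases p) auto
lemma par_0 [simp]: "par p 0 = p" by (cases p) auto
lemma jac_nz [simp]: "jac p w \<noteq> 0" by (cases p) auto
lemma pull_0 [simp]: "pull p f 0 = f p" by (simp add: pull_def)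

lemma mform_of_spec:
  assumes f: "\<And>p. pull p f meromorphic_on {0}"
  shows "coeff (mform_of f) p = remove_sings (pull p f) 0"
    and "\<forall>\<^sub>F w in at 0. coeff (mform_of f) (par p w) = f (par p w)"
proof -
  define g where "g = (\<lambda>p. remove_sings (pull p f) 0)"
  have an: "\<forall>\<^sub>F w in at 0. w \<noteq> 0 \<and> pull p f analytic_on {w}" for p
  proof -
    have "isolated_singularity_at (pull p f) 0"
      using f meromorphic_on_isolated_singularity by blast
    then obtain r where r: "r > 0" "pull p f analytic_on ball 0 r - {0}"
      unfolding isolated_singularity_at_def by blast
    then have "\<forall>\<^sub>F w in at 0. w \<in> ball 0 r - {0}"
      by (metis centre_in_ball eventually_at_in_open open_ball)
    then show ?thesis
      by eventually_elim (use r in \<open>auto intro: analytic_on_subset\<close>)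
  qed
  have ev: "\<forall>\<^sub>F w in at 0. g (par p w) = f (par p w)" for p
    using an[of p]
  proof eventually_elim
    case (elim w)
    have "pull (par p w) f analytic_on {0}"
    proof (cases p)
      case (Fin a)
      have "(pull p f \<circ> (\<lambda>v. w + v)) analytic_on {0}"
        by (rule analytic_on_compose) (use elim in \<open>auto intro!: analytic_intros\<close>)
      also have "pull p f \<circ> (\<lambda>v. w + v) = pull (par p w) f"
        using Fin by (auto simp: pull_def add.assoc)
      finally show ?thesis .
    next
      case Infty
      define h where "h = (\<lambda>v. 1 / (1 / w + v))"
      have "(\<lambda>v. (pull p f \<circ> h) v * (- (h v)\<^sup>2)) analytic_on {0}"
      proof (intro analytic_intros)
        show h: "h analytic_on {0}"
          unfolding h_def using elim by (auto intro!: analytic_intros)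
        show "(pull p f \<circ> h) analytic_on {0}"
          by (rule analytic_on_compose[OF h]) (use elim in \<open>auto simp: h_def\<close>)
      qed
      moreover have "\<forall>\<^sub>F v in nhds 0. (pull p f \<circ> h) v * (- (h v)\<^sup>2) = pull (par p w) f v"
      proof -
        have "\<forall>\<^sub>F v in nhds 0. v \<in> ball 0 (norm (1 / w))"
          by (rule eventually_nhds_in_open) (use elim in auto)
        then show ?thesis
        proof eventually_elim
          case (elim v)
          have "1 / w + v \<noteq> 0"
          proof
            assume "1 / w + v = 0"
            then have "1 / w = - v" by (simp add: eq_neg_iff_add_eq_0)
            then show False using elim by simp
          qed
          moreover have "w \<noteq> 0"
            using elim by auto
          ultimately show ?case
            using Infty by (auto simp: pull_def h_def)
        qed
      qed
      ultimately show ?thesis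
        by (subst (asm) analytic_at_cong) auto
    qed
    then show ?case by (simp add: g_def)
  qed
  have nice: "pull q g nicely_meromorphic_on {0}" for q
  proof -
    have e: "\<forall>\<^sub>F w in at 0. pull q g w = remove_sings (pull q f) w"
      using ev[of q] eventually_remove_sings_eq_at[OF meromorphic_on_isolated_singularity[OF f[of q]]]
      by eventually_elim (auto simp: pull_def)
    moreover have "pull q g 0 = remove_sings (pull q f) 0"
      by (simp add: g_def)
    moreover have "remove_sings (pull q f) nicely_meromorphic_on {0}"
      by (rule remove_sings_nicely_meromorphic[OF f])
    ultimately show ?thesis
      unfolding nicely_meromorphic_on_def
      using meromorphic_on_cong[of "{0}" "pull q g" "remove_sings (pull q f)" "{0}"]
        is_pole_cong[OF e refl] tendsto_cong[OF e] by auto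
  qed
  have "coeff (mform_of f) = g"
    unfolding mform_of_def using nice by (subst Abs_mform_inverse) (auto simp: g_def)
  then show "coeff (mform_of f) p = remove_sings (pull p f) 0"
    and "\<forall>\<^sub>F w in at 0. coeff (mform_of f) (par p w) = f (par p w)"
    using ev by (simp_all add: g_def)
qed

lemma coeff_nice: "pull p (coeff \<alpha>) nicely_meromorphic_on {0}"
  using coeff[of \<alpha>] by auto

lemma coeff_mero: "pull p (coeff \<alpha>) meromorphic_on {0}"
  using coeff_nice by (auto simp: nicely_meromorphic_on_def)

lemma mform_eqI:
  assumes "\<And>p. \<forall>\<^sub>F w in at 0. coeff \<alpha> (par p w) = coeff \<beta> (par p w)"
  shows "\<alpha> = \<beta>"
proof -
  have rs: "remove_sings (pull p (coeff \<alpha>)) 0 = coeff \<alpha> p" for p \<alpha>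
    using coeff_nice[of p \<alpha>] unfolding nicely_meromorphic_on_def by auto
  have "coeff \<alpha> p = coeff \<beta> p" for p
  proof -
    have "remove_sings (pull p (coeff \<alpha>)) 0 = remove_sings (pull p (coeff \<beta>)) 0"
      by (rule remove_sings_cong) (use assms[of p] in \<open>auto simp: pull_def elim: eventually_mono\<close>)
    then show ?thesis by (simp add: rs)
  qed
  then show ?thesis by (simp add: coeff_inject[symmetric] fun_eq_iff)
qed

instantiation mform :: ab_group_add
begin

definition "0 = mform_of (\<lambda>_. 0)"
definition "\<alpha> + \<beta> = mform_of (\<lambda>p. coeff \<alpha> p + coeff \<beta> p)"
definition "- \<alpha> = mform_of (\<lambda>p. - coeff \<alpha> p)"
definition "\<alpha> - \<beta> = mform_of (\<lambda>p. coeff \<alpha> p - coeff \<beta> p)"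

lemma ev_zero: "\<forall>\<^sub>F w in at 0. coeff 0 (par p w) = 0"
  unfolding zero_mform_def
  by (rule mform_of_spec(2)) (auto simp: pull_def[abs_def] intro!: meromorphic_intros)

lemma ev_plus: "\<forall>\<^sub>F w in at 0. coeff (\<alpha> + \<beta>) (par p w) = coeff \<alpha> (par p w) + coeff \<beta> (par p w)"
  unfolding plus_mform_def
proof (rule mform_of_spec(2))
  show "pull q (\<lambda>p. coeff \<alpha> p + coeff \<beta> p) meromorphic_on {0}" for q
    using meromorphic_on_add[OF coeff_mero[of q \<alpha>] coeff_mero[of q \<beta>]]
    by (simp add: pull_def[abs_def] distrib_right)
qed

lemma ev_uminus: "\<forall>\<^sub>F w in at 0. coeff (- \<alpha>) (par p w) = - coeff \<alpha> (par p w)"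
  unfolding uminus_mform_def
proof (rule mform_of_spec(2))
  show "pull q (\<lambda>p. - coeff \<alpha> p) meromorphic_on {0}" for q
    using meromorphic_on_uminus[OF coeff_mero[of q \<alpha>]]
    by (simp add: pull_def[abs_def])
qed

lemma ev_minus: "\<forall>\<^sub>F w in at 0. coeff (\<alpha> - \<beta>) (par p w) = coeff \<alpha> (par p w) - coeff \<beta> (par p w)"
  unfolding minus_mform_def
proof (rule mform_of_spec(2))
  show "pull q (\<lambda>p. coeff \<alpha> p - coeff \<beta> p) meromorphic_on {0}" for q
    using meromorphic_on_diff[OF coeff_mero[of q \<alpha>] coeff_mero[of q \<beta>]]
    by (simp add: pull_def[abs_def] left_diff_distrib)
qed

instance
proof
  fix a b c :: mform
  show "a + b + c = a + (b + c)"
  proof (rule mform_eqI)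
    fix p
    show "\<forall>\<^sub>F w in at 0. coeff (a + b + c) (par p w) = coeff (a + (b + c)) (par p w)"
      using ev_plus[of a b p] ev_plus[of "a + b" c p] ev_plus[of b c p] ev_plus[of a "b + c" p]
      by eventually_elim simp
  qed
  show "a + b = b + a"
    by (simp add: plus_mform_def add.commute)
  show "0 + a = a"
  proof (rule mform_eqI)
    fix p
    show "\<forall>\<^sub>F w in at 0. coeff (0 + a) (par p w) = coeff a (par p w)"
      using ev_plus[of 0 a p] ev_zero[of p] by eventually_elim simp
  qed
  show "- a + a = 0"
  proof (rule mform_eqI)
    fix p
    show "\<forall>\<^sub>F w in at 0. coeff (- a + a) (par p w) = coeff 0 (par p w)"
      using ev_plus[of "- a" a p] ev_zero[of p] ev_uminus[of a p] by eventually_elim simp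
  qed
  show "a - b = a + - b"
  proof (rule mform_eqI)
    fix p
    show "\<forall>\<^sub>F w in at 0. coeff (a - b) (par p w) = coeff (a + - b) (par p w)"
      using ev_plus[of a "- b" p] ev_minus[of a b p] ev_uminus[of b p] by eventually_elim simp
  qed
qed

end

definition scale_form :: "complex \<Rightarrow> mform \<Rightarrow> mform" where
  "scale_form c \<alpha> = mform_of (\<lambda>p. c * coeff \<alpha> p)"

lemma ev_scale: "\<forall>\<^sub>F w in at 0. coeff (scale_form c \<alpha>) (par p w) = c * coeff \<alpha> (par p w)"
  unfolding scale_form_def
proof (rule mform_of_spec(2))
  show "pull q (\<lambda>p. c * coeff \<alpha> p) meromorphic_on {0}" for q
    using meromorphic_on_mult[OF meromorphic_on_const coeff_mero[of q \<alpha>], of c]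
    by (simp add: pull_def[abs_def] mult.assoc)
qed

interpretation mform: vector_space scale_form
proof
  fix a b :: complex and x y :: mform
  show "scale_form a (x + y) = scale_form a x + scale_form a y"
  proof (rule mform_eqI)
    fix p
    show "\<forall>\<^sub>F w in at 0. coeff (scale_form a (x + y)) (par p w) =
        coeff (scale_form a x + scale_form a y) (par p w)"
      using ev_scale[of a "x + y" p] ev_plus[of x y p] ev_scale[of a x p] ev_scale[of a y p]
        ev_plus[of "scale_form a x" "scale_form a y" p]
      by eventually_elim (simp add: algebra_simps)
  qed
  show "scale_form (a + b) x = scale_form a x + scale_form b x"
  proof (rule mform_eqI)
    fix p
    show "\<forall>\<^sub>F w in at 0. coeff (scale_form (a + b) x) (par p w) =
        coeff (scale_form a x + scale_form b x) (par p w)"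
      using ev_scale[of "a + b" x p] ev_scale[of a x p] ev_scale[of b x p]
        ev_plus[of "scale_form a x" "scale_form b x" p]
      by eventually_elim (simp add: algebra_simps)
  qed
  show "scale_form a (scale_form b x) = scale_form (a * b) x"
  proof (rule mform_eqI)
    fix p
    show "\<forall>\<^sub>F w in at 0. coeff (scale_form a (scale_form b x)) (par p w) =
        coeff (scale_form (a * b) x) (par p w)"
      using ev_scale[of a "scale_form b x" p] ev_scale[of b x p] ev_scale[of "a * b" x p]
      by eventually_elim simp
  qed
  show "scale_form 1 x = x"
  proof (rule mform_eqI)
    fix p
    show "\<forall>\<^sub>F w in at 0. coeff (scale_form 1 x) (par p w) = coeff x (par p w)"
      using ev_scale[of 1 x p] by eventually_elim simp
  qed
qed

definition form_pole :: "mform \<Rightarrow> pline \<Rightarrow> bool" where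
  "form_pole \<alpha> p \<longleftrightarrow> is_pole (pull p (coeff \<alpha>)) 0"

text \<open>The space \<open>\<^sub>DK\<close>.\<close>

definition KK :: "pline set \<Rightarrow> mform set" where
  "KK D = {\<alpha>. (\<forall>p. residue (pull p (coeff \<alpha>)) 0 = 0) \<and> (\<forall>p. form_pole \<alpha> p \<longrightarrow> p \<in> D)}"

text \<open>\<open>e\<^sub>z = - du / (u - u(z))\<^sup>2 \<otimes> du\<^sub>z\<close>, independent of the choice of \<open>u\<close>.  The coefficient of
  \<open>du\<close> at \<open>p\<close> with respect to \<open>dw\<close>, \<open>w = crd p\<close>, is \<open>deriv (u \<circ> par p) 0\<close>.\<close>

definition e_form :: "pline \<Rightarrow> mform" where
  "e_form z = (THE \<epsilon>. \<forall>u. coordinate u \<and> \<not> fun_pole u z \<longrightarrow>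
     \<epsilon> = mform_of (\<lambda>p. - deriv (u \<circ> par p) 0 / (u p - u z)\<^sup>2 * deriv (u \<circ> par z) 0))"


section \<open>Symmetric algebras\<close>

text \<open>The symmetric algebra of a subspace \<open>V\<close>: polynomials in commuting indeterminates \<open>[v]\<close>,
  \<open>v \<in> V\<close>, modulo the ideal generated by \<open>[v + v'] - [v] - [v']\<close> and \<open>[c v] - c [v]\<close>.\<close>

type_synonym 'v cpoly = "('v \<Rightarrow>\<^sub>0 nat) \<Rightarrow>\<^sub>0 complex"

definition pvar :: "'v \<Rightarrow> 'v cpoly" where
  "pvar v = Poly_Mapping.single (Poly_Mapping.single v 1) 1"

definition pconst :: "complex \<Rightarrow> 'v cpoly" where
  "pconst c = Poly_Mapping.single 0 c"

definition poly_alg :: "'v set \<Rightarrow> 'v cpoly ring" where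
  "poly_alg V = \<lparr>carrier = {P. \<forall>m \<in> Poly_Mapping.keys P. Poly_Mapping.keys m \<subseteq> V},
     mult = (*), one = 1, zero = 0, add = (+)\<rparr>"

definition sym_ideal :: "(complex \<Rightarrow> 'v \<Rightarrow> 'v::ab_group_add) \<Rightarrow> 'v set \<Rightarrow> 'v cpoly set" where
  "sym_ideal scl V = Idl\<^bsub>poly_alg V\<^esub>
     ({pvar (v + v') - pvar v - pvar v' | v v'. v \<in> V \<and> v' \<in> V} \<union>
      {pvar (scl c v) - pconst c * pvar v | c v. v \<in> V})"

definition sym_alg :: "(complex \<Rightarrow> 'v \<Rightarrow> 'v::ab_group_add) \<Rightarrow> 'v set \<Rightarrow> 'v cpoly set ring" where
  "sym_alg scl V = poly_alg V Quot sym_ideal scl V"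


section \<open>The spaces W and the operators on them\<close>

type_synonym fock = "mform cpoly set"

definition WW :: "pline set \<Rightarrow> fock ring" where
  "WW D = sym_alg scale_form (KK D)"

definition vacuum :: "pline set \<Rightarrow> fock" where
  "vacuum D = \<one>\<^bsub>WW D\<^esub>"

definition W_incl :: "pline set \<Rightarrow> mform \<Rightarrow> fock" where
  "W_incl D \<alpha> = sym_ideal scale_form (KK D) +>\<^bsub>poly_alg (KK D)\<^esub> pvar \<alpha>"

definition W_const :: "pline set \<Rightarrow> complex \<Rightarrow> fock" where
  "W_const D c = sym_ideal scale_form (KK D) +>\<^bsub>poly_alg (KK D)\<^esub> pconst c"

definition W_scale :: "pline set \<Rightarrow> complex \<Rightarrow> fock \<Rightarrow> fock" where
  "W_scale D c \<xi> = W_const D c \<otimes>\<^bsub>WW D\<^esub> \<xi>"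

definition derivation_on_W :: "pline set \<Rightarrow> (fock \<Rightarrow> fock) \<Rightarrow> bool" where
  "derivation_on_W D d \<longleftrightarrow> d \<in> carrier (WW D) \<rightarrow>\<^sub>E carrier (WW D) \<and>
     (\<forall>\<xi>\<in>carrier (WW D). \<forall>\<psi>\<in>carrier (WW D). d (\<xi> \<oplus>\<^bsub>WW D\<^esub> \<psi>) = d \<xi> \<oplus>\<^bsub>WW D\<^esub> d \<psi>) \<and>
     (\<forall>c. \<forall>\<xi>\<in>carrier (WW D). d (W_scale D c \<xi>) = W_scale D c (d \<xi>)) \<and>
     (\<forall>\<xi>\<in>carrier (WW D). \<forall>\<psi>\<in>carrier (WW D).
        d (\<xi> \<otimes>\<^bsub>WW D\<^esub> \<psi>) = (d \<xi> \<otimes>\<^bsub>WW D\<^esub> \<psi>) \<oplus>\<^bsub>WW D\<^esub> (\<xi> \<otimes>\<^bsub>WW D\<^esub> d \<psi>))"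

definition e_op :: "pline set \<Rightarrow> pline \<Rightarrow> fock \<Rightarrow> fock" where
  "e_op D z \<xi> = W_incl D (e_form z) \<otimes>\<^bsub>WW D\<^esub> \<xi>"

definition i_op :: "pline set \<Rightarrow> pline \<Rightarrow> fock \<Rightarrow> fock" where
  "i_op D z = (THE d. derivation_on_W D d \<and> d (vacuum D) = \<zero>\<^bsub>WW D\<^esub> \<and>
     (\<forall>\<alpha>\<in>KK D. d (W_incl D \<alpha>) = W_scale D (- coeff \<alpha> z) (vacuum D)))"


section \<open>Derivatives of operator-valued sections\<close>

text \<open>The degree-0 component \<open>W = S\<^sup>*(K) \<rightarrow> S\<^sup>0(K)\<close>: all polynomials in a coset have the same
  constant term.\<close>

definition vac_comp :: "pline set \<Rightarrow> fock \<Rightarrow> complex" where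
  "vac_comp D \<xi> = the_elem ((\<lambda>P. Poly_Mapping.lookup P 0) ` \<xi>)"

text \<open>If the complement of \<open>D\<close> has interior, elements of \<open>W\<close> are determined by their values as symmetric polydifferentials on the
  complement of \<open>D\<close>, which are (up to sign) the degree-0 components of \<open>i(y\<^sub>1) \<dots> i(y\<^sub>n) \<xi>\<close>.
  The infinite-dimensional space \<open>W\<close> carries the topology of pointwise convergence of these
  values, and \<open>W\<close>-valued functions are differentiated accordingly.  For \<open>\<alpha> \<in> K \<subseteq> W\<close> depending on
  a parameter \<open>w\<close> this says that \<open>\<alpha>(y)\<close> is differentiated with respect to \<open>w\<close> for every fixed
  \<open>y \<notin> D\<close>.\<close>

definition W_has_derivative :: "pline set \<Rightarrow> (complex \<Rightarrow> fock) \<Rightarrow> fock \<Rightarrow> complex \<Rightarrow> bool" where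
  "W_has_derivative D F G w \<longleftrightarrow> G \<in> carrier (WW D) \<and>
     (\<forall>ys. set ys \<subseteq> - D \<longrightarrow>
       ((\<lambda>v. vac_comp D (foldr (i_op D) ys (F v))) has_field_derivative
         vac_comp D (foldr (i_op D) ys G)) (at w))"

definition lie_op :: "pline set \<Rightarrow> (pline \<Rightarrow> complex) \<Rightarrow> (pline \<Rightarrow> fock \<Rightarrow> fock)
    \<Rightarrow> pline \<Rightarrow> fock \<Rightarrow> fock" where
  "lie_op D X A p \<xi> =
     (THE \<psi>. W_has_derivative D (\<lambda>w. W_scale D (X (par p w)) (A (par p w) \<xi>)) \<psi> 0)"


section \<open>Pairings\<close>

definition bilinear_pairing :: "pline set \<Rightarrow> pline set \<Rightarrow> (fock \<times> fock \<Rightarrow> complex) \<Rightarrow> bool" where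
  "bilinear_pairing D' D B \<longleftrightarrow>
     B \<in> carrier (WW D') \<times> carrier (WW D) \<rightarrow>\<^sub>E UNIV \<and>
     (\<forall>\<xi>'\<in>carrier (WW D'). \<forall>\<psi>'\<in>carrier (WW D'). \<forall>\<xi>\<in>carrier (WW D).
        B (\<xi>' \<oplus>\<^bsub>WW D'\<^esub> \<psi>', \<xi>) = B (\<xi>', \<xi>) + B (\<psi>', \<xi>)) \<and>
     (\<forall>c. \<forall>\<xi>'\<in>carrier (WW D'). \<forall>\<xi>\<in>carrier (WW D). B (W_scale D' c \<xi>', \<xi>) = c * B (\<xi>', \<xi>)) \<and>
     (\<forall>\<xi>'\<in>carrier (WW D'). \<forall>\<xi>\<in>carrier (WW D). \<forall>\<psi>\<in>carrier (WW D).
        B (\<xi>', \<xi> \<oplus>\<^bsub>WW D\<^esub> \<psi>) = B (\<xi>', \<xi>) + B (\<xi>', \<psi>)) \<and>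
     (\<forall>c. \<forall>\<xi>'\<in>carrier (WW D'). \<forall>\<xi>\<in>carrier (WW D). B (\<xi>', W_scale D c \<xi>) = c * B (\<xi>', \<xi>))"

end

theory Submission
  imports Defs
begin

text \<open>The pairing is built on generators and then extended to symmetric algebras.

  On generators, everything rests on one symmetric kernel, the form \<open>e\<^sub>z\<close> evaluated at a second
  point.  Its derivatives in \<open>z\<close>, called \<open>gform z k\<close> below, have a single pole, at \<open>z\<close>, of order
  \<open>k + 2\<close>; by partial fractions and Liouville's theorem they span \<open>KK D\<close> when \<open>z\<close> runs through
  \<open>D\<close> (\<open>KK_spanned\<close>).  The pairing of forms has to send \<open>(\<alpha>', gform z k)\<close> to the \<open>k\<close>-th derivative
  of \<open>\<alpha>'\<close> at \<open>z\<close> and, symmetrically, \<open>(gform z' k, \<alpha>)\<close> to the \<open>k\<close>-th derivative of \<open>\<alpha>\<close> at \<open>z'\<close>.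
  The two prescriptions agree because mixed derivatives of the kernel at two distinct points do not
  depend on the order (\<open>jet_gcoef_sym\<close>), and each of them is well defined because of the other: a
  linear relation between forms \<open>gform z k\<close> gives the same relation between the functionals, which
  can be tested on the spanning set of \<open>KK D'\<close>.

  A bilinear form \<open>b\<close> on generators extends to symmetric algebras by letting each generator
  \<open>\<alpha>\<close> act as the derivation with \<open>\<alpha>' \<mapsto> b \<alpha>' \<alpha>\<close>: these derivations commute, so products act by
  composition, and the pairing is the constant term of the result (\<open>ppair\<close>).  Multiplication by a
  generator is then adjoint to the derivation defined by it, on both sides.  For
  \<open>\<alpha> = e\<^sub>z\<close> this derivation is \<open>- i'(z)\<close>, which gives the first two properties.

  For the Lie derivatives one has to know that the operator-valued sections are differentiable and
  what their derivatives are.  An element of \<open>W\<close> is determined by the numbers obtained from it with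
  operators \<open>i(y)\<close>, \<open>y \<notin> D\<close>, and the vacuum component (\<open>fock_eqI\<close>, resting on \<open>J_criterion\<close>).
  On scalar sections an iterated Lie derivative at \<open>z\<close> is a fixed linear combination of ordinary
  derivatives at \<open>z\<close>; the same combination of the forms \<open>gform z k\<close> is a form \<open>\<alpha>\<close> for which the
  iterated Lie derivative of \<open>e(z)\<close> is multiplication by \<open>\<alpha>\<close> (\<open>lie_op_e\<close>), and likewise
  for \<open>i'(z)\<close> (\<open>lie_op_i\<close>).

  Uniqueness uses vector fields that are constant in a coordinate at \<open>z\<close>: for them the iterated Lie
  derivatives of \<open>e(z)\<close> are the multiplications by \<open>gform z k\<close>.  Since these forms span, the third
  property alone moves every generator to the other side of the pairing, and the value is reduced to
  that on the vacuum vectors (\<open>pairing_unique\<close>).\<close>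

section \<open>Polynomials in formal variables\<close>

abbreviation polys :: "'v set \<Rightarrow> 'v cpoly set" where
  "polys V \<equiv> carrier (poly_alg V)"

text \<open>Exponent functions are exchanged for multisets, which supply induction on monomials and
  sums over the factors of a monomial.\<close>

definition mset_of :: "('v \<Rightarrow>\<^sub>0 nat) \<Rightarrow> 'v multiset" where
  "mset_of m = Abs_multiset (Poly_Mapping.lookup m)"

definition mono_of :: "'v multiset \<Rightarrow> ('v \<Rightarrow>\<^sub>0 nat)" where
  "mono_of M = Abs_poly_mapping (count M)"

definition mono_poly :: "'v multiset \<Rightarrow> 'v cpoly" where
  "mono_poly M = Poly_Mapping.single (mono_of M) 1"

lemma lookup_mono_of [simp]: "Poly_Mapping.lookup (mono_of M) = count M"
proof -
  have "{x. count M x \<noteq> 0} = set_mset M" by auto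
  then have "finite {x. count M x \<noteq> 0}" by simp
  then show ?thesis by (simp add: mono_of_def)
qed

lemma count_mset_of [simp]: "count (mset_of m) = Poly_Mapping.lookup m"
  unfolding mset_of_def by (intro count_Abs_multiset) (simp add: finite_lookup_nat)

lemma mono_of_mset_of [simp]: "mono_of (mset_of m) = m"
  by (rule poly_mapping_eqI) simp

lemma mset_of_mono_of [simp]: "mset_of (mono_of M) = M"
  by (rule multiset_eqI) simp

lemma mono_of_empty [simp]: "mono_of {#} = 0"
  by (rule poly_mapping_eqI) simp

lemma mset_of_0 [simp]: "mset_of 0 = {#}"
  by (rule multiset_eqI) simp

lemma mono_of_add: "mono_of (M + N) = mono_of M + mono_of N"
  by (rule poly_mapping_eqI) (simp add: lookup_add)

lemma mono_of_single: "mono_of {#v#} = Poly_Mapping.single v 1"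
  by (rule poly_mapping_eqI) (simp add: lookup_single when_def)

lemma mset_of_single: "mset_of (Poly_Mapping.single v (Suc 0)) = {#v#}"
  using mset_of_mono_of[of "{#v#}"] by (simp add: mono_of_single)

lemma keys_mono_of [simp]: "Poly_Mapping.keys (mono_of M) = set_mset M"
  by (auto simp: in_keys_iff)

lemma pconst_0 [simp]: "pconst 0 = 0" by (simp add: pconst_def)
lemma pconst_1 [simp]: "pconst 1 = 1" by (simp add: pconst_def)
lemma pconst_add: "pconst (a + b) = pconst a + pconst b" by (simp add: pconst_def single_add)
lemma pconst_uminus: "pconst (- a) = - pconst a" by (simp add: pconst_def single_uminus)
lemma pconst_mult: "pconst (a * b) = pconst a * pconst b" by (simp add: pconst_def mult_single)

lemma pconst_times: "pconst c * Poly_Mapping.single m d = Poly_Mapping.single m (c * d)"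
  by (simp add: pconst_def mult_single)

lemma mono_poly_empty [simp]: "mono_poly {#} = 1" by (simp add: mono_poly_def)

lemma mono_poly_add_mset: "mono_poly (add_mset v M) = pvar v * mono_poly M"
proof -
  have "mono_of (add_mset v M) = mono_of {#v#} + mono_of M"
    by (metis add_mset_add_single mono_of_add add.commute)
  then show ?thesis by (simp add: mono_poly_def pvar_def mult_single mono_of_single)
qed

lemma single_eq_mono_poly: "Poly_Mapping.single m c = pconst c * mono_poly (mset_of m)"
  by (simp add: mono_poly_def pconst_times)

lemma lookup_pconst_times: "Poly_Mapping.lookup (pconst c * P) m = c * Poly_Mapping.lookup P m"
proof -
  have "pconst c * P = Poly_Mapping.map ((*) c) P"
    by (simp add: mult_map_scale_conv_mult pconst_def)
  then show ?thesis by (simp add: Poly_Mapping.map.rep_eq when_def)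
qed

lemma cpoly_expand: "P = (\<Sum>m\<in>Poly_Mapping.keys P. pconst (Poly_Mapping.lookup P m) * mono_poly (mset_of m))"
proof (rule poly_mapping_eqI)
  fix k
  have "Poly_Mapping.lookup P k
      = (\<Sum>m\<in>Poly_Mapping.keys P. if k = m then Poly_Mapping.lookup P m else 0)"
    by (simp add: sum.delta in_keys_iff)
  also have "\<dots> = Poly_Mapping.lookup
      (\<Sum>m\<in>Poly_Mapping.keys P. pconst (Poly_Mapping.lookup P m) * mono_poly (mset_of m)) k"
    by (auto simp add: lookup_sum single_eq_mono_poly[symmetric] lookup_single when_def intro!: sum.cong)
  finally show "Poly_Mapping.lookup P k = \<dots>" .
qed

lemma polys_iff: "P \<in> polys V \<longleftrightarrow> (\<forall>m\<in>Poly_Mapping.keys P. set_mset (mset_of m) \<subseteq> V)"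
proof -
  have "set_mset (mset_of m) = Poly_Mapping.keys m" for m :: "'a \<Rightarrow>\<^sub>0 nat"
    by (metis keys_mono_of mono_of_mset_of)
  then show ?thesis by (simp add: poly_alg_def)
qed

lemma polys_UNIV [simp]: "P \<in> polys UNIV" by (simp add: polys_iff)

lemma polys_add [intro]: "P \<in> polys V \<Longrightarrow> Q \<in> polys V \<Longrightarrow> P + Q \<in> polys V"
  using keys_add[of P Q] by (auto simp: polys_iff)

lemma polys_0 [simp, intro]: "0 \<in> polys V" by (simp add: polys_iff)

lemma polys_sum [intro]: "(\<And>a. a \<in> A \<Longrightarrow> f a \<in> polys V) \<Longrightarrow> sum f A \<in> polys V"
  by (induction A rule: infinite_finite_induct) auto

lemma polys_const [simp, intro]: "pconst c \<in> polys V"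
  by (simp add: polys_iff pconst_def)

lemma polys_1 [simp, intro]: "1 \<in> polys V"
  by (simp flip: pconst_1)

lemma polys_var [simp]: "pvar v \<in> polys V \<longleftrightarrow> v \<in> V"
  by (auto simp: polys_iff pvar_def mset_of_single)

lemma polys_mult [intro]: "P \<in> polys V \<Longrightarrow> Q \<in> polys V \<Longrightarrow> P * Q \<in> polys V"
proof -
  assume a: "P \<in> polys V" "Q \<in> polys V"
  have "Poly_Mapping.keys (a + b) \<subseteq> V" if "a \<in> Poly_Mapping.keys P" "b \<in> Poly_Mapping.keys Q" for a b
    using that a keys_add[of a b] unfolding poly_alg_def by (simp, blast)
  then show ?thesis using keys_mult[of P Q] by (fastforce simp: poly_alg_def)
qed

lemma polys_uminus [intro]: "P \<in> polys V \<Longrightarrow> - P \<in> polys V"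
  using polys_mult[OF polys_const[of "-1"]] by (simp add: pconst_uminus)

lemma polys_diff [intro]: "P \<in> polys V \<Longrightarrow> Q \<in> polys V \<Longrightarrow> P - Q \<in> polys V"
  using polys_add[of P V "- Q"] polys_uminus by auto

lemma polys_mon [intro]: "set_mset M \<subseteq> V \<Longrightarrow> mono_poly M \<in> polys V"
  by (induction M) (auto simp: mono_poly_add_mset intro!: polys_mult)

lemma polys_finite_support:
  assumes "P \<in> polys V"
  obtains U where "finite U" "U \<subseteq> V" "P \<in> polys U"
proof
  let ?U = "\<Union>m\<in>Poly_Mapping.keys P. set_mset (mset_of m)"
  show "finite ?U" "?U \<subseteq> V" "P \<in> polys ?U" using assms by (auto simp: polys_iff)
qed

text \<open>The induction principle behind most identities below: constants, sums, and
  multiplication by one variable generate all polynomials.\<close>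

lemma cpoly_induct [consumes 1, case_names const add var]:
  assumes P: "P \<in> polys V"
    and const: "\<And>c. Q (pconst c)"
    and add: "\<And>P R. P \<in> polys V \<Longrightarrow> R \<in> polys V \<Longrightarrow> Q P \<Longrightarrow> Q R \<Longrightarrow> Q (P + R)"
    and var: "\<And>v P. v \<in> V \<Longrightarrow> P \<in> polys V \<Longrightarrow> Q P \<Longrightarrow> Q (pvar v * P)"
  shows "Q P"
proof -
  have mon: "Q (pconst c * mono_poly M)" if "set_mset M \<subseteq> V" for c M
    using that
  proof (induction M)
    case empty
    then show ?case using const by simp
  next
    case (add v M)
    then have "Q (pvar v * (pconst c * mono_poly M))"
      by (intro var) (auto intro!: polys_mult polys_mon)
    then show ?case by (simp add: mono_poly_add_mset mult_ac)
  qed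
  have "finite K \<Longrightarrow> (\<forall>m\<in>K. set_mset (mset_of m) \<subseteq> V) \<Longrightarrow>
      Q (\<Sum>m\<in>K. pconst (Poly_Mapping.lookup P m) * mono_poly (mset_of m))" for K
  proof (induction K rule: finite_induct)
    case empty
    then show ?case using const[of 0] by simp
  next
    case (insert m K)
    then show ?case
      by (auto intro!: add mon polys_sum polys_mult polys_mon)
  qed
  then show ?thesis using P by (subst cpoly_expand) (auto simp: polys_iff)
qed

lemma cpoly_UNIV_induct [case_names const add var]:
  assumes "\<And>c. Q (pconst c)" "\<And>P R. Q P \<Longrightarrow> Q R \<Longrightarrow> Q (P + R)" "\<And>v P. Q P \<Longrightarrow> Q (pvar v * P)"
  shows "Q P"
  by (rule cpoly_induct[of P UNIV]) (auto intro: assms)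

section \<open>Derivations of polynomials\<close>

text \<open>The derivative of a monomial with respect to the derivation that sends each variable \<open>v\<close> to
  \<open>f v\<close>.  Polynomial values \<open>f v\<close> are allowed so that the Euler operator \<open>v \<mapsto> v\<close> and its
  decomposition in a basis fall under the same definition as the constant-coefficient derivations.\<close>

definition mder :: "('v \<Rightarrow> 'v cpoly) \<Rightarrow> 'v multiset \<Rightarrow> 'v cpoly" where
  "mder f M = (\<Sum>v\<in>#M. f v * mono_poly (M - {#v#}))"

definition pder :: "('v \<Rightarrow> 'v cpoly) \<Rightarrow> 'v cpoly \<Rightarrow> 'v cpoly" where
  "pder f P = (\<Sum>m\<in>Poly_Mapping.keys P. pconst (Poly_Mapping.lookup P m) * mder f (mset_of m))"

lemma mder_add_mset: "mder f (add_mset u M) = f u * mono_poly M + pvar u * mder f M"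
proof -
  have "(\<Sum>v\<in>#M. f v * mono_poly (add_mset u M - {#v#})) = (\<Sum>v\<in>#M. pvar u * (f v * mono_poly (M - {#v#})))"
  proof (intro arg_cong[of _ _ sum_mset] image_mset_cong)
    fix v assume "v \<in># M"
    then have "add_mset u M - {#v#} = add_mset u (M - {#v#})"
      by (metis add_mset_commute add_mset_remove_trivial insert_DiffM)
    then show "f v * mono_poly (add_mset u M - {#v#}) = pvar u * (f v * mono_poly (M - {#v#}))"
      by (simp add: mono_poly_add_mset mult_ac)
  qed
  then show ?thesis by (simp add: mder_def sum_mset_distrib_left)
qed

lemma pder_add: "pder f (P + R) = pder f P + pder f R"
  unfolding pder_def
  by (rule setsum_keys_plus_distrib) (simp_all add: pconst_add distrib_right)

lemma pder_const_mon: "pder f (pconst c * mono_poly M) = pconst c * mder f M"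
  by (cases "c = 0") (simp_all add: pder_def mono_poly_def pconst_times)

lemma pder_const [simp]: "pder f (pconst c) = 0"
  using pder_const_mon[of f c "{#}"] by (simp add: mder_def)

lemma pder_1 [simp]: "pder f 1 = 0" using pder_const[of f 1] by simp
lemma pder_0 [simp]: "pder f 0 = 0" using pder_const[of f 0] by simp

lemma cpoly_mon_induct [case_names add mon]:
  assumes "\<And>P R. Q P \<Longrightarrow> Q R \<Longrightarrow> Q (P + R)" "\<And>c M. Q (pconst c * mono_poly M)"
  shows "Q P"
proof -
  have z: "Q 0" using assms(2)[of 0] by simp
  have "finite K \<Longrightarrow> Q (\<Sum>m\<in>K. pconst (Poly_Mapping.lookup P m) * mono_poly (mset_of m))" for K
    by (induction K rule: finite_induct) (auto intro: z assms)
  then show ?thesis by (subst cpoly_expand) auto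
qed

lemma pder_var_times: "pder f (pvar v * P) = f v * P + pvar v * pder f P"
proof (induction P rule: cpoly_mon_induct)
  case (add P R)
  then show ?case by (simp add: distrib_left pder_add)
next
  case (mon c M)
  have e: "pvar v * (pconst c * mono_poly M) = pconst c * mono_poly (add_mset v M)"
    by (simp add: mono_poly_add_mset mult_ac)
  show ?case
    unfolding e pder_const_mon by (simp add: mder_add_mset algebra_simps)
qed

lemma pder_const_times: "pder f (pconst c * P) = pconst c * pder f P"
proof (induction P rule: cpoly_mon_induct)
  case (add P R)
  then show ?case by (simp add: distrib_left pder_add)
next
  case (mon d M)
  have e: "pconst c * (pconst d * mono_poly M) = pconst (c * d) * mono_poly M"
    by (simp add: pconst_mult mult_ac)
  show ?case
    unfolding e pder_const_mon by (simp add: pconst_mult mult_ac)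
qed

lemma pder_var [simp]: "pder f (pvar v) = f v"
  using pder_var_times[of f v 1] by simp

lemma pder_mult: "pder f (P * R) = pder f P * R + P * pder f R"
  by (induction P rule: cpoly_UNIV_induct;
      simp add: pder_const_times pder_var_times pder_add mult.assoc distrib_right;
      simp add: algebra_simps)

lemma pder_uminus: "pder f (- P) = - pder f P"
  using pder_const_times[of f "-1" P] by (simp add: pconst_uminus)

lemma pder_diff: "pder f (P - R) = pder f P - pder f R"
  using pder_add[of f P "- R"] by (simp add: pder_uminus)

lemma pder_polys:
  assumes "P \<in> polys V" "\<And>v. v \<in> V \<Longrightarrow> f v \<in> polys V"
  shows "pder f P \<in> polys V"
  using assms(1)
  by (induction rule: cpoly_induct)
     (auto simp: pder_add pder_var_times intro!: polys_add polys_mult assms(2))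

lemma pder_cong:
  assumes "P \<in> polys V" "\<And>v. v \<in> V \<Longrightarrow> f v = g v"
  shows "pder f P = pder g P"
  using assms(1)
  by (induction rule: cpoly_induct) (auto simp: pder_add pder_var_times assms(2))

lemma pder_fun_add: "pder (\<lambda>v. f v + g v) P = pder f P + pder g P"
  by (induction P rule: cpoly_UNIV_induct;
      simp add: pder_const_times pder_var_times pder_add mult.assoc distrib_right;
      simp add: algebra_simps)

lemma pder_fun_times: "pder (\<lambda>v. R * f v) P = R * pder f P"
  by (induction P rule: cpoly_UNIV_induct;
      simp add: pder_const_times pder_var_times pder_add mult.assoc distrib_right;
      simp add: algebra_simps)

lemma pder_fun_0 [simp]: "pder (\<lambda>v. 0) P = 0"
  by (induction P rule: cpoly_UNIV_induct;
      simp add: pder_const_times pder_var_times pder_add mult.assoc distrib_right;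
      simp add: algebra_simps)

lemma pder_fun_sum: "pder (\<lambda>v. \<Sum>i\<in>A. f i v) P = (\<Sum>i\<in>A. pder (f i) P)"
  by (induction A rule: infinite_finite_induct) (auto simp: pder_fun_add)

lemma pder_fun_diff: "pder (\<lambda>v. f v - g v) P = pder f P - pder g P"
  using pder_fun_add[of f "\<lambda>v. (-1) * g v" P] pder_fun_times[of "-1" g P] by simp

text \<open>Constant-coefficient derivations; they commute, since they do so on variables.\<close>

abbreviation cder :: "('v \<Rightarrow> complex) \<Rightarrow> 'v cpoly \<Rightarrow> 'v cpoly" where
  "cder \<mu> \<equiv> pder (\<lambda>v. pconst (\<mu> v))"

lemma cder_commute: "cder \<mu> (cder \<nu> P) = cder \<nu> (cder \<mu> P)"
  by (induction P rule: cpoly_UNIV_induct;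
      simp add: pder_const_times pder_var_times pder_add mult.assoc distrib_right;
      simp add: algebra_simps)

lemma cder_polys: "P \<in> polys V \<Longrightarrow> cder \<mu> P \<in> polys V"
  by (rule pder_polys) auto

abbreviation cterm :: "'v cpoly \<Rightarrow> complex" where
  "cterm P \<equiv> Poly_Mapping.lookup P 0"

lemma cterm_const [simp]: "cterm (pconst c) = c" by (simp add: pconst_def)

lemma cterm_const_times: "cterm (pconst c * P) = c * cterm P"
  by (simp add: lookup_pconst_times)

lemma cterm_var_times [simp]: "cterm (pvar v * P) = 0"
proof (induction P rule: cpoly_mon_induct)
  case (add P R)
  then show ?case by (simp add: distrib_left lookup_add)
next
  case (mon c M)
  have "pvar v * (pconst c * mono_poly M) = pconst c * mono_poly (add_mset v M)"
    by (simp add: mono_poly_add_mset mult_ac)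
  moreover have "mono_of (add_mset v M) \<noteq> 0"
    by (metis mono_of_empty mset_of_mono_of empty_not_add_mset)
  ultimately show ?case by (simp add: lookup_pconst_times mono_poly_def lookup_single when_def)
qed

lemma cterm_mult: "cterm (P * R) = cterm P * cterm R"
  by (induction P rule: cpoly_UNIV_induct)
     (simp_all add: cterm_const_times mult.assoc lookup_add distrib_right)

text \<open>The degree of each monomial is divided out; on the monomial \<open>1\<close> this is a division by zero with
  value \<open>0\<close>, which is why the constant term is lost in \<open>euler_inverse_euler\<close>.\<close>

definition euler_inverse :: "'v cpoly \<Rightarrow> 'v cpoly" where
  "euler_inverse P = (\<Sum>m\<in>Poly_Mapping.keys P. pconst (Poly_Mapping.lookup P m) *
     (pconst (1 / of_nat (size (mset_of m))) * mono_poly (mset_of m)))"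

lemma euler_inverse_add: "euler_inverse (P + R) = euler_inverse P + euler_inverse R"
  unfolding euler_inverse_def
  by (rule setsum_keys_plus_distrib) (simp_all add: pconst_add distrib_right)

lemma euler_inverse_mon: "euler_inverse (pconst c * mono_poly M) = pconst (c / of_nat (size M)) * mono_poly M"
proof (cases "c = 0")
  case False
  have "pconst (c / of_nat (size M)) = pconst c * pconst (1 / of_nat (size M))"
    by (simp flip: pconst_mult)
  then show ?thesis using False by (simp add: euler_inverse_def mono_poly_def pconst_times)
qed (simp add: euler_inverse_def)

lemma euler_inverse_uminus: "euler_inverse (- P) = - euler_inverse P"
proof (induction P rule: cpoly_mon_induct)
  case (mon c M)
  then show ?case using euler_inverse_mon[of "-c" M] euler_inverse_mon[of c M] by (simp add: pconst_uminus)
next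
  case (add P R)
  then show ?case using euler_inverse_add[of "- P" "- R"] by (simp add: euler_inverse_add)
qed

lemma euler_inverse_diff: "euler_inverse (P - R) = euler_inverse P - euler_inverse R"
  using euler_inverse_add[of P "- R"] by (simp add: euler_inverse_uminus)

lemma mder_euler: "mder pvar M = pconst (of_nat (size M)) * mono_poly M"
proof (induction M)
  case (add v M)
  then show ?case by (simp add: mder_add_mset mono_poly_add_mset pconst_add algebra_simps)
qed (simp add: mder_def)

lemma euler_inverse_euler: "euler_inverse (pder pvar P) = P - pconst (cterm P)"
proof (induction P rule: cpoly_mon_induct)
  case (mon c M)
  have e: "pder pvar (pconst c * mono_poly M) = pconst (c * of_nat (size M)) * mono_poly M"
    unfolding pder_const_mon mder_euler by (simp add: pconst_mult mult_ac)
  show ?case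
  proof (cases "M = {#}")
    case True
    then show ?thesis unfolding e using euler_inverse_mon[of 0 "{#}"] by simp
  next
    case False
    then have "mono_of M \<noteq> 0" by (metis mono_of_empty mset_of_mono_of)
    then have "cterm (pconst c * mono_poly M) = 0"
      by (simp add: lookup_pconst_times mono_poly_def lookup_single when_def)
    moreover have "size M \<noteq> 0" using False by simp
    ultimately show ?thesis unfolding e euler_inverse_mon by simp
  qed
qed (simp add: pder_add euler_inverse_add lookup_add pconst_add)

section \<open>The pairing of polynomials\<close>

text \<open>The variables of the second polynomial act on the first one as commuting derivations, so a
  monomial acts by their composition, in any order.\<close>

definition act :: "('u \<Rightarrow> 'v \<Rightarrow> complex) \<Rightarrow> 'v multiset \<Rightarrow> 'u cpoly \<Rightarrow> 'u cpoly" where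
  "act b M P' = fold_mset (\<lambda>v. cder (\<lambda>u. b u v)) P' M"

text \<open>On products of \<open>n\<close> variables this is the permanent of the matrix of values of \<open>b\<close>.\<close>

definition ppair :: "('u \<Rightarrow> 'v \<Rightarrow> complex) \<Rightarrow> 'u cpoly \<Rightarrow> 'v cpoly \<Rightarrow> complex" where
  "ppair b P' P = (\<Sum>m\<in>Poly_Mapping.keys P. Poly_Mapping.lookup P m * cterm (act b (mset_of m) P'))"

lemma act_add_mset: "act b (add_mset v M) P' = act b M (cder (\<lambda>u. b u v) P')"
proof -
  interpret comp_fun_commute "\<lambda>v. cder (\<lambda>u. b u v)"
    by standard (rule ext, simp, rule cder_commute)
  show ?thesis by (simp add: act_def fold_mset_fun_left_comm)
qed

lemma act_empty [simp]: "act b {#} P' = P'" by (simp add: act_def)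

lemma ppair_add: "ppair b P' (P + R) = ppair b P' P + ppair b P' R"
  unfolding ppair_def
  by (rule setsum_keys_plus_distrib) (simp_all add: distrib_right)

lemma ppair_mon: "ppair b P' (pconst c * mono_poly M) = c * cterm (act b M P')"
  by (cases "c = 0") (simp_all add: ppair_def mono_poly_def pconst_times)

lemma ppair_const: "ppair b P' (pconst c) = c * cterm P'"
  using ppair_mon[of b P' c "{#}"] by simp

text \<open>Adjointness on the right holds by construction; adjointness on the left, in
  \<open>ppair_var_left\<close>, follows by induction from the product rule.\<close>

lemma ppair_var: "ppair b P' (pvar v * P) = ppair b (cder (\<lambda>u. b u v) P') P"
proof (induction P rule: cpoly_mon_induct)
  case (add P R)
  then show ?case by (simp add: distrib_left ppair_add)
next
  case (mon c M)
  have "pvar v * (pconst c * mono_poly M) = pconst c * mono_poly (add_mset v M)"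
    by (simp add: mono_poly_add_mset mult_ac)
  then show ?case by (simp add: ppair_mon act_add_mset)
qed

lemma ppair_scale: "ppair b P' (pconst c * P) = c * ppair b P' P"
  by (induction P arbitrary: P' rule: cpoly_UNIV_induct)
     (simp_all add: ppair_add ppair_var ppair_const distrib_left mult.left_commute[of _ "pvar _"]
        flip: pconst_mult)

lemma ppair_add_left: "ppair b (P' + R') P = ppair b P' P + ppair b R' P"
  by (induction P arbitrary: P' R' rule: cpoly_UNIV_induct)
     (simp_all add: ppair_add ppair_var ppair_const distrib_left pder_add lookup_add)

lemma ppair_scale_left: "ppair b (pconst c * P') P = c * ppair b P' P"
  by (induction P arbitrary: P' rule: cpoly_UNIV_induct)
     (simp_all add: ppair_add ppair_var ppair_const distrib_left pder_const_times cterm_const_times)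

lemma ppair_var_left: "ppair b (pvar u * P') P = ppair b P' (cder (b u) P)"
proof (induction P arbitrary: P' rule: cpoly_UNIV_induct)
  case (const c)
  then show ?case using ppair_const[of b P' 0] by (simp add: ppair_const)
next
  case (var v P)
  then show ?case
    by (simp add: ppair_var pder_var_times ppair_add_left ppair_add ppair_scale_left ppair_scale)
qed (simp add: ppair_add pder_add)

section \<open>Symmetric algebras as quotients\<close>

definition cls :: "(complex \<Rightarrow> 'v \<Rightarrow> 'v::ab_group_add) \<Rightarrow> 'v set \<Rightarrow> 'v cpoly \<Rightarrow> 'v cpoly set" where
  "cls scl V P = sym_ideal scl V +>\<^bsub>poly_alg V\<^esub> P"

text \<open>Functionals are total functions on the ambient type, linear only on the subspace: evaluation of
  forms at a point is additive only where there are no poles.\<close>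

definition lin_on :: "(complex \<Rightarrow> 'v \<Rightarrow> 'v::ab_group_add) \<Rightarrow> 'v set \<Rightarrow> ('v \<Rightarrow> complex) \<Rightarrow> bool" where
  "lin_on scl V \<mu> \<longleftrightarrow> (\<forall>v\<in>V. \<forall>w\<in>V. \<mu> (v + w) = \<mu> v + \<mu> w) \<and> (\<forall>c. \<forall>v\<in>V. \<mu> (scl c v) = c * \<mu> v)"

lemma lin_on_add: "lin_on scl V \<mu> \<Longrightarrow> lin_on scl V \<nu> \<Longrightarrow> lin_on scl V (\<lambda>v. \<mu> v + \<nu> v)"
  by (simp add: lin_on_def algebra_simps)

lemma lin_on_cmult: "lin_on scl V \<mu> \<Longrightarrow> lin_on scl V (\<lambda>v. c * \<mu> v)"
  by (simp add: lin_on_def algebra_simps)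

lemma poly_cring: "cring (poly_alg V)"
proof (rule cringI)
  show "abelian_group (poly_alg V)"
  proof (rule abelian_groupI)
    fix x assume x: "x \<in> polys V"
    have "- x \<in> polys V" using x by (rule polys_uminus)
    moreover have "- x \<oplus>\<^bsub>poly_alg V\<^esub> x = \<zero>\<^bsub>poly_alg V\<^esub>" by (simp add: poly_alg_def)
    ultimately show "\<exists>y\<in>polys V. y \<oplus>\<^bsub>poly_alg V\<^esub> x = \<zero>\<^bsub>poly_alg V\<^esub>" by blast
  next
    fix x y assume "x \<in> polys V" "y \<in> polys V"
    then show "x \<oplus>\<^bsub>poly_alg V\<^esub> y \<in> polys V"
      using polys_add[of x V y] by (simp add: poly_alg_def)
  qed (simp_all add: poly_alg_def algebra_simps)
  show "comm_monoid (poly_alg V)"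
  proof (rule comm_monoidI)
    show "x \<otimes>\<^bsub>poly_alg V\<^esub> y \<in> polys V" if "x \<in> polys V" "y \<in> polys V" for x y
      using polys_mult[OF that] by (simp add: poly_alg_def)
    show "\<one>\<^bsub>poly_alg V\<^esub> \<in> polys V" using polys_1[of V] by (simp add: poly_alg_def)
  qed (auto simp: poly_alg_def algebra_simps)
qed (simp add: poly_alg_def algebra_simps)

lemma euler_inverse_0: "euler_inverse 0 = 0" by (simp add: euler_inverse_def)

locale sym_space = vector_space scl for scl :: "complex \<Rightarrow> 'v \<Rightarrow> 'v::ab_group_add" +
  fixes V :: "'v set"
  assumes V: "subspace V"
begin

abbreviation "J \<equiv> sym_ideal scl V"

abbreviation "gens \<equiv> {pvar (v + v') - pvar v - pvar v' | v v'. v \<in> V \<and> v' \<in> V} \<union>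
      {pvar (scl c v) - pconst c * pvar v | c v. v \<in> V}"

lemma V_add: "v \<in> V \<Longrightarrow> w \<in> V \<Longrightarrow> v + w \<in> V"
  and V_scl: "v \<in> V \<Longrightarrow> scl c v \<in> V"
  and V_0: "0 \<in> V"
  using V by (auto simp: subspace_def)

lemma V_sum: "(\<And>a. a \<in> A \<Longrightarrow> f a \<in> V) \<Longrightarrow> sum f A \<in> V"
  by (rule subspace_sum[OF V])

lemma V_diff: "v \<in> V \<Longrightarrow> w \<in> V \<Longrightarrow> v - w \<in> V"
  by (rule subspace_diff[OF V])

lemma gens_sub: "gens \<subseteq> polys V"
  by (auto intro!: polys_diff polys_mult simp: V_add V_scl)

lemma ideal_J: "ideal J (poly_alg V)"
proof -
  interpret cring "poly_alg V" by (rule poly_cring)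
  show ?thesis unfolding sym_ideal_def by (rule genideal_ideal[OF gens_sub])
qed

lemma J_polys: "P \<in> J \<Longrightarrow> P \<in> polys V"
  using ideal.Icarr[OF ideal_J] by blast

lemma J_add: "P \<in> J \<Longrightarrow> R \<in> J \<Longrightarrow> P + R \<in> J"
  using additive_subgroup.a_closed[OF ideal.axioms(1)[OF ideal_J], of P R] by (simp add: poly_alg_def)

lemma J_0: "0 \<in> J"
  using additive_subgroup.zero_closed[OF ideal.axioms(1)[OF ideal_J]] by (simp add: poly_alg_def)

lemma J_mult: "P \<in> J \<Longrightarrow> R \<in> polys V \<Longrightarrow> R * P \<in> J"
  using ideal.I_l_closed[OF ideal_J, of P R] by (simp add: poly_alg_def)

lemma J_mult': "P \<in> J \<Longrightarrow> R \<in> polys V \<Longrightarrow> P * R \<in> J"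
  using J_mult by (simp add: mult.commute)

lemma J_uminus: "P \<in> J \<Longrightarrow> - P \<in> J"
  using J_mult[OF _ polys_const, of P "-1"] by (simp add: pconst_uminus)

lemma J_diff: "P \<in> J \<Longrightarrow> R \<in> J \<Longrightarrow> P - R \<in> J"
  using J_add[of P "- R"] J_uminus by simp

lemma J_sum: "(\<And>a. a \<in> A \<Longrightarrow> f a \<in> J) \<Longrightarrow> sum f A \<in> J"
  by (induction A rule: infinite_finite_induct) (auto intro: J_0 J_add)

lemma gens_J: "gens \<subseteq> J"
  using ring.genideal_self[OF cring.axioms(1)[OF poly_cring] gens_sub] by (simp add: sym_ideal_def)

lemma J_var_add: "v \<in> V \<Longrightarrow> w \<in> V \<Longrightarrow> pvar (v + w) - pvar v - pvar w \<in> J"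
  using gens_J by blast

lemma J_var_scl: "v \<in> V \<Longrightarrow> pvar (scl c v) - pconst c * pvar v \<in> J"
  using gens_J by blast

text \<open>Induction over the defining ideal.\<close>

lemma J_minimal:
  assumes add: "\<And>v w. v \<in> V \<Longrightarrow> w \<in> V \<Longrightarrow> Q (pvar (v + w) - pvar v - pvar w)"
    and scl: "\<And>c v. v \<in> V \<Longrightarrow> Q (pvar (scl c v) - pconst c * pvar v)"
    and 0: "Q 0" and plus: "\<And>P R. P \<in> polys V \<Longrightarrow> R \<in> polys V \<Longrightarrow> Q P \<Longrightarrow> Q R \<Longrightarrow> Q (P + R)"
    and mult: "\<And>P R. P \<in> polys V \<Longrightarrow> R \<in> polys V \<Longrightarrow> Q P \<Longrightarrow> Q (R * P)"
    and P: "P \<in> J"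
  shows "Q P"
proof -
  interpret cring "poly_alg V" by (rule poly_cring)
  define K where "K = {P \<in> polys V. Q P}"
  have "ideal K (poly_alg V)"
  proof (rule idealI)
    show "ring (poly_alg V)" by (rule ring_axioms)
    show "subgroup K (add_monoid (poly_alg V))"
    proof (rule subgroup.intro)
      show "K \<subseteq> carrier (add_monoid (poly_alg V))" "\<one>\<^bsub>add_monoid (poly_alg V)\<^esub> \<in> K"
        using 0 polys_0 by (auto simp: K_def poly_alg_def)
      fix a assume a: "a \<in> K"
      then have "Q (pconst (-1) * a)" by (intro mult) (auto simp: K_def)
      then have "- a \<in> K" using a by (auto simp: K_def pconst_uminus intro: polys_uminus)
      moreover have "- a = \<ominus>\<^bsub>poly_alg V\<^esub> a"
      proof (rule minus_equality[symmetric])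
        show "- a \<oplus>\<^bsub>poly_alg V\<^esub> a = \<zero>\<^bsub>poly_alg V\<^esub>" by (simp add: poly_alg_def)
        show "- a \<in> polys V" "a \<in> polys V" using a by (auto simp: K_def intro: polys_uminus)
      qed
      ultimately show "inv\<^bsub>add_monoid (poly_alg V)\<^esub> a \<in> K" by (simp add: a_inv_def)
      fix b assume "b \<in> K"
      then have "a + b \<in> K" using a by (auto simp: K_def intro: plus)
      then show "a \<otimes>\<^bsub>add_monoid (poly_alg V)\<^esub> b \<in> K" by (simp add: poly_alg_def)
    qed
    fix a x assume "a \<in> K" "x \<in> polys V"
    then have "x * a \<in> K" by (auto simp: K_def intro: mult polys_mult)
    then show "x \<otimes>\<^bsub>poly_alg V\<^esub> a \<in> K" "a \<otimes>\<^bsub>poly_alg V\<^esub> x \<in> K"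
      by (simp_all add: poly_alg_def mult.commute)
  qed
  moreover have "gens \<subseteq> K"
    using gens_sub add scl unfolding K_def by blast
  ultimately have "J \<subseteq> K"
    unfolding sym_ideal_def by (rule genideal_minimal)
  then show ?thesis using P by (auto simp: K_def)
qed

lemma mem_cls: "X \<in> cls scl V P \<longleftrightarrow> X - P \<in> J"
proof -
  have "cls scl V P = {h + P | h. h \<in> J}"
    by (auto simp: cls_def a_r_coset_def r_coset_def poly_alg_def)
  then show ?thesis by simp (metis diff_add_cancel add_diff_cancel_right')
qed

lemma cls_eq_iff: "cls scl V P = cls scl V R \<longleftrightarrow> P - R \<in> J"
proof
  assume "cls scl V P = cls scl V R"
  moreover have "P \<in> cls scl V P" by (simp add: mem_cls J_0)
  ultimately show "P - R \<in> J" by (simp add: mem_cls)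
next
  assume a: "P - R \<in> J"
  have "X - P \<in> J \<longleftrightarrow> X - R \<in> J" for X
    using J_add[OF _ a, of "X - P"] J_diff[OF _ a, of "X - R"] by auto
  then show "cls scl V P = cls scl V R" by (simp add: set_eq_iff mem_cls)
qed

lemma cls_self: "P \<in> cls scl V P" by (simp add: mem_cls J_0)

lemma carrier_sym: "carrier (sym_alg scl V) = cls scl V ` polys V"
  by (auto simp: sym_alg_def FactRing_def A_RCOSETS_def' cls_def)

lemma cls_carrier [simp, intro]: "P \<in> polys V \<Longrightarrow> cls scl V P \<in> carrier (sym_alg scl V)"
  by (simp add: carrier_sym)

lemma cls_cases:
  assumes "\<xi> \<in> carrier (sym_alg scl V)"
  obtains P where "P \<in> polys V" "\<xi> = cls scl V P"
  using assms by (auto simp: carrier_sym)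

lemma hom_cls: "cls scl V \<in> ring_hom (poly_alg V) (sym_alg scl V)"
  using ideal.rcos_ring_hom[OF ideal_J] by (simp add: sym_alg_def cls_def[abs_def])

lemma cls_add: "P \<in> polys V \<Longrightarrow> R \<in> polys V \<Longrightarrow>
    cls scl V P \<oplus>\<^bsub>sym_alg scl V\<^esub> cls scl V R = cls scl V (P + R)"
  using ring_hom_add[OF hom_cls, of P R] by (simp add: poly_alg_def)

lemma cls_mult: "P \<in> polys V \<Longrightarrow> R \<in> polys V \<Longrightarrow>
    cls scl V P \<otimes>\<^bsub>sym_alg scl V\<^esub> cls scl V R = cls scl V (P * R)"
  using ring_hom_mult[OF hom_cls, of P R] by (simp add: poly_alg_def)

lemma cls_1: "\<one>\<^bsub>sym_alg scl V\<^esub> = cls scl V 1"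
  using ring_hom_one[OF hom_cls] by (simp add: poly_alg_def)

lemma cls_0: "\<zero>\<^bsub>sym_alg scl V\<^esub> = cls scl V 0"
proof -
  have "\<zero>\<^bsub>sym_alg scl V\<^esub> = J" by (simp add: sym_alg_def FactRing_def)
  also have "J = cls scl V 0" using mem_cls[of _ 0] by auto
  finally show ?thesis .
qed

section \<open>Vanishing in the symmetric algebra\<close>

text \<open>A derivation preserves the ideal as soon as it kills the linear relations, which it does when it is
  given by a linear functional.\<close>

lemma cder_J:
  assumes \<mu>: "lin_on scl V \<mu>" and P: "P \<in> J"
  shows "cder \<mu> P \<in> J"
proof -
  have "P \<in> J \<and> cder \<mu> P \<in> J"
  proof (rule J_minimal[OF _ _ _ _ _ P])
    fix v w assume "v \<in> V" "w \<in> V"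
    then show "pvar (v + w) - pvar v - pvar w \<in> J \<and> cder \<mu> (pvar (v + w) - pvar v - pvar w) \<in> J"
      using \<mu> J_var_add by (simp add: pder_diff lin_on_def pconst_add J_0)
  next
    fix c v assume "v \<in> V"
    then show "pvar (scl c v) - pconst c * pvar v \<in> J \<and> cder \<mu> (pvar (scl c v) - pconst c * pvar v) \<in> J"
      using \<mu> J_var_scl by (simp add: pder_diff pder_const_times lin_on_def pconst_mult J_0)
  next
    fix P R assume "P \<in> polys V" "R \<in> polys V" "P \<in> J \<and> cder \<mu> P \<in> J"
    then show "R * P \<in> J \<and> cder \<mu> (R * P) \<in> J"
      by (simp add: pder_mult J_add J_mult cder_polys)
  qed (auto simp: J_0 pder_add intro: J_add)
  then show ?thesis by simp
qed

lemma cterm_J: "P \<in> J \<Longrightarrow> cterm P = 0"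
  by (rule J_minimal[of "\<lambda>P. cterm P = 0"])
     (auto simp: lookup_minus cterm_const_times cterm_mult lookup_add
        cterm_var_times[of _ 1, simplified])

text \<open>The ideal is generated by homogeneous elements of degree one, so dividing each homogeneous part
  by its degree does not leave it.  In the induction over the ideal the claim has to be made for all
  multiples at once, because \<open>euler_inverse\<close> is not multiplicative.\<close>

lemma euler_inverse_J:
  assumes "P \<in> J"
  shows "euler_inverse P \<in> J"
proof -
  have gen: "euler_inverse (Q * g) \<in> J"
    if Q: "Q \<in> polys V" and g: "g \<in> J" and hom: "\<And>c M. euler_inverse (pconst c * mono_poly M * g) =
       pconst (c / of_nat (Suc (size M))) * mono_poly M * g" for Q g
  proof -
    have "finite K \<Longrightarrow> (\<forall>m\<in>K. set_mset (mset_of m) \<subseteq> V) \<Longrightarrow>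
      euler_inverse ((\<Sum>m\<in>K. pconst (Poly_Mapping.lookup Q m) * mono_poly (mset_of m)) * g) \<in> J" for K
    proof (induction K rule: finite_induct)
      case empty
      then show ?case by (simp add: euler_inverse_0 J_0)
    next
      case (insert m K)
      then show ?case
        unfolding sum.insert[OF insert(1,2)] distrib_right euler_inverse_add hom
        by (intro J_add J_mult[OF g] polys_mult polys_mon) auto
    qed
    from this[of "Poly_Mapping.keys Q"] show ?thesis
      using Q by (subst cpoly_expand) (auto simp: polys_iff)
  qed
  have v: "pconst c * mono_poly M * pvar v = pconst c * mono_poly (add_mset v M)" for c M v
    by (simp add: mono_poly_add_mset mult_ac)
  have v': "pconst c * mono_poly M * (pconst d * pvar v) = pconst (c * d) * mono_poly (add_mset v M)"
    for c d M v
    by (simp add: mono_poly_add_mset pconst_mult mult_ac)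
  have "\<forall>Q\<in>polys V. euler_inverse (Q * P) \<in> J"
  proof (rule J_minimal[OF _ _ _ _ _ assms])
    fix v w assume vw: "v \<in> V" "w \<in> V"
    show "\<forall>Q\<in>polys V. euler_inverse (Q * (pvar (v + w) - pvar v - pvar w)) \<in> J"
      by (intro ballI gen J_var_add vw)
         (simp_all add: right_diff_distrib euler_inverse_diff v euler_inverse_mon)
  next
    fix c v assume vw: "v \<in> V"
    show "\<forall>Q\<in>polys V. euler_inverse (Q * (pvar (scl c v) - pconst c * pvar v)) \<in> J"
      by (intro ballI gen J_var_scl vw)
         (simp_all add: right_diff_distrib euler_inverse_diff v v' euler_inverse_mon)
  next
    fix P R assume "P \<in> polys V" "R \<in> polys V" "\<forall>Q\<in>polys V. euler_inverse (Q * P) \<in> J"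
    then show "\<forall>Q\<in>polys V. euler_inverse (Q * (R * P)) \<in> J"
      by (auto simp: polys_mult simp flip: mult.assoc)
  qed (simp_all add: euler_inverse_add distrib_left J_add euler_inverse_0 J_0)
  from bspec[OF this polys_1] show ?thesis by simp
qed

lemma J_var_sum:
  assumes "finite A" "\<And>a. a \<in> A \<Longrightarrow> f a \<in> V"
  shows "pvar (\<Sum>a\<in>A. scl (c a) (f a)) - (\<Sum>a\<in>A. pconst (c a) * pvar (f a)) \<in> J"
  using assms
proof (induction A rule: finite_induct)
  case empty
  show ?case using J_var_scl[OF V_0, of 0] by simp
next
  case (insert a A)
  have "pvar (scl (c a) (f a) + (\<Sum>a\<in>A. scl (c a) (f a))) - pvar (scl (c a) (f a))
      - pvar (\<Sum>a\<in>A. scl (c a) (f a)) \<in> J"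
    using insert by (intro J_var_add V_sum V_scl) auto
  moreover have "pvar (scl (c a) (f a)) - pconst (c a) * pvar (f a) \<in> J"
    using insert by (intro J_var_scl) auto
  ultimately have "(pvar (scl (c a) (f a) + (\<Sum>a\<in>A. scl (c a) (f a))) - pvar (scl (c a) (f a))
      - pvar (\<Sum>a\<in>A. scl (c a) (f a))) + (pvar (scl (c a) (f a)) - pconst (c a) * pvar (f a))
      + (pvar (\<Sum>a\<in>A. scl (c a) (f a)) - (\<Sum>a\<in>A. pconst (c a) * pvar (f a))) \<in> J"
    using insert by (intro J_add) auto
  then show ?case using insert by (simp add: algebra_simps)
qed

text \<open>A separating space of functionals contains a dual family for any finite set of vectors.  The
  vectors are added one at a time: the part \<open>r\<close> of a new vector that the family misses is detected
  by some \<open>\<nu>\<close>, and subtracting from \<open>\<nu>\<close> its expansion makes it vanish on the old vectors.\<close>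

lemma finite_dual_family:
  assumes lin: "\<And>\<mu>. \<mu> \<in> L \<Longrightarrow> lin_on scl V \<mu>"
    and add: "\<And>\<mu> \<nu>. \<mu> \<in> L \<Longrightarrow> \<nu> \<in> L \<Longrightarrow> (\<lambda>v. \<mu> v + \<nu> v) \<in> L"
    and cm: "\<And>\<mu> c. \<mu> \<in> L \<Longrightarrow> (\<lambda>v. c * \<mu> v) \<in> L"
    and sep: "\<And>v. v \<in> V \<Longrightarrow> \<forall>\<mu>\<in>L. \<mu> v = 0 \<Longrightarrow> v = 0"
    and U: "finite U" "U \<subseteq> V"
  shows "\<exists>(n::nat) \<mu> \<alpha>. (\<forall>i<n. \<mu> i \<in> L \<and> \<alpha> i \<in> V) \<and> (\<forall>v\<in>U. v = (\<Sum>i<n. scl (\<mu> i v) (\<alpha> i)))"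
  using U
proof (induction U rule: finite_induct)
  case empty
  then show ?case by (intro exI[of _ 0]) auto
next
  case (insert u U)
  then obtain n :: nat and \<mu> \<alpha> where n: "\<And>i. i < n \<Longrightarrow> \<mu> i \<in> L" "\<And>i. i < n \<Longrightarrow> \<alpha> i \<in> V"
    and rep: "\<And>v. v \<in> U \<Longrightarrow> v = (\<Sum>i<n. scl (\<mu> i v) (\<alpha> i))"
  proof -
    have "U \<subseteq> V" using insert.prems by simp
    from insert.IH[OF this] show thesis using that by blast
  qed
  define r where "r = u - (\<Sum>i<n. scl (\<mu> i u) (\<alpha> i))"
  have rV: "r \<in> V" unfolding r_def using insert n by (intro V_diff V_sum V_scl) auto
  show ?case
  proof (cases "r = 0")
    case True
    then have u: "u = (\<Sum>i<n. scl (\<mu> i u) (\<alpha> i))" by (simp add: r_def)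
    have "\<forall>v\<in>insert u U. v = (\<Sum>i<n. scl (\<mu> i v) (\<alpha> i))" using u rep by blast
    then show ?thesis using n by blast
  next
    case False
    then obtain \<nu> where \<nu>: "\<nu> \<in> L" "\<nu> r \<noteq> 0" using sep[OF rV] by blast
    have lsum: "\<kappa> (\<Sum>i\<in>A. scl (c i) (\<alpha> i)) = (\<Sum>i\<in>A. c i * \<kappa> (\<alpha> i))"
      if "\<kappa> \<in> L" "A \<subseteq> {..<n}" for \<kappa> c A
    proof -
      have "finite A" using that(2) finite_subset by blast
      then show ?thesis using that(2)
      proof (induction A rule: finite_induct)
        case empty
        have "\<kappa> (scl 0 0) = 0 * \<kappa> 0" using lin[OF that(1)] V_0 unfolding lin_on_def by blast
        then show ?case by simp
      next
        case (insert a A)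
        then have "scl (c a) (\<alpha> a) \<in> V" "(\<Sum>i\<in>A. scl (c i) (\<alpha> i)) \<in> V" "\<alpha> a \<in> V"
          using n by (auto intro!: V_scl V_sum)
        then show ?case using insert lin[OF that(1)] by (simp add: lin_on_def)
      qed
    qed
    have ladd: "\<kappa> (v + w) = \<kappa> v + \<kappa> w" if "\<kappa> \<in> L" "v \<in> V" "w \<in> V" for \<kappa> v w
      using lin[OF that(1)] that by (simp add: lin_on_def)
    define \<nu>' where "\<nu>' = (\<lambda>v. (1 / \<nu> r) * (\<nu> v + (-1) * (\<Sum>i<n. \<mu> i v * \<nu> (\<alpha> i))))"
    have sumL: "(\<lambda>v. \<Sum>i<k. \<mu> i v * \<nu> (\<alpha> i)) \<in> L" if "k \<le> n" for k
      using that
    proof (induction k)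
      case 0
      have "(\<lambda>v. 0 * \<nu> v) \<in> L" using cm[OF \<nu>(1)] by blast
      then show ?case by simp
    next
      case (Suc k)
      have "(\<lambda>v. (\<Sum>i<k. \<mu> i v * \<nu> (\<alpha> i)) + \<nu> (\<alpha> k) * \<mu> k v) \<in> L"
        using Suc n by (intro add cm) auto
      then show ?case by (simp add: mult.commute)
    qed
    have \<nu>'L: "\<nu>' \<in> L" unfolding \<nu>'_def using \<nu> sumL by (intro cm add) auto
    define \<mu>' where "\<mu>' = \<mu>(n := \<nu>')"
    define \<alpha>' where "\<alpha>' = \<alpha>(n := r)"
    have s: "(\<Sum>i<Suc n. scl (\<mu>' i v) (\<alpha>' i)) = (\<Sum>i<n. scl (\<mu> i v) (\<alpha> i)) + scl (\<nu>' v) r" for v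
      by (simp add: \<mu>'_def \<alpha>'_def)
    have "v = (\<Sum>i<Suc n. scl (\<mu>' i v) (\<alpha>' i))" if "v \<in> insert u U" for v
    proof (cases "v \<in> U")
      case True
      have "\<nu> v = (\<Sum>i<n. \<mu> i v * \<nu> (\<alpha> i))"
        using rep[OF True] lsum[OF \<nu>(1), of "{..<n}" "\<lambda>i. \<mu> i v"] by simp
      then have "\<nu>' v = 0" by (simp add: \<nu>'_def)
      then show ?thesis unfolding s using rep[OF True, symmetric] by simp
    next
      case False
      then have [simp]: "v = u" using that by simp
      have "\<nu> u = \<nu> (r + (\<Sum>i<n. scl (\<mu> i u) (\<alpha> i)))" by (simp add: r_def)
      also have "\<dots> = \<nu> r + (\<Sum>i<n. \<mu> i u * \<nu> (\<alpha> i))"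
        using ladd[OF \<nu>(1) rV, of "\<Sum>i<n. scl (\<mu> i u) (\<alpha> i)"]
          lsum[OF \<nu>(1), of "{..<n}" "\<lambda>i. \<mu> i u"] n by (auto intro!: V_sum V_scl)
      finally have "\<nu>' u = 1" using \<nu>(2) by (simp add: \<nu>'_def)
      then show ?thesis unfolding s by (simp add: r_def)
    qed
    moreover have "\<forall>i<Suc n. \<mu>' i \<in> L \<and> \<alpha>' i \<in> V"
      using n \<nu>'L rV by (auto simp: \<mu>'_def \<alpha>'_def less_Suc_eq)
    ultimately show ?thesis by blast
  qed
qed

lemma pder_J:
  assumes "P \<in> polys U" "U \<subseteq> V" "\<And>v. v \<in> U \<Longrightarrow> f v \<in> J"
  shows "pder f P \<in> J"
  using assms(1)
proof (induction rule: cpoly_induct)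
  case (var v P)
  have "P \<in> polys V" using var(2) assms(2) by (auto simp: polys_iff)
  then have "f v * P \<in> J" "pvar v * pder f P \<in> J"
    using var assms by (auto intro!: J_mult' J_mult[OF var(3)])
  then show ?case by (simp add: pder_var_times J_add)
qed (auto simp: pder_add J_0 intro: J_add)

text \<open>An upper bound for the total degree, in a form that leaves the zero polynomial unexceptional.\<close>

definition degree_le :: "'v cpoly \<Rightarrow> nat \<Rightarrow> bool" where
  "degree_le P d \<longleftrightarrow> (\<forall>m\<in>Poly_Mapping.keys P. size (mset_of m) \<le> d)"

lemma degree_le_cder:
  assumes "degree_le P (Suc d)" shows "degree_le (cder \<mu> P) d"
proof -
  have plus: "degree_le (P + R) k" if "degree_le P k" "degree_le R k" for P R k
    using that keys_add[of P R] by (auto simp: degree_le_def)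
  have sum: "degree_le (sum f A) k" if "\<And>a. a \<in> A \<Longrightarrow> degree_le (f a) k" for f A k
    using that by (induction A rule: infinite_finite_induct) (auto intro: plus simp: degree_le_def[of 0])
  have cm: "degree_le (pconst c * P) k" if "degree_le P k" for c P k
    using that by (auto simp: degree_le_def in_keys_iff lookup_pconst_times)
  have "degree_le (mder (\<lambda>v. pconst (\<mu> v)) M) k" if "size M \<le> Suc k" for M k
    using that
  proof (induction M arbitrary: k)
    case empty
    then show ?case by (simp add: mder_def degree_le_def)
  next
    case (add v M)
    have 1: "degree_le (pconst (\<mu> v) * mono_poly M) k"
      by (rule cm) (use add.prems in \<open>simp add: degree_le_def mono_poly_def\<close>)
    have 2: "degree_le (pvar v * mder (\<lambda>v. pconst (\<mu> v)) M) k"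
    proof (cases k)
      case 0
      then have "M = {#}" using add.prems by simp
      then show ?thesis by (simp add: mder_def degree_le_def)
    next
      case (Suc l)
      then have ih: "degree_le (mder (\<lambda>v. pconst (\<mu> v)) M) l" using add by simp
      have "size (mset_of (a + b)) \<le> Suc l" if "a \<in> Poly_Mapping.keys (pvar v)"
         "b \<in> Poly_Mapping.keys (mder (\<lambda>v. pconst (\<mu> v)) M)" for a b
      proof -
        have "mset_of (a + b) = mset_of a + mset_of b"
          by (metis mono_of_add mono_of_mset_of mset_of_mono_of)
        moreover have "size (mset_of a) = 1" using that(1) by (simp add: pvar_def mset_of_single)
        ultimately show ?thesis using ih that(2) by (auto simp: degree_le_def)
      qed
      then show ?thesis using keys_mult[of "pvar v" "mder (\<lambda>v. pconst (\<mu> v)) M"] Suc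
        unfolding degree_le_def by blast
    qed
    show ?case unfolding mder_add_mset by (rule plus[OF 1 2])
  qed
  then show ?thesis unfolding pder_def
    using assms by (intro sum cm) (auto simp: degree_le_def)
qed

text \<open>A polynomial vanishes in the symmetric algebra if all its iterated derivatives along a separating
  set of functionals have constant term zero: a Taylor expansion at the origin.

  By induction on the degree all first derivatives of \<open>P\<close> vanish.  On the finitely many variables of
  \<open>P\<close> the Euler operator is, modulo the ideal, a combination of such derivatives with linear
  coefficients, so it annihilates \<open>P\<close>.  Inverting it leaves only the constant term.\<close>

theorem J_criterion:
  assumes lin: "\<And>\<mu>. \<mu> \<in> \<Lambda> \<Longrightarrow> lin_on scl V \<mu>"
    and sep: "\<And>v. v \<in> V \<Longrightarrow> \<forall>\<mu>\<in>\<Lambda>. \<mu> v = 0 \<Longrightarrow> v = 0"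
    and P: "P \<in> polys V" "\<And>\<mu>s. set \<mu>s \<subseteq> \<Lambda> \<Longrightarrow> cterm (foldr cder \<mu>s P) = 0"
  shows "P \<in> J"
proof -
  have "P \<in> J" if "degree_le P d" "P \<in> polys V" "\<And>\<mu>s. set \<mu>s \<subseteq> \<Lambda> \<Longrightarrow> cterm (foldr cder \<mu>s P) = 0" for d P
    using that
  proof (induction d arbitrary: P)
    case 0
    have "m = 0" if "m \<in> Poly_Mapping.keys P" for m
      using 0(1) that by (metis degree_le_def le_zero_eq size_eq_0_iff_empty mono_of_empty mono_of_mset_of)
    then have "Poly_Mapping.lookup P m = 0" if "m \<noteq> 0" for m using that by (auto simp: in_keys_iff)
    moreover have "cterm P = 0" using 0(3)[of "[]"] by simp
    ultimately have "P = 0" by (intro poly_mapping_eqI) (metis lookup_zero)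
    then show ?case by (simp add: J_0)
  next
    case (Suc d)
    \<comment> \<open>the functionals along which \<open>P\<close> has zero derivative form a vector space; it contains \<open>\<Lambda>\<close>\<close>
    define L where "L = {\<mu>. lin_on scl V \<mu> \<and> cder \<mu> P \<in> J}"
    have sub: "\<mu> \<in> L" if "\<mu> \<in> \<Lambda>" for \<mu>
    proof -
      have "cder \<mu> P \<in> J"
      proof (rule Suc.IH)
        show "degree_le (cder \<mu> P) d" by (rule degree_le_cder[OF Suc.prems(1)])
        show "cder \<mu> P \<in> polys V" by (rule cder_polys[OF Suc.prems(2)])
        fix \<mu>s assume "set \<mu>s \<subseteq> \<Lambda>"
        then show "cterm (foldr cder \<mu>s (cder \<mu> P)) = 0"
          using Suc.prems(3)[of "\<mu>s @ [\<mu>]"] that by simp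
      qed
      then show ?thesis using lin[OF that] by (simp add: L_def)
    qed
    obtain U where U: "finite U" "U \<subseteq> V" "P \<in> polys U"
      using polys_finite_support[OF Suc.prems(2)] .
    have "\<exists>(n::nat) \<mu> \<alpha>. (\<forall>i<n. \<mu> i \<in> L \<and> \<alpha> i \<in> V) \<and> (\<forall>v\<in>U. v = (\<Sum>i<n. scl (\<mu> i v) (\<alpha> i)))"
    proof (rule finite_dual_family[OF _ _ _ _ U(1,2)])
      show "v = 0" if "v \<in> V" "\<forall>\<mu>\<in>L. \<mu> v = 0" for v using that sep sub by blast
    next
      fix \<mu> \<nu> assume "\<mu> \<in> L" "\<nu> \<in> L"
      then show "(\<lambda>v. \<mu> v + \<nu> v) \<in> L"
        by (auto simp: L_def lin_on_add pconst_add pder_fun_add intro: J_add)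
    next
      fix \<mu> c assume "\<mu> \<in> L"
      then show "(\<lambda>v. c * \<mu> v) \<in> L"
        by (auto simp: L_def lin_on_cmult pconst_mult pder_fun_times intro: J_mult)
    qed (simp add: L_def)
    then obtain n :: nat and \<mu> \<alpha> where n: "\<And>i. i < n \<Longrightarrow> \<mu> i \<in> L" "\<And>i. i < n \<Longrightarrow> \<alpha> i \<in> V"
      and rep: "\<And>v. v \<in> U \<Longrightarrow> v = (\<Sum>i<n. scl (\<mu> i v) (\<alpha> i))" by blast
    have "pder (\<lambda>v. pvar v - (\<Sum>i<n. pconst (\<mu> i v) * pvar (\<alpha> i))) P \<in> J"
    proof (rule pder_J[OF U(3,2)])
      fix v assume "v \<in> U"
      then have e: "(\<Sum>i<n. scl (\<mu> i v) (\<alpha> i)) = v" using rep by simp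
      show "pvar v - (\<Sum>i<n. pconst (\<mu> i v) * pvar (\<alpha> i)) \<in> J"
        using J_var_sum[of "{..<n}" \<alpha> "\<lambda>i. \<mu> i v"] n unfolding e by simp
    qed
    moreover have "pder (\<lambda>v. \<Sum>i<n. pconst (\<mu> i v) * pvar (\<alpha> i)) P \<in> J"
    proof -
      have "pder (\<lambda>v. \<Sum>i<n. pconst (\<mu> i v) * pvar (\<alpha> i)) P = (\<Sum>i<n. pvar (\<alpha> i) * cder (\<mu> i) P)"
        by (simp add: pder_fun_sum pder_fun_times mult.commute[of _ "pvar _"])
      also have "\<dots> \<in> J" using n by (intro J_sum J_mult) (auto simp: L_def)
      finally show ?thesis .
    qed
    ultimately have "pder pvar P \<in> J"
      using J_add[of "pder (\<lambda>v. pvar v - (\<Sum>i<n. pconst (\<mu> i v) * pvar (\<alpha> i))) P"]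
      unfolding pder_fun_diff by fastforce
    then have "euler_inverse (pder pvar P) \<in> J" by (rule euler_inverse_J)
    moreover have "cterm P = 0" using Suc.prems(3)[of "[]"] by simp
    ultimately show ?case by (simp add: euler_inverse_euler)
  qed
  moreover have "degree_le P (Max (insert 0 ((\<lambda>m. size (mset_of m)) ` Poly_Mapping.keys P)))"
    by (auto simp: degree_le_def)
  ultimately show ?thesis using P by blast
qed

end

section \<open>The pairing of symmetric algebras\<close>

locale sym_pair =
  S': sym_space scl' V' + S: sym_space scl V
  for scl' :: "complex \<Rightarrow> 'u \<Rightarrow> 'u::ab_group_add" and V' and scl :: "complex \<Rightarrow> 'v \<Rightarrow> 'v::ab_group_add" and V +
  fixes b :: "'u \<Rightarrow> 'v \<Rightarrow> complex"
  assumes lin_left: "\<And>v. v \<in> V \<Longrightarrow> lin_on scl' V' (\<lambda>u. b u v)"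
    and lin_right: "\<And>u. u \<in> V' \<Longrightarrow> lin_on scl V (b u)"
begin

lemma ppair_J_left:
  assumes "P \<in> polys V" "P' \<in> S'.J"
  shows "ppair b P' P = 0"
  using assms
proof (induction arbitrary: P' rule: cpoly_induct)
  case (var v P)
  then show ?case using S'.cder_J[OF lin_left] by (simp add: ppair_var)
qed (simp_all add: ppair_const ppair_add S'.cterm_J)

lemma ppair_uminus: "ppair b P' (- P) = - ppair b P' P"
  using ppair_scale[of b P' "-1" P] by (simp add: pconst_uminus)

lemma ppair_diff: "ppair b P' (P - R) = ppair b P' P - ppair b P' R"
  using ppair_add[of b P' P "- R"] by (simp add: ppair_uminus)

text \<open>Here bilinearity of \<open>b\<close> in its second argument is used through the derivations: on
  polynomials over \<open>V'\<close> they depend linearly on the vector of \<open>V\<close>.\<close>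

lemma ppair_J_right:
  assumes "P' \<in> polys V'" "P \<in> S.J"
  shows "ppair b P' P = 0"
proof -
  have v: "ppair b P' (pvar v) = cterm (cder (\<lambda>u. b u v) P')" for P' v
    using ppair_var[of b P' v 1] ppair_const[of b _ 1] by simp
  have "\<forall>P'\<in>polys V'. ppair b P' P = 0"
  proof (rule S.J_minimal[OF _ _ _ _ _ assms(2)])
    fix v w assume vw: "v \<in> V" "w \<in> V"
    show "\<forall>P'\<in>polys V'. ppair b P' (pvar (v + w) - pvar v - pvar w) = 0"
    proof
      fix P' assume P': "P' \<in> polys V'"
      have "cder (\<lambda>u. b u (v + w)) P' = pder (\<lambda>u. pconst (b u v) + pconst (b u w)) P'"
        by (rule pder_cong[OF P']) (use lin_right vw in \<open>auto simp: lin_on_def pconst_add\<close>)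
      then show "ppair b P' (pvar (v + w) - pvar v - pvar w) = 0"
        by (simp add: ppair_diff v pder_fun_add lookup_add)
    qed
  next
    fix c v assume vw: "v \<in> V"
    show "\<forall>P'\<in>polys V'. ppair b P' (pvar (scl c v) - pconst c * pvar v) = 0"
    proof
      fix P' assume P': "P' \<in> polys V'"
      have "cder (\<lambda>u. b u (scl c v)) P' = pder (\<lambda>u. pconst c * pconst (b u v)) P'"
        by (rule pder_cong[OF P']) (use lin_right vw in \<open>auto simp: lin_on_def pconst_mult\<close>)
      then show "ppair b P' (pvar (scl c v) - pconst c * pvar v) = 0"
        by (simp add: ppair_diff v pder_fun_times cterm_const_times ppair_scale)
    qed
  next
    fix P R assume P: "P \<in> polys V" "\<forall>P'\<in>polys V'. ppair b P' P = 0" and R: "R \<in> polys V"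
    from R show "\<forall>P'\<in>polys V'. ppair b P' (R * P) = 0"
      by (induction rule: cpoly_induct)
         (auto simp: P ppair_scale distrib_right ppair_add mult.assoc ppair_var cder_polys)
  qed (use ppair_const[of b _ 0] in \<open>auto simp: ppair_add\<close>)
  then show ?thesis using assms(1) by blast
qed

definition spair :: "'u cpoly set \<times> 'v cpoly set \<Rightarrow> complex" where
  "spair = restrict (\<lambda>(\<xi>', \<xi>). ppair b (SOME P'. P' \<in> \<xi>') (SOME P. P \<in> \<xi>))
     (carrier (sym_alg scl' V') \<times> carrier (sym_alg scl V))"

lemma spair_cls:
  assumes P': "P' \<in> polys V'" and P: "P \<in> polys V"
  shows "spair (cls scl' V' P', cls scl V P) = ppair b P' P"
proof -
  define R' where "R' = (SOME X. X \<in> cls scl' V' P')"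
  define R where "R = (SOME X. X \<in> cls scl V P)"
  have "R' \<in> cls scl' V' P'" unfolding R'_def by (rule someI, rule S'.cls_self)
  then have R': "R' - P' \<in> S'.J" by (simp add: S'.mem_cls)
  have "R \<in> cls scl V P" unfolding R_def by (rule someI, rule S.cls_self)
  then have R: "R - P \<in> S.J" by (simp add: S.mem_cls)
  have "ppair b R' R = ppair b (P' + (R' - P')) (P + (R - P))" by simp
  also have "\<dots> = ppair b P' P"
    unfolding ppair_add ppair_add_left
    using ppair_J_left[OF P R'] ppair_J_left[OF S.J_polys[OF R] R'] ppair_J_right[OF P' R] by simp
  finally show ?thesis using assms by (simp add: spair_def R'_def R_def)
qed

end

section \<open>Topology of the projective line\<close>

lemma eventually_analytic_at: "f analytic_on {x} \<Longrightarrow> \<forall>\<^sub>F w in nhds x. f analytic_on {w}"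
proof -
  assume "f analytic_on {x}"
  then obtain S where S: "open S" "x \<in> S" "f holomorphic_on S"
    by (meson analytic_at)
  then have "\<forall>\<^sub>F w in nhds x. w \<in> S" by (intro eventually_nhds_in_open)
  then show ?thesis by eventually_elim (use S analytic_at in blast)
qed

lemma open_plineD: "open S \<Longrightarrow> p \<in> S \<Longrightarrow> \<forall>\<^sub>F w in nhds 0. par p w \<in> S"
  by (simp add: open_pline_def)

lemma open_Fin: "open U \<Longrightarrow> open (Fin ` U)"
  unfolding open_pline_def
proof
  fix p assume U: "open U" and "p \<in> Fin ` U"
  then obtain a where a: "p = Fin a" "a \<in> U" by auto
  have "\<forall>\<^sub>F w in nhds 0. a + w \<in> U"
  proof -
    have "open ((\<lambda>w. a + w) -` U)" using U by (intro open_vimage continuous_intros)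
    then have "\<forall>\<^sub>F w in nhds 0. w \<in> (\<lambda>w. a + w) -` U" by (rule eventually_nhds_in_open) (use a in auto)
    then show ?thesis by simp
  qed
  then show "\<forall>\<^sub>F w in nhds 0. par p w \<in> Fin ` U" using a by (auto elim!: eventually_mono)
qed

lemma open_Infty_nhd: "open (insert Infty (Fin ` {z. norm z > r}))"
  unfolding open_pline_def
proof
  fix p assume p: "p \<in> insert Infty (Fin ` {z. norm z > r})"
  show "\<forall>\<^sub>F w in nhds 0. par p w \<in> insert Infty (Fin ` {z. norm z > r})"
  proof (cases p)
    case (Fin a)
    have "open {z::complex. norm z > r}" by (intro open_Collect_less continuous_intros)
    from open_plineD[OF open_Fin[OF this], of p] show ?thesis
      using p Fin by (auto elim: eventually_mono)
  next
    case Infty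
    have "\<forall>\<^sub>F w::complex in nhds 0. w \<in> ball 0 (1 / (\<bar>r\<bar> + 1))" by (rule eventually_nhds_in_open) auto
    then show ?thesis
    proof eventually_elim
      case (elim w)
      show ?case
      proof (cases "w = 0")
        case False
        have "norm w * (\<bar>r\<bar> + 1) < 1" using elim by (simp add: field_simps)
        then have "\<bar>r\<bar> + 1 < norm (1 / w)" using False by (simp add: norm_divide field_simps)
        then show ?thesis using Infty False by auto
      qed (use Infty in auto)
    qed
  qed
qed

text \<open>Separatedness makes the compact image of a closed curve closed.\<close>

instance pline :: t2_space
proof
  fix x y :: pline
  assume "x \<noteq> y"
  have sep: "\<exists>U V. open U \<and> open V \<and> Infty \<in> U \<and> Fin a \<in> V \<and> U \<inter> V = {}" for a
    by (rule exI[of _ "insert Infty (Fin ` {z. norm z > norm a + 1})"], rule exI[of _ "Fin ` ball 0 (norm a + 1)"])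
       (auto intro!: open_Infty_nhd open_Fin)
  show "\<exists>U V. open U \<and> open V \<and> x \<in> U \<and> y \<in> V \<and> U \<inter> V = {}"
  proof (cases x; cases y)
    fix a b assume ab: "x = Fin a" "y = Fin b"
    then obtain U V where "open U" "open V" "a \<in> U" "b \<in> V" "U \<inter> V = {}"
      using \<open>x \<noteq> y\<close> separation_t2[of a b] by auto
    then show ?thesis using ab
      by (intro exI[of _ "Fin ` U"] exI[of _ "Fin ` V"]) (auto intro: open_Fin)
  next
    fix a assume "x = Fin a" "y = Infty" then show ?thesis using sep[of a] by blast
  next
    fix a assume "x = Infty" "y = Fin a" then show ?thesis using sep[of a] by blast
  next
    assume "x = Infty" "y = Infty" then show ?thesis using \<open>x \<noteq> y\<close> by simp
  qed
qed

lemma closed_range_curve: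
  assumes "smooth_simple_closed_curve \<gamma>"
  shows "closed (range \<gamma>)"
proof -
  have "\<gamma> t \<in> \<gamma> ` {0..1}" for t
  proof -
    have "\<gamma> t = \<gamma> (frac t)" using assms
      by (auto simp: smooth_simple_closed_curve_def frac_def)
    then show ?thesis using frac_ge_0[of t] frac_lt_1[of t] by force
  qed
  then have "range \<gamma> = \<gamma> ` {0..1}" by auto
  moreover have "compact (\<gamma> ` {0..1})"
    using assms by (intro compact_continuous_image) (auto simp: smooth_simple_closed_curve_def intro: continuous_on_subset)
  ultimately show ?thesis by (simp add: compact_imp_closed)
qed

text \<open>Components are relatively closed; as there are only two, each is the complement of the other in
  \<open>S\<close>, so both are also open.\<close>

lemma two_components_open:
  fixes S D D' :: "pline set"
  assumes "open S" "components S = {D, D'}" "D \<noteq> D'"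
  shows "open D" "open D'" "D \<inter> D' = {}" "D \<noteq> {}" "D' \<noteq> {}"
proof -
  show ne: "D \<noteq> {}" "D' \<noteq> {}" using assms(2) in_components_nonempty by blast+
  show disj: "D \<inter> D' = {}" using assms components_nonoverlap[of D S D'] by auto
  have un: "S = D \<union> D'" using Union_components[of S] assms(2) by auto
  have c: "closedin (top_of_set S) D" "closedin (top_of_set S) D'"
    using closedin_component assms(2) by blast+
  have "openin (top_of_set S) (S - D)" "openin (top_of_set S) (S - D')"
    using c by (simp_all add: openin_diff)
  moreover have "S - D = D'" "S - D' = D" using un disj by auto
  ultimately show "open D" "open D'" using assms(1) by (auto simp: openin_open_eq)
qed

section \<open>Lie derivatives of sections and jets\<close>

definition regular_at :: "(pline \<Rightarrow> complex) \<Rightarrow> pline \<Rightarrow> bool" where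
  "regular_at \<omega> p \<longleftrightarrow> pull p \<omega> analytic_on {0}"

text \<open>The \<open>k\<close>-th derivative at \<open>p\<close>, in the standard coordinate centred at \<open>p\<close>, of the coefficient of
  a section of the canonical bundle.\<close>

definition jet :: "pline \<Rightarrow> nat \<Rightarrow> (pline \<Rightarrow> complex) \<Rightarrow> complex" where
  "jet p k \<omega> = (deriv ^^ k) (pull p \<omega>) 0"

lemma jet_0 [simp]: "jet p 0 \<omega> = \<omega> p" by (simp add: jet_def)

text \<open>The change of coordinate between the chart at \<open>p\<close> and the chart at a nearby point.  Having it
  with the cocycle rule for \<open>jac\<close> treats the finite points and the point at infinity alike.\<close>

lemma chart_transition:
  obtains \<tau> where "\<tau> analytic_on {0}" "\<tau> 0 = w"
    "\<forall>\<^sub>F v in nhds 0. par (par p w) v = par p (\<tau> v) \<and> jac (par p w) v = jac p (\<tau> v) * deriv \<tau> v"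
proof -
  consider "w = 0" | a where "p = Fin a" | "p = Infty" "w \<noteq> 0" by (cases p) auto
  then show ?thesis
  proof cases
    case 1
    then show ?thesis by (intro that[of "\<lambda>v. v"]) auto
  next
    case 2
    have "deriv (\<lambda>v. w + v) v = 1" for v
      by (rule DERIV_imp_deriv) (auto intro!: derivative_eq_intros)
    then show ?thesis using 2
      by (intro that[of "\<lambda>v. w + v"]) (auto intro!: analytic_intros simp: add.assoc)
  next
    case 3
    define \<tau> where "\<tau> = (\<lambda>v. 1 / (1 / w + v))"
    have "\<forall>\<^sub>F v in nhds 0. v \<in> ball 0 (norm (1 / w))"
      by (rule eventually_nhds_in_open) (use 3 in auto)
    then have "\<forall>\<^sub>F v in nhds 0. par (par p w) v = par p (\<tau> v) \<and> jac (par p w) v = jac p (\<tau> v) * deriv \<tau> v"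
    proof eventually_elim
      case (elim v)
      have nz: "1 / w + v \<noteq> 0"
      proof
        assume "1 / w + v = 0"
        then have "1 / w = - v" by (simp add: eq_neg_iff_add_eq_0)
        then show False using elim by simp
      qed
      have "(\<tau> has_field_derivative (- 1 / (1 / w + v)\<^sup>2)) (at v)"
        unfolding \<tau>_def using nz by (auto intro!: derivative_eq_intros simp: power2_eq_square)
      then have "deriv \<tau> v = - 1 / (1 / w + v)\<^sup>2" by (rule DERIV_imp_deriv)
      then show ?case using 3 nz by (simp add: \<tau>_def power_divide)
    qed
    then show ?thesis using 3
      by (intro that[of \<tau>]) (auto simp: \<tau>_def intro!: analytic_intros)
  qed
qed

lemma regular_at_par:
  assumes "pull p \<omega> analytic_on {w}"
  shows "regular_at \<omega> (par p w)"
proof -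
  obtain \<tau> where \<tau>: "\<tau> analytic_on {0}" "\<tau> 0 = w"
    and ev: "\<forall>\<^sub>F v in nhds 0. par (par p w) v = par p (\<tau> v) \<and> jac (par p w) v = jac p (\<tau> v) * deriv \<tau> v"
    by (rule chart_transition)
  have "(\<lambda>v. (pull p \<omega> \<circ> \<tau>) v * deriv \<tau> v) analytic_on {0}"
    using assms \<tau> by (intro analytic_on_mult analytic_on_compose analytic_deriv) auto
  moreover have "\<forall>\<^sub>F v in nhds 0. (pull p \<omega> \<circ> \<tau>) v * deriv \<tau> v = pull (par p w) \<omega> v"
    using ev by eventually_elim (simp add: pull_def)
  ultimately show ?thesis
    unfolding regular_at_def by (subst (asm) analytic_at_cong) auto
qed

lemma pull_vec_times_pull: "pull_vec p X w * pull p \<omega> w = X (par p w) * \<omega> (par p w)"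
  by (simp add: pull_vec_def pull_def)

lemma contraction_analytic:
  assumes "regular_vector_field X" "regular_at \<omega> p"
  shows "(\<lambda>w. X (par p w) * \<omega> (par p w)) analytic_on {0}"
  using assms unfolding pull_vec_times_pull[symmetric, abs_def]
  by (auto simp: regular_vector_field_def regular_at_def intro!: analytic_intros)

text \<open>In a chart the Lie derivative of \<open>f dw\<close> is \<open>(X f)' dw\<close>, not only at the centre but in a
  neighbourhood, since the contraction \<open>X f\<close> is a function and does not depend on the chart.\<close>

lemma pull_lie_section:
  assumes X: "regular_vector_field X" and \<omega>: "regular_at \<omega> p"
  shows "\<forall>\<^sub>F w in nhds 0. pull p (lie_section X \<omega>) w = deriv (\<lambda>u. pull_vec p X u * pull p \<omega> u) w"
  using eventually_analytic_at[OF contraction_analytic[OF assms]]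
proof eventually_elim
  case (elim w)
  define h where "h = (\<lambda>u. X (par p u) * \<omega> (par p u))"
  obtain \<tau> where \<tau>: "\<tau> analytic_on {0}" "\<tau> 0 = w"
    and ev: "\<forall>\<^sub>F v in nhds 0. par (par p w) v = par p (\<tau> v) \<and> jac (par p w) v = jac p (\<tau> v) * deriv \<tau> v"
    by (rule chart_transition)
  have "lie_section X \<omega> (par p w) = deriv (h \<circ> \<tau>) 0"
    unfolding lie_section_def
    by (rule deriv_cong_ev) (use ev in \<open>auto simp: h_def elim: eventually_mono\<close>)
  also have "\<dots> = deriv h w * deriv \<tau> 0"
    using \<tau> elim by (subst deriv_chain) (auto simp: h_def analytic_on_imp_differentiable_at)
  finally have "lie_section X \<omega> (par p w) * jac p w = deriv h w * (jac p w * deriv \<tau> 0)" by simp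
  also have "jac p w * deriv \<tau> 0 = 1" using eventually_nhds_x_imp_x[OF ev] \<tau>(2) by simp
  finally show ?case by (simp add: pull_def[of p "lie_section X \<omega>"] h_def pull_vec_times_pull)
qed

lemma regular_at_lie_section:
  assumes X: "regular_vector_field X" and \<omega>: "regular_at \<omega> p"
  shows "regular_at (lie_section X \<omega>) p"
proof -
  have "deriv (\<lambda>u. pull_vec p X u * pull p \<omega> u) analytic_on {0}"
    using contraction_analytic[OF assms] unfolding pull_vec_times_pull by (rule analytic_deriv)
  then show ?thesis unfolding regular_at_def
    using analytic_at_cong[OF pull_lie_section[OF assms] refl] by simp
qed

lemma regular_at_lie_iter:
  assumes X: "regular_vector_field X" and \<omega>: "regular_at \<omega> p"
  shows "regular_at ((lie_section X ^^ N) \<omega>) p"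
  using \<omega> by (induction N) (auto intro: regular_at_lie_section[OF X])

lemma lie_section_cong:
  assumes "open U" "y \<in> U" "\<And>y. y \<in> U \<Longrightarrow> \<omega> y = \<omega>' y"
  shows "lie_section X \<omega> y = lie_section X \<omega>' y"
proof -
  have "\<forall>\<^sub>F w in nhds 0. X (par y w) * \<omega> (par y w) = X (par y w) * \<omega>' (par y w)"
    using open_plineD[OF assms(1,2)] by eventually_elim (use assms(3) in auto)
  then show ?thesis unfolding lie_section_def by (rule deriv_cong_ev) simp
qed

lemma lie_iter_cong:
  assumes U: "open U" and eq: "\<And>y. y \<in> U \<Longrightarrow> \<omega> y = \<omega>' y"
  shows "y \<in> U \<Longrightarrow> (lie_section X ^^ N) \<omega> y = (lie_section X ^^ N) \<omega>' y"
proof (induction N arbitrary: y)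
  case (Suc N)
  show ?case unfolding funpow.simps o_apply
    by (rule lie_section_cong[OF U Suc.prems Suc.IH])
qed (use eq in auto)

lemma lie_section_derivative:
  assumes X: "regular_vector_field X" and \<omega>: "regular_at \<omega> p"
  shows "((\<lambda>w. X (par p w) * \<omega> (par p w)) has_field_derivative lie_section X \<omega> p) (at 0)"
  unfolding lie_section_def
  by (rule analytic_derivI[OF contraction_analytic[OF assms]])

lemma lie_section_sum:
  assumes X: "regular_vector_field X" and \<omega>: "\<And>i. i \<in> A \<Longrightarrow> regular_at (\<omega> i) p"
  shows "lie_section X (\<lambda>y. \<Sum>i\<in>A. c i * \<omega> i y) p = (\<Sum>i\<in>A. c i * lie_section X (\<omega> i) p)"
proof -
  have "((\<lambda>w. \<Sum>i\<in>A. c i * (X (par p w) * \<omega> i (par p w))) has_field_derivative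
      (\<Sum>i\<in>A. c i * lie_section X (\<omega> i) p)) (at 0)"
    by (intro DERIV_sum DERIV_cmult lie_section_derivative X \<omega>)
  from DERIV_imp_deriv[OF this] show ?thesis
    by (simp add: lie_section_def sum_distrib_left mult_ac)
qed

lemma lie_iter_sum:
  assumes U: "open U" and X: "regular_vector_field X"
    and \<omega>: "\<And>i y. i \<in> A \<Longrightarrow> y \<in> U \<Longrightarrow> regular_at (\<omega> i) y"
  shows "y \<in> U \<Longrightarrow> (lie_section X ^^ N) (\<lambda>y. \<Sum>i\<in>A. c i * \<omega> i y) y
    = (\<Sum>i\<in>A. c i * (lie_section X ^^ N) (\<omega> i) y)"
proof (induction N arbitrary: y)
  case (Suc N)
  have "(lie_section X ^^ Suc N) (\<lambda>y. \<Sum>i\<in>A. c i * \<omega> i y) y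
      = lie_section X (\<lambda>y. \<Sum>i\<in>A. c i * (lie_section X ^^ N) (\<omega> i) y) y"
    unfolding funpow.simps o_apply by (rule lie_section_cong[OF U Suc.prems Suc.IH])
  also have "\<dots> = (\<Sum>i\<in>A. c i * (lie_section X ^^ Suc N) (\<omega> i) y)"
    using Suc \<omega> by (subst lie_section_sum[OF X]) (auto intro: regular_at_lie_iter[OF X])
  finally show ?case .
qed auto

text \<open>An iterated Lie derivative at a point is a differential operator applied to the coefficient, so its
  value is a linear combination of derivatives with coefficients that depend on the vector field
  only.  The induction on \<open>N\<close> goes through for all jets simultaneously, by the Leibniz rule.\<close>

lemma jet_lie_iter:
  assumes X: "regular_vector_field X"
  shows "\<exists>(n::nat) c. \<forall>\<omega>. regular_at \<omega> z \<longrightarrow>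
    jet z m ((lie_section X ^^ N) \<omega>) = (\<Sum>k\<le>n. c k * jet z k \<omega>)"
proof -
  \<comment> \<open>the functionals that are finite combinations of jets at \<open>z\<close>\<close>
  define fin where "fin = (\<lambda>\<Phi> :: (pline \<Rightarrow> complex) \<Rightarrow> complex. \<exists>(n::nat) c. \<forall>\<omega>. regular_at \<omega> z \<longrightarrow>
    \<Phi> \<omega> = (\<Sum>k\<le>n. c k * jet z k \<omega>))"
  have jet: "fin (\<lambda>\<omega>. c * jet z k \<omega>)" for k c
  proof -
    have "(\<Sum>i\<le>k. (if i = k then c else 0) * jet z i \<omega>) = (\<Sum>i\<le>k. if i = k then c * jet z i \<omega> else 0)" for \<omega>
      by (intro sum.cong) auto
    then have "\<forall>\<omega>. c * jet z k \<omega> = (\<Sum>i\<le>k. (if i = k then c else 0) * jet z i \<omega>)" by simp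
    then show ?thesis unfolding fin_def
      by (intro exI[of _ k] exI[of _ "\<lambda>i. if i = k then c else 0"]) fast
  qed
  have add: "fin (\<lambda>\<omega>. \<Phi> \<omega> + \<Psi> \<omega>)" if "fin \<Phi>" "fin \<Psi>" for \<Phi> \<Psi>
  proof -
    obtain n c where 1: "\<And>\<omega>. regular_at \<omega> z \<Longrightarrow> \<Phi> \<omega> = (\<Sum>k\<le>n. c k * jet z k \<omega>)"
      using \<open>fin \<Phi>\<close> unfolding fin_def by blast
    obtain n' c' where 2: "\<And>\<omega>. regular_at \<omega> z \<Longrightarrow> \<Psi> \<omega> = (\<Sum>k\<le>n'. c' k * jet z k \<omega>)"
      using \<open>fin \<Psi>\<close> unfolding fin_def by blast
    have ext: "(\<Sum>k\<le>n. c k * jet z k \<omega>) = (\<Sum>k\<le>m. (if k \<le> n then c k else 0) * jet z k \<omega>)"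
      if "n \<le> m" for n m :: nat and c \<omega>
      using that by (intro sum.mono_neutral_cong_left) auto
    have "\<Phi> \<omega> + \<Psi> \<omega> = (\<Sum>k\<le>max n n'. ((if k \<le> n then c k else 0) + (if k \<le> n' then c' k else 0)) * jet z k \<omega>)"
      if "regular_at \<omega> z" for \<omega>
      unfolding 1[OF that] 2[OF that] distrib_right sum.distrib
      using ext[of n "max n n'" c \<omega>] ext[of n' "max n n'" c' \<omega>] by simp
    then show ?thesis unfolding fin_def
      by (intro exI[of _ "max n n'"] exI[of _ "\<lambda>k. (if k \<le> n then c k else 0) + (if k \<le> n' then c' k else 0)"]) simp
  qed
  have sum: "fin (\<lambda>\<omega>. \<Sum>i\<in>A. \<Phi> i \<omega>)" if "finite A" "\<And>i. i \<in> A \<Longrightarrow> fin (\<Phi> i)" for A :: "nat set" and \<Phi>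
    using that
  proof (induction A rule: finite_induct)
    case empty
    show ?case using jet[of 0] by simp
  next
    case (insert a A)
    then show ?case by (auto intro!: add)
  qed
  have step: "fin (\<lambda>\<omega>. c * jet z k (lie_section X \<omega>))" for k c
  proof -
    have "c * jet z k (lie_section X \<omega>) = (\<Sum>i\<in>{0..Suc k}. (c * of_nat (Suc k choose i) *
        (deriv ^^ i) (pull_vec z X) 0) * jet z (Suc k - i) \<omega>)" if w: "regular_at \<omega> z" for \<omega>
    proof -
      obtain S where S: "open S" "0 \<in> S" "pull_vec z X holomorphic_on S"
        using X unfolding regular_vector_field_def by (meson analytic_at)
      obtain T where T: "open T" "0 \<in> T" "pull z \<omega> holomorphic_on T"
        using w unfolding regular_at_def by (meson analytic_at)
      have "jet z k (lie_section X \<omega>) = (deriv ^^ k) (deriv (\<lambda>u. pull_vec z X u * pull z \<omega> u)) 0"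
        unfolding jet_def using pull_lie_section[OF X w] by (intro higher_deriv_cong_ev) auto
      also have "\<dots> = (deriv ^^ Suc k) (\<lambda>u. pull_vec z X u * pull z \<omega> u) 0"
        by (simp only: funpow_Suc_right o_apply)
      also have "\<dots> = (\<Sum>i = 0..Suc k. of_nat (Suc k choose i) * (deriv ^^ i) (pull_vec z X) 0 *
          (deriv ^^ (Suc k - i)) (pull z \<omega>) 0)"
        by (rule higher_deriv_mult[of _ "S \<inter> T"]) (use S T in \<open>auto intro: holomorphic_on_subset\<close>)
      finally have "c * jet z k (lie_section X \<omega>) = (\<Sum>i = 0..Suc k. c * (of_nat (Suc k choose i) *
          (deriv ^^ i) (pull_vec z X) 0 * (deriv ^^ (Suc k - i)) (pull z \<omega>) 0))"
        by (simp only: sum_distrib_left)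
      then show ?thesis by (simp only: jet_def mult.assoc)
    qed
    then have "fin (\<lambda>\<omega>. c * jet z k (lie_section X \<omega>)) \<longleftrightarrow> fin (\<lambda>\<omega>. \<Sum>i\<in>{0..Suc k}. (c * of_nat (Suc k choose i) *
        (deriv ^^ i) (pull_vec z X) 0) * jet z (Suc k - i) \<omega>)" unfolding fin_def by auto
    then show ?thesis by (rule iffD2) (rule sum, simp, rule jet)
  qed
  have "fin (\<lambda>\<omega>. jet z m ((lie_section X ^^ N) \<omega>))" for m
  proof (induction N)
    case 0
    show ?case using jet[of 1] by simp
  next
    case (Suc N)
    then obtain n :: nat and c where c: "\<And>\<omega>. regular_at \<omega> z \<Longrightarrow>
        jet z m ((lie_section X ^^ N) \<omega>) = (\<Sum>k\<le>n. c k * jet z k \<omega>)"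
      unfolding fin_def by blast
    have "jet z m ((lie_section X ^^ Suc N) \<omega>) = (\<Sum>k\<le>n. c k * jet z k (lie_section X \<omega>))"
      if "regular_at \<omega> z" for \<omega>
      using c[OF regular_at_lie_section[OF X that]] by (simp add: funpow_swap1)
    then have "fin (\<lambda>\<omega>. jet z m ((lie_section X ^^ Suc N) \<omega>)) \<longleftrightarrow>
        fin (\<lambda>\<omega>. \<Sum>k\<le>n. c k * jet z k (lie_section X \<omega>))" unfolding fin_def by auto
    then show ?case by (rule iffD2) (rule sum, simp, rule step)
  qed
  then show ?thesis unfolding fin_def .
qed

section \<open>Coefficients of forms\<close>

lemma regular_at_iff_not_pole: "regular_at (coeff \<alpha>) p \<longleftrightarrow> \<not> form_pole \<alpha> p"
  unfolding regular_at_def form_pole_def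
  using nicely_meromorphic_on_imp_analytic_at[OF coeff_nice] analytic_at_imp_no_pole by blast

text \<open>The operations on forms are normalised at removable singularities and hence known only off the
  centre of a chart; at regular points continuity recovers the value at the centre as well.\<close>

lemma coeff_eqI:
  assumes ev: "\<forall>\<^sub>F w in at 0. coeff \<gamma> (par q w) = f (par q w)" and f: "regular_at f q"
  shows "regular_at (coeff \<gamma>) q" "\<forall>\<^sub>F w in nhds 0. pull q (coeff \<gamma>) w = pull q f w"
proof -
  have ev': "\<forall>\<^sub>F w in at 0. pull q (coeff \<gamma>) w = pull q f w"
    using ev by eventually_elim (simp add: pull_def)
  have lim: "pull q f \<midarrow>0\<rightarrow> pull q f 0"
    using f unfolding regular_at_def by (meson analytic_at_imp_isCont isContD)
  then have lim': "pull q (coeff \<gamma>) \<midarrow>0\<rightarrow> pull q f 0"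
    using tendsto_cong[OF ev'] by simp
  then have "\<not> is_pole (pull q (coeff \<gamma>)) 0"
    by (meson is_pole_def at_neq_bot not_tendsto_and_filterlim_at_infinity)
  then show reg: "regular_at (coeff \<gamma>) q" by (simp add: regular_at_iff_not_pole form_pole_def)
  then have "pull q (coeff \<gamma>) \<midarrow>0\<rightarrow> pull q (coeff \<gamma>) 0"
    unfolding regular_at_def by (meson analytic_at_imp_isCont isContD)
  then have "pull q (coeff \<gamma>) 0 = pull q f 0" using lim' by (rule LIM_unique)
  then show "\<forall>\<^sub>F w in nhds 0. pull q (coeff \<gamma>) w = pull q f w"
    using ev' by (simp add: eventually_nhds_conv_at)
qed

lemma coeff_of_eventually:
  assumes "\<forall>\<^sub>F w in at 0. coeff \<gamma> (par q w) = f (par q w)" and f: "regular_at f q"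
  shows "coeff \<gamma> q = f q"
  using eventually_nhds_x_imp_x[OF coeff_eqI(2)[OF assms]] by simp

lemma jet_of_eventually:
  assumes "\<forall>\<^sub>F w in at 0. coeff \<gamma> (par q w) = f (par q w)" and f: "regular_at f q"
  shows "jet q k (coeff \<gamma>) = jet q k f"
  unfolding jet_def by (rule higher_deriv_cong_ev[OF coeff_eqI(2)[OF assms] refl])

lemma regular_at_fun_add:
  "regular_at f q \<Longrightarrow> regular_at g q \<Longrightarrow> regular_at (\<lambda>y. f y + g y) q"
proof -
  assume "regular_at f q" "regular_at g q"
  then have "(\<lambda>w. pull q f w + pull q g w) analytic_on {0}"
    unfolding regular_at_def by (intro analytic_intros)
  then show ?thesis by (simp add: regular_at_def pull_def[abs_def] distrib_right)
qed

lemma regular_at_fun_cmult: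
  "regular_at f q \<Longrightarrow> regular_at (\<lambda>y. c * f y) q"
proof -
  assume "regular_at f q"
  then have "(\<lambda>w. c * pull q f w) analytic_on {0}"
    unfolding regular_at_def by (intro analytic_intros)
  then show ?thesis by (simp add: regular_at_def pull_def[abs_def] mult.assoc)
qed

lemma jet_add:
  assumes "regular_at f q" "regular_at g q"
  shows "jet q k (\<lambda>y. f y + g y) = jet q k f + jet q k g"
proof -
  have "(deriv ^^ k) (\<lambda>w. pull q f w + pull q g w) 0 = jet q k f + jet q k g"
    unfolding jet_def using assms by (intro higher_deriv_add_at) (auto simp: regular_at_def)
  then show ?thesis by (simp add: jet_def pull_def[abs_def] distrib_right)
qed

lemma jet_cmult:
  assumes "regular_at f q"
  shows "jet q k (\<lambda>y. c * f y) = c * jet q k f"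
proof -
  have "(deriv ^^ k) (\<lambda>w. c * pull q f w) 0 = c * jet q k f"
    unfolding jet_def using assms by (intro higher_deriv_cmult') (auto simp: regular_at_def)
  then show ?thesis by (simp add: jet_def pull_def[abs_def] mult.assoc)
qed

lemma
  assumes "regular_at (coeff \<alpha>) q" "regular_at (coeff \<beta>) q"
  shows regular_add: "regular_at (coeff (\<alpha> + \<beta>)) q"
    and coeff_add: "coeff (\<alpha> + \<beta>) q = coeff \<alpha> q + coeff \<beta> q"
    and jet_coeff_add: "jet q k (coeff (\<alpha> + \<beta>)) = jet q k (coeff \<alpha>) + jet q k (coeff \<beta>)"
  using coeff_eqI(1)[OF ev_plus] coeff_of_eventually[OF ev_plus] jet_of_eventually[OF ev_plus]
    regular_at_fun_add[OF assms] jet_add[OF assms] by simp_all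

lemma
  assumes "regular_at (coeff \<alpha>) q"
  shows regular_scale: "regular_at (coeff (scale_form c \<alpha>)) q"
    and coeff_scale: "coeff (scale_form c \<alpha>) q = c * coeff \<alpha> q"
    and jet_coeff_scale: "jet q k (coeff (scale_form c \<alpha>)) = c * jet q k (coeff \<alpha>)"
  using coeff_eqI(1)[OF ev_scale] coeff_of_eventually[OF ev_scale] jet_of_eventually[OF ev_scale]
    regular_at_fun_cmult[OF assms] jet_cmult[OF assms] by simp_all

lemma regular_zero: "regular_at (coeff 0) q"
  by (rule coeff_eqI(1)[OF ev_zero]) (simp add: regular_at_def pull_def[abs_def])

lemma coeff_0 [simp]: "coeff 0 q = 0"
  by (rule coeff_of_eventually[OF ev_zero]) (simp add: regular_at_def pull_def[abs_def])

lemma residue_add_isolated: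
  assumes "isolated_singularity_at f z" "isolated_singularity_at g z"
  shows "residue (\<lambda>w. f w + g w) z = residue f z + residue g z"
proof -
  obtain r where r: "r > 0" "f analytic_on ball z r - {z}"
    using assms unfolding isolated_singularity_at_def by blast
  obtain s where s: "s > 0" "g analytic_on ball z s - {z}"
    using assms unfolding isolated_singularity_at_def by blast
  show ?thesis
    by (rule residue_add[of "ball z (min r s)"])
       (use r s in \<open>auto intro!: analytic_imp_holomorphic elim: analytic_on_subset\<close>)
qed

lemma residue_cmult_isolated:
  assumes "isolated_singularity_at f z"
  shows "residue (\<lambda>w. c * f w) z = c * residue f z"
proof -
  obtain r where r: "r > 0" "f analytic_on ball z r - {z}"
    using assms unfolding isolated_singularity_at_def by blast
  show ?thesis
    by (rule residue_lmul[of "ball z r"])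
       (use r in \<open>auto intro!: analytic_imp_holomorphic elim: analytic_on_subset\<close>)
qed

lemma residue_form_add:
  "residue (pull p (coeff (\<alpha> + \<beta>))) 0 = residue (pull p (coeff \<alpha>)) 0 + residue (pull p (coeff \<beta>)) 0"
proof -
  have "residue (pull p (coeff (\<alpha> + \<beta>))) 0 = residue (\<lambda>w. pull p (coeff \<alpha>) w + pull p (coeff \<beta>) w) 0"
    by (rule residue_cong[OF _ refl], use ev_plus[of \<alpha> \<beta> p] in eventually_elim) (simp add: pull_def distrib_right)
  also have "\<dots> = residue (pull p (coeff \<alpha>)) 0 + residue (pull p (coeff \<beta>)) 0"
    by (intro residue_add_isolated meromorphic_on_isolated_singularity coeff_mero)
  finally show ?thesis .
qed

lemma residue_form_scale:
  "residue (pull p (coeff (scale_form c \<alpha>))) 0 = c * residue (pull p (coeff \<alpha>)) 0"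
proof -
  have "residue (pull p (coeff (scale_form c \<alpha>))) 0 = residue (\<lambda>w. c * pull p (coeff \<alpha>) w) 0"
    by (rule residue_cong[OF _ refl], use ev_scale[of c \<alpha> p] in eventually_elim) (simp add: pull_def)
  also have "\<dots> = c * residue (pull p (coeff \<alpha>)) 0"
    by (intro residue_cmult_isolated meromorphic_on_isolated_singularity coeff_mero)
  finally show ?thesis .
qed

lemma KK_iff: "\<alpha> \<in> KK D \<longleftrightarrow> (\<forall>p. residue (pull p (coeff \<alpha>)) 0 = 0) \<and> (\<forall>p. p \<notin> D \<longrightarrow> regular_at (coeff \<alpha>) p)"
  by (auto simp: KK_def regular_at_iff_not_pole)

lemma KK_subspace: "mform.subspace (KK D)"
  unfolding mform.subspace_def
proof (intro conjI ballI allI)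
  have "residue (pull p (coeff 0)) 0 = 0" for p
    using residue_form_scale[of p 0 0] by simp
  then show "0 \<in> KK D" by (simp add: KK_iff regular_zero)
qed (auto simp: KK_iff residue_form_add residue_form_scale intro: regular_add regular_scale)

lemma KK_regular: "\<alpha> \<in> KK D \<Longrightarrow> p \<notin> D \<Longrightarrow> regular_at (coeff \<alpha>) p"
  by (simp add: KK_iff)

lemma sym_space_KK: "sym_space scale_form (KK D)"
  by unfold_locales (rule KK_subspace)

lemma lin_on_coeff: "q \<notin> D \<Longrightarrow> lin_on scale_form (KK D) (\<lambda>\<alpha>. coeff \<alpha> q)"
  by (simp add: lin_on_def coeff_add coeff_scale KK_regular)

lemma lin_on_jet: "q \<notin> D \<Longrightarrow> lin_on scale_form (KK D) (\<lambda>\<alpha>. jet q k (coeff \<alpha>))"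
  by (simp add: lin_on_def jet_coeff_add jet_coeff_scale KK_regular)

section \<open>The kernel\<close>

text \<open>\<open>gcoef p k\<close> is the coefficient of the \<open>k\<close>-th derivative at \<open>z = p\<close> of the form \<open>e\<^sub>z\<close>, where \<open>z\<close>
  is moved in the standard chart at \<open>p\<close>: in affine coordinates \<open>e\<^sub>z\<close> is \<open>- dx / (x - z)\<^sup>2\<close>,
  and with \<open>z = 1 / w\<close> and frame \<open>dw\<close> it becomes \<open>dx / (1 - x w)\<^sup>2\<close>.  At the pole the formula
  gives \<open>0\<close>, the dummy value of a normalised form.\<close>

fun gcoef :: "pline \<Rightarrow> nat \<Rightarrow> pline \<Rightarrow> complex" where
  "gcoef (Fin a) k (Fin x) = - fact (Suc k) / (x - a) ^ (k + 2)"
| "gcoef (Fin a) k Infty = (if k = 0 then 1 else 0)"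
| "gcoef Infty k (Fin x) = fact (Suc k) * x ^ k"
| "gcoef Infty k Infty = 0"

text \<open>The principal part at the pole has the same shape at finite points and at infinity.\<close>

lemma pull_gcoef_self: "pull p (gcoef p k) w = - fact (Suc k) / w ^ (k + 2)"
  by (cases p) (auto simp: pull_def power_divide power2_eq_square)

lemma pull_gcoef_FF: "pull (Fin x) (gcoef (Fin a) k) w = - fact (Suc k) / ((x - a) + 1 * w) ^ Suc (Suc k)"
  by (simp add: pull_def algebra_simps)

lemma pull_gcoef_IF: "pull (Fin x) (gcoef Infty k) w = fact (Suc k) * (x + w) ^ k"
  by (simp add: pull_def)

lemma pull_gcoef_FI: "pull Infty (gcoef (Fin a) k) w = fact (Suc k) * (w ^ k / (1 + (- a) * w) ^ Suc (Suc k))"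
proof (cases "w = 0")
  case False
  have "1 / w - a = (1 + (- a) * w) / w" using False by (simp add: field_simps)
  then have "(1 / w - a) ^ (k + 2) = (1 + (- a) * w) ^ Suc (Suc k) / w ^ (k + 2)"
    by (simp add: power_divide)
  then show ?thesis using False by (simp add: pull_def power2_eq_square)
qed (simp add: pull_def)

lemma regular_gcoef: "q \<noteq> p \<Longrightarrow> regular_at (gcoef p k) q"
proof (cases p; cases q)
  fix a x assume "q \<noteq> p" and [simp]: "p = Fin a" "q = Fin x"
  then have "x - a \<noteq> 0" by simp
  then show ?thesis unfolding regular_at_def
    by (simp only: \<open>p = _\<close> \<open>q = _\<close> pull_gcoef_FF[abs_def]) (intro analytic_intros; simp)
next
  fix a assume "p = Fin a" "q = Infty"
  then show ?thesis unfolding regular_at_def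
    by (simp only: pull_gcoef_FI[abs_def]) (intro analytic_intros; simp)
next
  fix x assume "p = Infty" "q = Fin x"
  then show ?thesis unfolding regular_at_def
    by (simp only: pull_gcoef_IF[abs_def]) (intro analytic_intros; simp)
qed auto

lemma is_pole_gcoef: "is_pole (pull p (gcoef p k)) 0"
proof -
  have "is_pole (\<lambda>w::complex. (- fact (Suc k)) / (w - 0) ^ (k + 2)) 0"
    by (rule is_pole_basic[of _ UNIV]) (auto simp del: fact_Suc)
  then show ?thesis by (simp add: pull_gcoef_self[abs_def])
qed

lemma gcoef_nice: "pull q (gcoef p k) nicely_meromorphic_on {0}"
proof (cases "q = p")
  case True
  have "(\<lambda>w::complex. - fact (Suc k) / w ^ (k + 2)) meromorphic_on {0}"
    by (intro meromorphic_intros)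
  then have "pull p (gcoef p k) meromorphic_on {0}" by (simp add: pull_gcoef_self[abs_def])
  then show ?thesis using True is_pole_gcoef[of p k]
    by (simp add: nicely_meromorphic_on_def) (simp add: pull_gcoef_self flip: pull_0)
next
  case False
  then show ?thesis using regular_gcoef[OF False] unfolding regular_at_def
    by (rule_tac analytic_on_imp_nicely_meromorphic_on)
qed

definition gform :: "pline \<Rightarrow> nat \<Rightarrow> mform" where
  "gform p k = Abs_mform (gcoef p k)"

lemma coeff_gform [simp]: "coeff (gform p k) = gcoef p k"
  unfolding gform_def using gcoef_nice by (subst Abs_mform_inverse) auto

text \<open>All poles have order at least two and a pure power as principal part, so there is no residue.\<close>

lemma gform_KK: "p \<in> D \<Longrightarrow> gform p k \<in> KK D"
proof -
  assume p: "p \<in> D"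
  have "residue (pull q (gcoef p k)) 0 = 0" for q
  proof (cases "q = p")
    case True
    have "residue (\<lambda>w::complex. - fact (Suc k) / w ^ Suc (Suc k)) 0 = (deriv ^^ Suc k) (\<lambda>w. - fact (Suc k)) 0 / fact (Suc k)"
      by (rule residue_holomorphic_over_power'[of UNIV]) auto
    also have "\<dots> = 0" by (simp add: higher_deriv_const del: funpow.simps)
    finally show ?thesis using True by (simp add: pull_gcoef_self[abs_def])
  next
    case False
    then obtain S where "open S" "0 \<in> S" "pull q (gcoef p k) holomorphic_on S"
      using regular_gcoef unfolding regular_at_def by (meson analytic_at)
    then show ?thesis by (rule residue_holo)
  qed
  moreover have "regular_at (gcoef p k) q" if "q \<notin> D" for q
    using regular_gcoef that p by metis
  ultimately show ?thesis by (simp add: KK_iff)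
qed

lemma higher_deriv_reciprocal_power:
  fixes c u :: complex
  assumes "c + u * w \<noteq> 0"
  shows "(deriv ^^ n) (\<lambda>w. 1 / (c + u * w) ^ Suc m) w
    = (- u) ^ n * fact (m + n) / fact m / (c + u * w) ^ Suc (m + n)"
  using assms
proof (induction n arbitrary: w)
  case (Suc n)
  have "open {w. c + u * w \<noteq> 0}" by (intro open_Collect_neq continuous_intros)
  then have "\<forall>\<^sub>F v in nhds w. v \<in> {w. c + u * w \<noteq> 0}"
    by (rule eventually_nhds_in_open) (use Suc in auto)
  then have "\<forall>\<^sub>F v in nhds w. (deriv ^^ n) (\<lambda>w. 1 / (c + u * w) ^ Suc m) v =
      (- u) ^ n * fact (m + n) / fact m / (c + u * v) ^ Suc (m + n)"
    by eventually_elim (use Suc.IH in auto)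
  then have "(deriv ^^ Suc n) (\<lambda>w. 1 / (c + u * w) ^ Suc m) w =
      deriv (\<lambda>v. (- u) ^ n * fact (m + n) / fact m / (c + u * v) ^ Suc (m + n)) w"
    by (simp only: funpow.simps o_apply) (rule deriv_cong_ev, auto)
  also have "\<dots> = (- u) ^ Suc n * fact (m + Suc n) / fact m / (c + u * w) ^ Suc (m + Suc n)"
  proof (rule DERIV_imp_deriv)
    define K where "K = (- u) ^ n * fact (m + n) / fact m"
    have y: "((\<lambda>y. K / y ^ Suc M) has_field_derivative (- K * of_nat (Suc M) / y ^ Suc (Suc M))) (at y)"
      if "y \<noteq> 0" for y :: complex and M
    proof -
      have "((\<lambda>y. K / y ^ Suc M) has_field_derivative
        (- K * (of_nat (Suc M) * y ^ M) / (y ^ Suc M * y ^ Suc M))) (at y)"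
        using that by (auto intro!: derivative_eq_intros simp del: power_Suc)
      moreover have "- K * (of_nat (Suc M) * y ^ M) / (y ^ Suc M * y ^ Suc M) = - K * of_nat (Suc M) / y ^ Suc (Suc M)"
        using that by (simp add: divide_simps)
      ultimately show ?thesis by simp
    qed
    have "((\<lambda>v. K / (c + u * v) ^ Suc (m + n)) has_field_derivative
        (- K * of_nat (Suc (m + n)) / (c + u * w) ^ Suc (Suc (m + n))) * u) (at w)"
      by (rule DERIV_chain2[OF y]) (use Suc.prems in \<open>auto intro!: derivative_eq_intros\<close>)
    moreover have "(- K * of_nat (Suc (m + n)) / (c + u * w) ^ Suc (Suc (m + n))) * u =
        (- u) ^ Suc n * fact (m + Suc n) / fact m / (c + u * w) ^ Suc (m + Suc n)"
      by (simp add: K_def)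
    ultimately show "((\<lambda>v. (- u) ^ n * fact (m + n) / fact m / (c + u * v) ^ Suc (m + n)) has_field_derivative
      (- u) ^ Suc n * fact (m + Suc n) / fact m / (c + u * w) ^ Suc (m + Suc n)) (at w)" by (simp only: K_def)
  qed
  finally show ?case .
qed simp

lemma higher_deriv_power_shift:
  fixes x :: complex
  shows "(deriv ^^ j) (\<lambda>w. (x + w) ^ k) w = (if j \<le> k then fact k / fact (k - j) * (x + w) ^ (k - j) else 0)"
proof (induction j arbitrary: w)
  case (Suc j)
  have "(deriv ^^ Suc j) (\<lambda>w. (x + w) ^ k) w =
    deriv (\<lambda>w. if j \<le> k then fact k / fact (k - j) * (x + w) ^ (k - j) else 0) w"
    unfolding funpow.simps o_apply Suc ..
  also have "\<dots> = (if Suc j \<le> k then fact k / fact (k - Suc j) * (x + w) ^ (k - Suc j) else 0)"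
  proof (cases "Suc j \<le> k")
    case True
    then obtain l where l: "k - j = Suc l" by (metis Suc_diff_le diff_Suc_Suc)
    then have l': "k - Suc j = l" by simp
    have "((\<lambda>w. C * (x + w) ^ Suc l) has_field_derivative C * (of_nat (Suc l) * (x + w) ^ l)) (at w)" for C
      by (auto intro!: derivative_eq_intros simp del: power_Suc)
    from this[of "fact k / fact (Suc l)"]
    have "((\<lambda>w. fact k / fact (Suc l) * (x + w) ^ Suc l) has_field_derivative
        fact k / fact l * (x + w) ^ l) (at w)"
      by (simp add: fact_Suc divide_simps del: of_nat_Suc power_Suc)
    then show ?thesis using True l l' by (auto intro: DERIV_imp_deriv)
  next
    case False
    then have "(\<lambda>w. if j \<le> k then fact k / fact (k - j) * (x + w) ^ (k - j) else 0) =
      (\<lambda>w. if j \<le> k then fact k else 0)" by (auto simp: fun_eq_iff)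
    then show ?thesis using False by simp
  qed
  finally show ?case .
qed simp

text \<open>The next three lemmas compute the mixed derivatives of the kernel for two finite points and for a
  finite point and infinity; their symmetry can be read off.\<close>

lemma jet_FF:
  assumes "x \<noteq> a"
  shows "jet (Fin x) j (gcoef (Fin a) k) = - ((-1) ^ j * fact (Suc k + j) / (x - a) ^ (k + j + 2))"
proof -
  have "(deriv ^^ j) (\<lambda>w. (- fact (Suc k)) * (1 / ((x - a) + 1 * w) ^ Suc (Suc k))) 0 =
    (- fact (Suc k)) * (deriv ^^ j) (\<lambda>w. 1 / ((x - a) + 1 * w) ^ Suc (Suc k)) 0"
    by (rule higher_deriv_cmult') (use assms in \<open>intro analytic_intros; simp\<close>)
  also have "\<dots> = - ((-1) ^ j * fact (Suc k + j) / (x - a) ^ (k + j + 2))"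
    using assms by (subst higher_deriv_reciprocal_power) (auto simp del: fact_Suc)
  finally show ?thesis unfolding jet_def pull_gcoef_FF[abs_def] by simp
qed

lemma jet_IF: "jet (Fin x) j (gcoef Infty k)
    = (if j \<le> k then fact (Suc k) * (fact k / fact (k - j)) * x ^ (k - j) else 0)"
proof -
  have "(deriv ^^ j) (\<lambda>w. fact (Suc k) * (x + w) ^ k) 0 = fact (Suc k) * (deriv ^^ j) (\<lambda>w. (x + w) ^ k) 0"
    by (rule higher_deriv_cmult') (intro analytic_intros)
  then show ?thesis unfolding jet_def pull_gcoef_IF[abs_def] higher_deriv_power_shift by simp
qed

lemma jet_FI: "jet Infty k (gcoef (Fin x) j)
    = (if j \<le> k then fact (Suc k) * (fact k / fact (k - j)) * x ^ (k - j) else 0)"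
proof -
  let ?r = "\<lambda>w. 1 / (1 + (- x) * w) ^ Suc (Suc j)"
  have "jet Infty k (gcoef (Fin x) j) = (deriv ^^ k) (\<lambda>w. fact (Suc j) * (w ^ j * ?r w)) 0"
    unfolding jet_def pull_gcoef_FI[abs_def] by simp
  also have "\<dots> = fact (Suc j) * (deriv ^^ k) (\<lambda>w. w ^ j * ?r w) 0"
    by (rule higher_deriv_cmult') (intro analytic_intros; simp)
  also have "(deriv ^^ k) (\<lambda>w. w ^ j * ?r w) 0 =
     (\<Sum>i = 0..k. of_nat (k choose i) * (deriv ^^ i) (\<lambda>w. w ^ j) 0 * (deriv ^^ (k - i)) ?r 0)"
    by (rule higher_deriv_mult_at; intro analytic_intros; simp)
  also have "\<dots> = (\<Sum>i = 0..k. if i = j then of_nat (k choose j) * fact j * (deriv ^^ (k - j)) ?r 0 else 0)"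
  proof (rule sum.cong[OF refl])
    fix i assume "i \<in> {0..k}"
    show "of_nat (k choose i) * (deriv ^^ i) (\<lambda>w. w ^ j) 0 * (deriv ^^ (k - i)) ?r 0 =
       (if i = j then of_nat (k choose j) * fact j * (deriv ^^ (k - j)) ?r 0 else 0)"
      using higher_deriv_power_shift[of i 0 j 0] by auto
  qed
  also have "\<dots> = (if j \<le> k then of_nat (k choose j) * fact j * (deriv ^^ (k - j)) ?r 0 else 0)"
    by (simp add: sum.delta)
  also have "(deriv ^^ (k - j)) ?r 0 = x ^ (k - j) * fact (Suc j + (k - j)) / fact (Suc j)"
    by (subst higher_deriv_reciprocal_power) simp_all
  finally show ?thesis
    by (auto simp: binomial_fact simp del: fact_Suc)
qed

text \<open>Mixed derivatives of the kernel in its two arguments commute.  This symmetry is what makes the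
  two definitions of the pairing of forms agree.\<close>

lemma jet_gcoef_sym: "p \<noteq> q \<Longrightarrow> jet q j (gcoef p k) = jet p k (gcoef q j)"
proof (cases p; cases q)
  fix a x assume "p \<noteq> q" and e: "p = Fin a" "q = Fin x"
  then have ne: "x \<noteq> a" "a \<noteq> x" by auto
  have "(a - x) ^ (j + k + 2) = ((-1) * (x - a)) ^ (k + j + 2)" by (simp add: add.commute)
  also have "\<dots> = (- 1) ^ (k + j) * (x - a) ^ (k + j + 2)" unfolding power_mult_distrib by simp
  finally have "(a - x) ^ (j + k + 2) = (- 1) ^ (k + j) * (x - a) ^ (k + j + 2)" .
  then show ?thesis unfolding e jet_FF[OF ne(1)] jet_FF[OF ne(2)]
    by (cases "even j"; cases "even k") (simp_all add: add.commute[of j k])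
qed (auto simp: jet_IF jet_FI)

section \<open>Partial fractions\<close>

lemma analytic_split_constant:
  assumes "h analytic_on {0}"
  obtains g where "g analytic_on {0}" "\<And>w. h w = h 0 + w * g w"
proof
  let ?g = "\<lambda>z. if z = 0 then deriv h 0 else (h z - h 0) / z"
  show "?g analytic_on {0}"
  proof (rule pole_theorem_analytic_0[where g = "\<lambda>z. h z - h 0" and a = 0])
    show "(\<lambda>z. h z - h 0) analytic_on {0}" using assms by (intro analytic_intros)
    show "\<exists>d>0. \<forall>w\<in>ball z d - {0}. h w - h 0 = (w - 0) * ?g w" for z
      by (rule exI[of _ 1]) auto
    have "deriv (\<lambda>z. h z - h 0) 0 = deriv h 0"
      using assms by (subst deriv_diff) (auto simp: analytic_on_imp_differentiable_at)
    then show "?g 0 = deriv (\<lambda>z. h z - h 0) 0" by simp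
  qed auto
  show "h w = h 0 + w * ?g w" for w by auto
qed

lemma not_pole_of_eventually:
  assumes "\<forall>\<^sub>F w in at 0. pull p (coeff \<alpha>) w = h w" "h analytic_on {0}"
  shows "regular_at (coeff \<alpha>) p"
  using assms(2) analytic_at_imp_no_pole is_pole_cong[OF assms(1) refl]
  by (auto simp: regular_at_iff_not_pole form_pole_def)

text \<open>The principal part is removed one order at a time.  The last step, from a simple pole to none, needs
  the vanishing of the residue, because no \<open>gform p k\<close> has a simple pole.\<close>

lemma remove_pole:
  assumes "residue (pull p (coeff \<alpha>)) 0 = 0"
    and "\<forall>\<^sub>F w in at 0. pull p (coeff \<alpha>) w = h w / w ^ n" and "h analytic_on {0}"
  shows "\<exists>\<sigma>\<in>mform.span (range (gform p)). regular_at (coeff (\<alpha> - \<sigma>)) p"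
  using assms
proof (induction n arbitrary: \<alpha> h)
  case 0
  then have "regular_at (coeff \<alpha>) p" by (intro not_pole_of_eventually[of p \<alpha> h]) auto
  then show ?case by (intro bexI[of _ 0]) (auto intro: mform.span_zero)
next
  case (Suc n)
  obtain g where g: "g analytic_on {0}" "\<And>w. h w = h 0 + w * g w"
    using analytic_split_constant[OF Suc.prems(3)] by blast
  have nz: "\<forall>\<^sub>F w::complex in at 0. w \<noteq> 0" by (simp add: eventually_at_filter)
  show ?case
  proof (cases n)
    case 0
    obtain S where S: "open S" "0 \<in> S" "h holomorphic_on S"
      using Suc.prems(3) by (meson analytic_at)
    have "residue (pull p (coeff \<alpha>)) 0 = residue (\<lambda>w. h w / w ^ Suc 0) 0"
      using Suc.prems(2) 0 by (intro residue_cong) auto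
    also have "\<dots> = h 0" using residue_holomorphic_over_power'[OF S, of 0] by simp
    finally have h0: "h 0 = 0" using Suc.prems(1) by simp
    have "\<forall>\<^sub>F w in at 0. pull p (coeff \<alpha>) w = g w"
      using Suc.prems(2) nz proof eventually_elim
      case (elim w)
      then show ?case using g(2)[of w] h0 0 by simp
    qed
    then have "regular_at (coeff \<alpha>) p" by (rule not_pole_of_eventually) (rule g(1))
    then show ?thesis by (intro bexI[of _ 0]) (auto intro: mform.span_zero)
  next
    case (Suc l)
    \<comment> \<open>chosen so that \<open>c\<close> times \<open>gform p l\<close> has the leading coefficient \<open>h 0\<close>\<close>
    define c where "c = - h 0 / fact (Suc l)"
    define \<beta> where "\<beta> = \<alpha> - scale_form c (gform p l)"
    have c: "c * (- fact (Suc l)) = h 0" by (simp add: c_def del: fact_Suc)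
    have \<beta>': "\<beta> = \<alpha> + scale_form (- c) (gform p l)" by (simp add: \<beta>_def)
    have "residue (pull p (gcoef p l)) 0 = 0"
      using gform_KK[of p UNIV l] by (simp add: KK_iff)
    then have "residue (pull p (coeff \<beta>)) 0 = 0"
      using Suc.prems(1) unfolding \<beta>' residue_form_add residue_form_scale by simp
    moreover have "\<forall>\<^sub>F w in at 0. pull p (coeff \<beta>) w = g w / w ^ n"
      using ev_plus[of \<alpha> "scale_form (- c) (gform p l)" p] ev_scale[of "- c" "gform p l" p] Suc.prems(2) nz
    proof eventually_elim
      case (elim w)
      have "pull p (coeff \<beta>) w = pull p (coeff \<alpha>) w - c * pull p (gcoef p l) w"
        using elim by (simp add: \<beta>' pull_def left_diff_distrib)
      also have "\<dots> = h w / w ^ Suc n - c * (- fact (Suc l)) / w ^ Suc n"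
        using elim(3) Suc by (simp only: pull_gcoef_self) (simp del: fact_Suc)
      also have "\<dots> = (h w - h 0) / w ^ Suc n" by (simp only: c diff_divide_distrib)
      also have "\<dots> = g w / w ^ n" using elim(4) g(2)[of w] by simp
      finally show ?case .
    qed
    ultimately obtain \<sigma> where \<sigma>: "\<sigma> \<in> mform.span (range (gform p))" "regular_at (coeff (\<beta> - \<sigma>)) p"
      using Suc.IH g(1) by blast
    have "scale_form c (gform p l) + \<sigma> \<in> mform.span (range (gform p))"
      by (intro mform.span_add[OF _ \<sigma>(1)] mform.span_scale mform.span_base) auto
    moreover have "\<alpha> - (scale_form c (gform p l) + \<sigma>) = \<beta> - \<sigma>" by (simp add: \<beta>_def)
    ultimately show ?thesis using \<sigma>(2) by metis
  qed
qed

lemma coeff_affine_nice: "(\<lambda>x. coeff \<alpha> (Fin x)) nicely_meromorphic_on UNIV"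
proof -
  have "(\<lambda>x. coeff \<alpha> (Fin x)) nicely_meromorphic_on {a}" for a
  proof -
    let ?f = "\<lambda>x. coeff \<alpha> (Fin x)"
    have e: "pull (Fin a) (coeff \<alpha>) = (\<lambda>w. ?f (a + w))" by (simp add: pull_def[abs_def])
    have nice: "(\<lambda>w. ?f (a + w)) nicely_meromorphic_on {0}" using coeff_nice[of "Fin a" \<alpha>] by (simp add: e)
    then have "?f meromorphic_on {a}" unfolding nicely_meromorphic_on_def meromorphic_on_def by simp
    moreover have "is_pole ?f a \<longleftrightarrow> is_pole (\<lambda>w. ?f (a + w)) 0" by (rule is_pole_shift_0)
    moreover have "?f \<midarrow>a\<rightarrow> ?f a \<longleftrightarrow> (\<lambda>w. ?f (a + w)) \<midarrow>0\<rightarrow> ?f a"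
      using LIM_offset_zero_iff[of a ?f] by simp
    ultimately show ?thesis using nice unfolding nicely_meromorphic_on_def by auto
  qed
  then show ?thesis unfolding nicely_meromorphic_on_def
    using meromorphic_on_meromorphic_at[of _ UNIV] by blast
qed

lemma form_zero_if_affine_zero:
  assumes "\<And>x. coeff \<alpha> (Fin x) = 0"
  shows "\<alpha> = 0"
proof (rule mform_eqI)
  fix p
  have "\<forall>\<^sub>F w::complex in at 0. w \<noteq> 0" by (simp add: eventually_at_filter)
  then show "\<forall>\<^sub>F w in at 0. coeff \<alpha> (par p w) = coeff 0 (par p w)"
    by eventually_elim (cases p; simp add: assms)
qed

lemma pull_affine: "pull (Fin a) \<omega> w = \<omega> (Fin (a + w))" by (simp add: pull_def)

lemma regular_affine: "regular_at (coeff \<alpha>) (Fin a) \<Longrightarrow> (\<lambda>x. coeff \<alpha> (Fin x)) analytic_on {a}"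
proof -
  assume "regular_at (coeff \<alpha>) (Fin a)"
  then have "(pull (Fin a) (coeff \<alpha>)) analytic_on ((\<lambda>x. x - a) ` {a})"
    by (simp add: regular_at_def)
  then have "(pull (Fin a) (coeff \<alpha>) \<circ> (\<lambda>x. x - a)) analytic_on {a}"
    by (intro analytic_on_compose) (auto intro!: analytic_intros)
  then show ?thesis by (simp add: o_def pull_affine)
qed

text \<open>A regular form is \<open>f dx\<close> with \<open>f\<close> entire, and regularity at infinity forces \<open>f\<close> to decay like
  \<open>1 / x\<^sup>2\<close>; Liouville's theorem applies.\<close>

theorem form_without_poles:
  assumes "\<And>p. regular_at (coeff \<alpha>) p"
  shows "\<alpha> = 0"
proof (rule form_zero_if_affine_zero)
  let ?f = "\<lambda>x. coeff \<alpha> (Fin x)"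
  have "?f holomorphic_on UNIV"
    using regular_affine[OF assms] by (intro analytic_imp_holomorphic) (subst analytic_on_analytic_at, simp)
  moreover have "(?f \<longlongrightarrow> 0) at_infinity"
  proof -
    have "pull Infty (coeff \<alpha>) \<midarrow>0\<rightarrow> pull Infty (coeff \<alpha>) 0"
      using assms[of Infty] unfolding regular_at_def by (meson analytic_at_imp_isCont isContD)
    then have "(\<lambda>w. - (w\<^sup>2) * pull Infty (coeff \<alpha>) w) \<midarrow>0\<rightarrow> - (0\<^sup>2) * pull Infty (coeff \<alpha>) 0"
      by (intro tendsto_intros)
    then have "(\<lambda>w. - (w\<^sup>2) * pull Infty (coeff \<alpha>) w) \<midarrow>0\<rightarrow> 0" by simp
    moreover have "\<forall>\<^sub>F w in at 0. (?f \<circ> inverse) w = - (w\<^sup>2) * pull Infty (coeff \<alpha>) w"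
      by (simp add: eventually_at_filter pull_def inverse_eq_divide)
    ultimately have "((?f \<circ> inverse) \<longlongrightarrow> 0) (at 0)" by (simp only: tendsto_cong)
    then show ?thesis by (simp add: lim_at_infinity_0)
  qed
  ultimately show "coeff \<alpha> (Fin x) = 0" for x by (rule Liouville_weak_0)
qed

lemma finite_poles: "finite {p. form_pole \<alpha> p}"
proof -
  let ?f = "\<lambda>x. coeff \<alpha> (Fin x)"
  have "isolated_singularity_at (pull Infty (coeff \<alpha>)) 0"
    by (rule meromorphic_on_isolated_singularity[OF coeff_mero])
  then obtain r where r: "r > 0" "pull Infty (coeff \<alpha>) analytic_on ball 0 r - {0}"
    unfolding isolated_singularity_at_def by blast
  have far: "regular_at (coeff \<alpha>) (Fin a)" if "norm a > 1 / r" for a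
  proof -
    have a: "a \<noteq> 0" using that r by auto
    then have "1 / a \<in> ball 0 r - {0}" using that r by (simp add: norm_divide field_simps)
    then have "pull Infty (coeff \<alpha>) analytic_on {1 / a}" using r(2) by (auto intro: analytic_on_subset)
    then show ?thesis using regular_at_par[of Infty "coeff \<alpha>" "1 / a"] a by simp
  qed
  have "{a. \<not> ?f analytic_on {a}} sparse_in cball 0 (1 / r)"
    using coeff_affine_nice[of \<alpha>] unfolding nicely_meromorphic_on_def
    by (intro meromorphic_on_imp_sparse_singularities) (auto intro: meromorphic_on_subset)
  then have fin: "finite (cball 0 (1 / r) \<inter> {a. \<not> ?f analytic_on {a}})"
    by (rule sparse_in_compact_finite) simp
  have "{p. form_pole \<alpha> p} \<subseteq> insert Infty (Fin ` (cball 0 (1 / r) \<inter> {a. \<not> ?f analytic_on {a}}))"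
  proof
    fix p assume p: "p \<in> {p. form_pole \<alpha> p}"
    show "p \<in> insert Infty (Fin ` (cball 0 (1 / r) \<inter> {a. \<not> ?f analytic_on {a}}))"
    proof (cases p)
      case (Fin a)
      have nr: "\<not> regular_at (coeff \<alpha>) (Fin a)" using p Fin by (simp add: regular_at_iff_not_pole)
      have "\<not> ?f analytic_on {a}"
      proof
        assume "?f analytic_on {a}"
        then have "(?f \<circ> (\<lambda>w. a + w)) analytic_on {0}"
          by (intro analytic_on_compose) (auto intro!: analytic_intros)
        then show False using nr by (simp add: regular_at_def pull_def[abs_def] o_def)
      qed
      moreover have "norm a \<le> 1 / r" using far nr by force
      ultimately show ?thesis using Fin by auto
    qed simp
  qed
  then show ?thesis by (rule finite_subset) (use fin in auto)
qed

lemma span_gform_regular: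
  assumes "\<sigma> \<in> mform.span (range (gform p))" "q \<noteq> p"
  shows "regular_at (coeff \<sigma>) q"
  using assms(1)
proof (induction rule: mform.span_induct_alt)
  case base
  show ?case by (rule regular_zero)
next
  case (step c x y)
  then have "regular_at (coeff x) q" using regular_gcoef[OF assms(2)] by auto
  then show ?case using step by (intro regular_add regular_scale)
qed

lemma span_gform_KK: "mform.span {gform p k | p k. p \<in> D} \<subseteq> KK D"
  by (rule mform.span_minimal[OF _ KK_subspace]) (auto intro: gform_KK)

text \<open>Partial fractions: after removal of all principal parts a form without poles remains, and this is
  zero.  The poles are finite in number because they do not accumulate at infinity.\<close>

theorem KK_spanned:
  assumes "\<alpha> \<in> KK D"
  shows "\<alpha> \<in> mform.span {gform p k | p k. p \<in> D}"
  using assms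
proof (induction "card {p. form_pole \<alpha> p}" arbitrary: \<alpha> rule: less_induct)
  case less
  show ?case
  proof (cases "\<exists>p. form_pole \<alpha> p")
    case False
    then have "\<alpha> = 0" by (intro form_without_poles) (simp add: regular_at_iff_not_pole)
    then show ?thesis by (simp add: mform.span_zero)
  next
    case True
    then obtain p where p: "form_pole \<alpha> p" by blast
    then have pD: "p \<in> D" using less.prems by (auto simp: KK_def)
    have "isolated_singularity_at (pull p (coeff \<alpha>)) 0"
      by (rule meromorphic_on_isolated_singularity[OF coeff_mero])
    then obtain r where r: "r > 0" "pull p (coeff \<alpha>) analytic_on ball 0 r - {0}"
      unfolding isolated_singularity_at_def by blast
    define n where "n = nat (- zorder (pull p (coeff \<alpha>)) 0)"
    define h where "h = zor_poly (pull p (coeff \<alpha>)) 0"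
    obtain s where s: "s > 0" "h holomorphic_on cball 0 s"
      "\<And>w. w \<in> cball 0 s - {0} \<Longrightarrow> pull p (coeff \<alpha>) w = h w / w ^ n"
      using zorder_exist_pole[of "pull p (coeff \<alpha>)" "ball 0 r" 0] r p
      by (auto simp: form_pole_def n_def h_def analytic_imp_holomorphic)
    have "h analytic_on {0}"
      using s(1,2) by (meson analytic_at ball_subset_cball centre_in_ball holomorphic_on_subset open_ball)
    moreover have "\<forall>\<^sub>F w in at 0. pull p (coeff \<alpha>) w = h w / w ^ n"
    proof -
      have "\<forall>\<^sub>F w::complex in at 0. w \<in> ball 0 s - {0}"
        using s(1) by (intro eventually_at_in_open) auto
      then show ?thesis by eventually_elim (use s(3) in auto)
    qed
    moreover have "residue (pull p (coeff \<alpha>)) 0 = 0" using less.prems by (simp add: KK_iff)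
    ultimately obtain \<sigma> where \<sigma>: "\<sigma> \<in> mform.span (range (gform p))" "regular_at (coeff (\<alpha> - \<sigma>)) p"
      using remove_pole by blast
    have sub: "mform.span (range (gform p)) \<subseteq> mform.span {gform p k | p k. p \<in> D}"
      by (rule mform.span_mono) (use pD in auto)
    have "\<alpha> - \<sigma> \<in> KK D"
      using mform.subspace_diff[OF KK_subspace less.prems] \<sigma>(1) sub span_gform_KK by blast
    moreover have "regular_at (coeff (\<alpha> - \<sigma>)) q" if "\<not> form_pole \<alpha> q" for q
    proof (cases "q = p")
      case False
      have "regular_at (coeff (\<alpha> + scale_form (-1) \<sigma>)) q"
        using span_gform_regular[OF \<sigma>(1) False] that
        by (intro regular_add regular_scale) (simp_all add: regular_at_iff_not_pole)
      then show ?thesis by (simp add: mform.scale_minus_left)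
    qed (use \<sigma> in auto)
    then have "{q. form_pole (\<alpha> - \<sigma>) q} \<subset> {q. form_pole \<alpha> q}"
      using p \<sigma>(2) unfolding regular_at_iff_not_pole by blast
    then have "card {q. form_pole (\<alpha> - \<sigma>) q} < card {q. form_pole \<alpha> q}"
      by (rule psubset_card_mono[OF finite_poles])
    ultimately have "\<alpha> - \<sigma> \<in> mform.span {gform p k | p k. p \<in> D}" using less.hyps by blast
    then have "(\<alpha> - \<sigma>) + \<sigma> \<in> mform.span {gform p k | p k. p \<in> D}"
      using \<sigma>(1) sub by (intro mform.span_add) auto
    then show ?thesis by simp
  qed
qed

text \<open>The identity theorem for the meromorphic coefficient in the affine coordinate.\<close>

theorem KK_separated:
  assumes U: "open U" "U \<noteq> {}" and z: "\<And>y. y \<in> U \<Longrightarrow> coeff \<alpha> y = 0"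
  shows "\<alpha> = 0"
proof -
  let ?f = "\<lambda>x. coeff \<alpha> (Fin x)"
  obtain p where p: "p \<in> U" using U by blast
  have "\<exists>a. Fin a \<in> U"
  proof (cases p)
    case Infty
    have "\<forall>\<^sub>F w in at 0. par Infty w \<in> U" using open_plineD[OF U(1) p] Infty
      by (simp add: eventually_nhds_conv_at)
    moreover have "\<forall>\<^sub>F w::complex in at 0. w \<noteq> 0" by (simp add: eventually_at_filter)
    ultimately have "\<forall>\<^sub>F w in at (0::complex). Fin (1 / w) \<in> U"
      by eventually_elim simp
    then show ?thesis using eventually_happens by (metis at_neq_bot)
  qed (use p in auto)
  then obtain a where a: "Fin a \<in> U" by blast
  have "\<forall>\<^sub>F w in at 0. ?f (a + w) = 0"
    using open_plineD[OF U(1) a] by (auto simp: eventually_nhds_conv_at z elim: eventually_mono)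
  then have "\<forall>\<^sub>F x in at a. ?f x = 0"
    by (subst at_to_0) (simp add: eventually_filtermap add.commute)
  then have "frequently (\<lambda>x. ?f x = 0) (at a)" by (intro eventually_frequently) auto
  then have "?f w = 0" for w
    by (rule frequently_eq_meromorphic_imp_constant[OF _ coeff_affine_nice]) auto
  then show ?thesis by (rule form_zero_if_affine_zero)
qed

section \<open>The pairing of forms\<close>

lemma lin_on_gform_unique:
  assumes \<phi>: "lin_on scale_form (KK D) \<phi>" and \<psi>: "lin_on scale_form (KK D) \<psi>"
    and eq: "\<And>z k. z \<in> D \<Longrightarrow> \<phi> (gform z k) = \<psi> (gform z k)" and \<alpha>: "\<alpha> \<in> KK D"
  shows "\<phi> \<alpha> = \<psi> \<alpha>"
proof -
  have "mform.span {gform p k | p k. p \<in> D} \<subseteq> {\<alpha> \<in> KK D. \<phi> \<alpha> = \<psi> \<alpha>}"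
  proof (rule mform.span_minimal)
    show "{gform p k | p k. p \<in> D} \<subseteq> {\<alpha> \<in> KK D. \<phi> \<alpha> = \<psi> \<alpha>}"
      using eq by (auto simp: gform_KK)
    have 0: "\<phi> (scale_form 0 0) = 0 * \<phi> 0" "\<psi> (scale_form 0 0) = 0 * \<psi> 0"
      using \<phi> \<psi> mform.subspace_0[OF KK_subspace] unfolding lin_on_def by blast+
    show "mform.subspace {\<alpha> \<in> KK D. \<phi> \<alpha> = \<psi> \<alpha>}"
      using \<phi> \<psi> KK_subspace[of D] 0 unfolding mform.subspace_def lin_on_def by simp
  qed
  then show ?thesis using KK_spanned[OF \<alpha>] by blast
qed

text \<open>The functional on \<open>KK D'\<close> that pairing with \<open>\<alpha>\<close> has to be.  It is prescribed on the spanning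
  forms \<open>gform p k\<close>, so at most one exists; that one does exist is clear for \<open>\<alpha> = gform p k\<close> with
  \<open>p \<in> D\<close>, by symmetry of the kernel, and is inherited by linear combinations.\<close>

definition represents :: "pline set \<Rightarrow> mform \<Rightarrow> (mform \<Rightarrow> complex) \<Rightarrow> bool" where
  "represents D' \<alpha> \<phi> \<longleftrightarrow> lin_on scale_form (KK D') \<phi> \<and> (\<forall>p\<in>D'. \<forall>k. \<phi> (gform p k) = jet p k (coeff \<alpha>))"

definition form_pair :: "pline set \<Rightarrow> mform \<Rightarrow> mform \<Rightarrow> complex" where
  "form_pair D' \<alpha>' \<alpha> = (SOME \<phi>. represents D' \<alpha> \<phi>) \<alpha>'"

lemma represents_unique:
  assumes "represents D' \<alpha> \<phi>" "represents D' \<alpha> \<psi>" "\<alpha>' \<in> KK D'"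
  shows "\<phi> \<alpha>' = \<psi> \<alpha>'"
  by (rule lin_on_gform_unique[of D']) (use assms in \<open>simp_all add: represents_def\<close>)

context
  fixes D D' :: "pline set"
  assumes disj: "D \<inter> D' = {}"
begin

lemma represents_gform: "p \<in> D \<Longrightarrow> represents D' (gform p k) (\<lambda>\<alpha>'. jet p k (coeff \<alpha>'))"
  unfolding represents_def
proof (intro conjI ballI allI)
  assume p: "p \<in> D"
  then show "lin_on scale_form (KK D') (\<lambda>\<alpha>'. jet p k (coeff \<alpha>'))"
    using disj by (intro lin_on_jet) auto
  fix q j assume "q \<in> D'"
  then have "q \<noteq> p" using p disj by auto
  then show "jet p k (coeff (gform q j)) = jet q j (coeff (gform p k))"
    by (simp add: jet_gcoef_sym)
qed

lemma represents_add:
  assumes "\<alpha> \<in> KK D" "\<beta> \<in> KK D" "represents D' \<alpha> \<phi>" "represents D' \<beta> \<psi>"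
  shows "represents D' (\<alpha> + \<beta>) (\<lambda>\<alpha>'. \<phi> \<alpha>' + \<psi> \<alpha>')"
proof -
  have "jet p k (coeff (\<alpha> + \<beta>)) = jet p k (coeff \<alpha>) + jet p k (coeff \<beta>)" if "p \<in> D'" for p k
    using assms(1,2) that disj by (intro jet_coeff_add KK_regular[of _ D]) auto
  then show ?thesis using assms(3,4) by (auto simp: represents_def intro: lin_on_add)
qed

lemma represents_scale:
  assumes "\<alpha> \<in> KK D" "represents D' \<alpha> \<phi>"
  shows "represents D' (scale_form c \<alpha>) (\<lambda>\<alpha>'. c * \<phi> \<alpha>')"
proof -
  have "jet p k (coeff (scale_form c \<alpha>)) = c * jet p k (coeff \<alpha>)" if "p \<in> D'" for p k
    using assms(1) that disj by (intro jet_coeff_scale KK_regular[of _ D]) auto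
  then show ?thesis using assms(2) by (auto simp: represents_def intro: lin_on_cmult)
qed

lemma represents_exists: "\<alpha> \<in> KK D \<Longrightarrow> \<exists>\<phi>. represents D' \<alpha> \<phi>"
proof -
  assume \<alpha>: "\<alpha> \<in> KK D"
  have z: "represents D' 0 (\<lambda>_. 0)"
    using regular_zero by (auto simp: represents_def lin_on_def jet_def)
       (metis jet_def jet_coeff_scale mform.scale_zero_left mult_zero_left)
  have "mform.span {gform p k | p k. p \<in> D} \<subseteq> {\<alpha> \<in> KK D. \<exists>\<phi>. represents D' \<alpha> \<phi>}"
  proof (rule mform.span_minimal)
    show "{gform p k | p k. p \<in> D} \<subseteq> {\<alpha> \<in> KK D. \<exists>\<phi>. represents D' \<alpha> \<phi>}"
      using represents_gform by (auto simp: gform_KK)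
    show "mform.subspace {\<alpha> \<in> KK D. \<exists>\<phi>. represents D' \<alpha> \<phi>}"
      using KK_subspace[of D] z unfolding mform.subspace_def by (blast intro: represents_add represents_scale)
  qed
  then show ?thesis using KK_spanned[OF \<alpha>] by blast
qed

lemma represents_form_pair: "\<alpha> \<in> KK D \<Longrightarrow> represents D' \<alpha> (\<lambda>\<alpha>'. form_pair D' \<alpha>' \<alpha>)"
  unfolding form_pair_def using someI_ex[OF represents_exists] by simp

lemma form_pair_gform_right:
  "p \<in> D \<Longrightarrow> \<alpha>' \<in> KK D' \<Longrightarrow> form_pair D' \<alpha>' (gform p k) = jet p k (coeff \<alpha>')"
  using represents_unique[OF represents_form_pair[OF gform_KK] represents_gform] by blast

lemma form_pair_gform_left:
  "p \<in> D' \<Longrightarrow> \<alpha> \<in> KK D \<Longrightarrow> form_pair D' (gform p k) \<alpha> = jet p k (coeff \<alpha>)"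
  using represents_form_pair by (auto simp: represents_def)

lemma form_pair_lin_left: "\<alpha> \<in> KK D \<Longrightarrow> lin_on scale_form (KK D') (\<lambda>\<alpha>'. form_pair D' \<alpha>' \<alpha>)"
  using represents_form_pair by (auto simp: represents_def)

lemma form_pair_lin_right:
  assumes "\<alpha>' \<in> KK D'"
  shows "lin_on scale_form (KK D) (form_pair D' \<alpha>')"
  unfolding lin_on_def
proof (intro conjI ballI allI)
  fix \<alpha> \<beta> assume a: "\<alpha> \<in> KK D" "\<beta> \<in> KK D"
  then have "\<alpha> + \<beta> \<in> KK D" by (rule mform.subspace_add[OF KK_subspace])
  then show "form_pair D' \<alpha>' (\<alpha> + \<beta>) = form_pair D' \<alpha>' \<alpha> + form_pair D' \<alpha>' \<beta>"
    using represents_unique[OF represents_form_pair represents_add[OF a represents_form_pair represents_form_pair]] a assms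
    by blast
next
  fix c \<alpha> assume a: "\<alpha> \<in> KK D"
  then have "scale_form c \<alpha> \<in> KK D" by (rule mform.subspace_scale[OF KK_subspace])
  then show "form_pair D' \<alpha>' (scale_form c \<alpha>) = c * form_pair D' \<alpha>' \<alpha>"
    using represents_unique[OF represents_form_pair represents_scale[OF a represents_form_pair]] a assms
    by blast
qed

lemma sym_pair_forms: "sym_pair scale_form (KK D') scale_form (KK D) (form_pair D')"
  by (intro sym_pair.intro sym_space_KK sym_pair_axioms.intro form_pair_lin_left form_pair_lin_right)

end

section \<open>The form e in terms of coordinates\<close>

lemma kernel_algebra:
  fixes c X A s :: complex
  assumes "c \<noteq> 0" "X \<noteq> 0" "A \<noteq> 0"
  shows "- (- c / X\<^sup>2) / (- c * s / (X * A))\<^sup>2 * (- c / A\<^sup>2) = - 1 / s\<^sup>2"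
proof (cases "s = 0")
  case False
  then show ?thesis using assms by (simp add: divide_simps power_mult_distrib) (simp add: power2_eq_square)
qed simp

lemma reciprocal_neq: "w \<noteq> 1 / b \<Longrightarrow> 1 / w \<noteq> b" for w b :: complex
  by auto

text \<open>The normalisation of a form fills in single missing points, so the formula for the kernel
  need only be checked off one finite point, the pole of the coordinate.\<close>

lemma mform_of_kernel:
  assumes "\<And>x. x \<noteq> b \<Longrightarrow> F (Fin x) = gcoef z 0 (Fin x)"
  shows "mform_of F = gform z 0"
proof -
  have ev: "\<forall>\<^sub>F w in at 0. F (par p w) = gcoef z 0 (par p w)" for p
  proof (cases p)
    case (Fin a)
    have "\<forall>\<^sub>F w in at 0. w \<noteq> b - a" by (rule eventually_neq_at_within)
    then show ?thesis
    proof eventually_elim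
      case (elim w)
      then have "a + w \<noteq> b" by (auto simp: algebra_simps)
      then show ?case using assms Fin by simp
    qed
  next
    case Infty
    have "\<forall>\<^sub>F w::complex in at 0. w \<noteq> 0" "\<forall>\<^sub>F w in at 0. w \<noteq> 1 / b"
      by (rule eventually_neq_at_within)+
    then show ?thesis
    proof eventually_elim
      case (elim w)
      then have "1 / w \<noteq> b" by (intro reciprocal_neq)
      then show ?case using assms Infty elim by simp
    qed
  qed
  have "pull p F meromorphic_on {0}" for p
  proof -
    have "\<forall>\<^sub>F w in at 0. pull p F w = pull p (gcoef z 0) w"
      using ev[of p] by eventually_elim (simp add: pull_def)
    then show ?thesis
      using meromorphic_on_cong[of "{0}" "pull p F" "pull p (gcoef z 0)" "{0}"] gcoef_nice[of p z 0]
      by (simp add: nicely_meromorphic_on_def)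
  qed
  note spec = mform_of_spec(2)[OF this]
  show ?thesis
  proof (rule mform_eqI)
    fix p
    show "\<forall>\<^sub>F w in at 0. coeff (mform_of F) (par p w) = coeff (gform z 0) (par p w)"
      using spec[of p] ev[of p] by eventually_elim simp
  qed
qed

lemma nonpole_analytic: "mero_fun u \<Longrightarrow> \<not> fun_pole u p \<Longrightarrow> (u \<circ> par p) analytic_on {0}"
  unfolding mero_fun_def fun_pole_def using nicely_meromorphic_on_imp_analytic_at by blast

lemma affine_analytic:
  assumes "(u \<circ> par (Fin a)) analytic_on {0}"
  shows "(\<lambda>x. u (Fin x)) analytic_on {a}"
proof -
  have "((u \<circ> par (Fin a)) \<circ> (\<lambda>x. x - a)) analytic_on {a}"
    using assms by (intro analytic_on_compose) (auto intro!: analytic_intros)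
  then show ?thesis by (simp add: o_def)
qed

lemma simple_pole_form:
  assumes "f nicely_meromorphic_on {0}" "is_pole f 0" "zorder f 0 = -1"
  obtains h where "h analytic_on {0}" "h 0 \<noteq> 0" "\<forall>\<^sub>F w in at 0. f w = h w / w"
proof -
  have "isolated_singularity_at f 0"
    using assms(1) unfolding nicely_meromorphic_on_def by (blast intro: meromorphic_on_isolated_singularity)
  then obtain r where r: "r > 0" "f analytic_on ball 0 r - {0}"
    unfolding isolated_singularity_at_def by blast
  define h where "h = zor_poly f 0"
  obtain s where s: "s > 0" "h 0 \<noteq> 0" "h holomorphic_on cball 0 s"
      "\<And>w. w \<in> cball 0 s - {0} \<Longrightarrow> f w = h w / w"
    using zorder_exist_pole[of f "ball 0 r" 0] r assms
    by (auto simp: h_def analytic_imp_holomorphic)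
  have "h analytic_on {0}"
    using s(1,3) by (meson analytic_at ball_subset_cball centre_in_ball holomorphic_on_subset open_ball)
  moreover have "\<forall>\<^sub>F w in at 0. f w = h w / w"
  proof -
    have "\<forall>\<^sub>F w::complex in at 0. w \<in> ball 0 s - {0}"
      using s(1) by (intro eventually_at_in_open) auto
    then show ?thesis by eventually_elim (use s(4) in auto)
  qed
  ultimately show ?thesis using s(2) that by blast
qed

lemma Liouville_const:
  fixes f :: "complex \<Rightarrow> complex"
  assumes "\<And>a. f analytic_on {a}" "((\<lambda>w. f (1 / w)) \<longlongrightarrow> l) (at 0)"
  shows "f x = l"
proof -
  have "(\<lambda>x. f x - l) holomorphic_on UNIV"
    using assms(1) by (intro holomorphic_intros analytic_imp_holomorphic) (subst analytic_on_analytic_at, simp)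
  moreover have "((\<lambda>x. f x - l) \<longlongrightarrow> 0) at_infinity"
    using LIM_zero[OF assms(2)] by (simp add: lim_at_infinity_0 o_def inverse_eq_divide)
  ultimately have "f x - l = 0" by (rule Liouville_weak_0)
  then show ?thesis by simp
qed

text \<open>A meromorphic function with one simple pole is \<open>c x + d\<close> or \<open>c / (x - b) + d\<close>: subtracting the
  principal part leaves an entire function with a limit at infinity.\<close>

lemma coordinate_cases:
  assumes u: "coordinate u"
  obtains (affine) c d where "c \<noteq> 0" "fun_pole u Infty" "\<And>x. u (Fin x) = c * x + d"
  | (reciprocal) b c d where "c \<noteq> 0" "fun_pole u (Fin b)" "u Infty = d" "\<And>x. x \<noteq> b \<Longrightarrow> u (Fin x) = c / (x - b) + d"
proof -
  have mero: "mero_fun u" and ex: "\<exists>!p. fun_pole u p"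
    and zo: "\<And>p. fun_pole u p \<Longrightarrow> zorder (u \<circ> par p) 0 = -1"
    using u by (auto simp: coordinate_def)
  then obtain p where p: "fun_pole u p" and uniq: "\<And>q. q \<noteq> p \<Longrightarrow> \<not> fun_pole u q" by blast
  have an: "(u \<circ> par q) analytic_on {0}" if "q \<noteq> p" for q
    using nonpole_analytic[OF mero uniq[OF that]] .
  obtain h where h: "h analytic_on {0}" "h 0 \<noteq> 0" "\<forall>\<^sub>F w in at 0. (u \<circ> par p) w = h w / w"
    using simple_pole_form[of "u \<circ> par p"] mero p zo[OF p] by (auto simp: mero_fun_def fun_pole_def)
  obtain g where g: "g analytic_on {0}" "\<And>w. h w = h 0 + w * g w"
    using analytic_split_constant[OF h(1)] by blast
  have glim: "g \<midarrow>0\<rightarrow> g 0" using g(1) by (meson analytic_at_imp_isCont isContD)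
  have nz: "\<forall>\<^sub>F w::complex in at 0. w \<noteq> 0" by (simp add: eventually_at_filter)
  have hw: "h w / w = h 0 / w + g w" if "w \<noteq> 0" for w
    using g(2)[of w] that by (simp add: divide_simps)
  have main: "\<forall>\<^sub>F w in at 0. (u \<circ> par p) w - h 0 / w = g w"
    using h(3) nz by eventually_elim (simp add: hw)
  show thesis
  proof (cases p)
    case Infty
    let ?f = "\<lambda>x. u (Fin x) - h 0 * x"
    have "?f analytic_on {a}" for a
      using affine_analytic[OF an[of "Fin a"]] Infty by (intro analytic_intros) auto
    moreover have "\<forall>\<^sub>F w in at 0. ?f (1 / w) = g w"
      using main nz by eventually_elim (simp add: Infty)
    then have "((\<lambda>w. ?f (1 / w)) \<longlongrightarrow> g 0) (at 0)" using glim by (simp only: tendsto_cong)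
    ultimately have "?f x = g 0" for x by (rule Liouville_const)
    then have "u (Fin x) = h 0 * x + g 0" for x by (metis diff_add_cancel add.commute)
    then show ?thesis using affine h(2) p Infty by blast
  next
    case (Fin b)
    define f where "f = (\<lambda>x. if x = b then g 0 else u (Fin x) - h 0 / (x - b))"
    have ev: "\<forall>\<^sub>F w in nhds 0. f (b + w) = g w"
    proof -
      have "\<forall>\<^sub>F w in at 0. f (b + w) = g w"
        using main nz by eventually_elim (simp add: Fin f_def)
      then show ?thesis by (simp add: eventually_nhds_conv_at f_def)
    qed
    have "f analytic_on {a}" for a
    proof (cases "a = b")
      case True
      have "(\<lambda>w. f (b + w)) analytic_on {0}" using analytic_at_cong[OF ev refl] g(1) by simp
      then have "((\<lambda>w. f (b + w)) \<circ> (\<lambda>x. x - b)) analytic_on {b}"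
        by (intro analytic_on_compose) (auto intro!: analytic_intros)
      then show ?thesis using True by (simp add: o_def)
    next
      case False
      have "(\<lambda>x. u (Fin x) - h 0 / (x - b)) analytic_on {a}"
        using affine_analytic[OF an[of "Fin a"]] Fin False by (intro analytic_intros) auto
      moreover have "\<forall>\<^sub>F x in nhds a. x \<in> - {b}"
        by (rule eventually_nhds_in_open) (use False in auto)
      then have ev': "\<forall>\<^sub>F x in nhds a. u (Fin x) - h 0 / (x - b) = f x"
        by eventually_elim (simp add: f_def)
      ultimately show ?thesis using analytic_at_cong[OF ev' refl] by simp
    qed
    moreover have "((\<lambda>w. f (1 / w)) \<longlongrightarrow> u Infty) (at 0)"
    proof -
      have "(u \<circ> par Infty) analytic_on {0}" using an Fin by blast
      then have "(u \<circ> par Infty) \<midarrow>0\<rightarrow> (u \<circ> par Infty) 0"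
        by (meson analytic_at_imp_isCont isContD)
      moreover have "(\<lambda>w. h 0 * w / (1 - b * w)) \<midarrow>0\<rightarrow> h 0 * 0 / (1 - b * 0)"
        by (intro tendsto_intros) auto
      ultimately have "(\<lambda>w. (u \<circ> par Infty) w - h 0 * w / (1 - b * w)) \<midarrow>0\<rightarrow> u Infty"
        using tendsto_diff by fastforce
      moreover have "\<forall>\<^sub>F w in at 0. f (1 / w) = (u \<circ> par Infty) w - h 0 * w / (1 - b * w)"
        using nz eventually_neq_at_within[of "1 / b" 0 UNIV]
      proof eventually_elim
        case (elim w)
        then have "1 / w \<noteq> b" by (intro reciprocal_neq)
        moreover have "h 0 / (1 / w - b) = h 0 * w / (1 - b * w)"
        proof -
          have "1 / w - b = (1 - b * w) / w" using elim by (simp add: field_simps)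
          then show ?thesis by simp
        qed
        ultimately show ?case using elim by (simp add: f_def)
      qed
      ultimately show ?thesis by (simp only: tendsto_cong)
    qed
    ultimately have f: "f x = u Infty" for x by (rule Liouville_const)
    have "u (Fin x) = h 0 / (x - b) + u Infty" if "x \<noteq> b" for x
      using f[of x] that by (simp add: f_def algebra_simps)
    then show ?thesis using reciprocal[OF h(2), of b "u Infty"] p Fin by blast
  qed
qed

text \<open>The formula for \<open>e\<^sub>z\<close> is invariant under fractional linear substitutions; with the two normal forms
  this is a computation.\<close>

lemma kernel_of_coordinate:
  assumes u: "coordinate u" and z: "\<not> fun_pole u z"
  shows "mform_of (\<lambda>p. - deriv (u \<circ> par p) 0 / (u p - u z)\<^sup>2 * deriv (u \<circ> par z) 0) = gform z 0"
  using u
proof (cases rule: coordinate_cases)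
  case (affine c d)
  have d: "deriv (u \<circ> par (Fin x)) 0 = c" for x
  proof -
    have "u \<circ> par (Fin x) = (\<lambda>w. c * (x + w) + d)" by (simp add: o_def affine(3))
    then show ?thesis by (auto intro!: DERIV_imp_deriv derivative_eq_intros)
  qed
  obtain a where a: "z = Fin a" using affine(2) z by (cases z) auto
  show ?thesis
  proof (rule mform_of_kernel)
    fix x
    have "c * x + d - (c * a + d) = c * (x - a)" by (simp add: algebra_simps)
    then show "- deriv (u \<circ> par (Fin x)) 0 / (u (Fin x) - u z)\<^sup>2 * deriv (u \<circ> par z) 0 = gcoef z 0 (Fin x)"
      unfolding a d affine(3) using affine(1) by (simp add: power_mult_distrib power2_eq_square)
  qed
next
  case (reciprocal b c d)
  have der: "deriv (u \<circ> par (Fin x)) 0 = - c / (x - b)\<^sup>2" if "x \<noteq> b" for x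
  proof -
    have "\<forall>\<^sub>F w in nhds 0. w \<in> - {b - x}" by (rule eventually_nhds_in_open) (use that in auto)
    then have "\<forall>\<^sub>F w in nhds 0. (u \<circ> par (Fin x)) w = c / (x + w - b) + d"
    proof eventually_elim
      case (elim w)
      then have "x + w \<noteq> b" by (auto simp: algebra_simps)
      then show ?case by (simp add: reciprocal(4))
    qed
    then have "deriv (u \<circ> par (Fin x)) 0 = deriv (\<lambda>w. c / (x + w - b) + d) 0"
      by (rule deriv_cong_ev) simp
    also have "\<dots> = - c / (x - b)\<^sup>2"
      using that by (intro DERIV_imp_deriv) (auto intro!: derivative_eq_intros simp: power2_eq_square)
    finally show ?thesis .
  qed
  show ?thesis
  proof (rule mform_of_kernel)
    fix x assume x: "x \<noteq> b"
    show "- deriv (u \<circ> par (Fin x)) 0 / (u (Fin x) - u z)\<^sup>2 * deriv (u \<circ> par z) 0 = gcoef z 0 (Fin x)"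
    proof (cases z)
      case (Fin a)
      then have a: "a \<noteq> b" using reciprocal(2) z by auto
      define X where "X = x - b"
      define A where "A = a - b"
      have XA: "X \<noteq> 0" "A \<noteq> 0" "x - a = X - A" using x a by (auto simp: X_def A_def)
      have e: "c / X + d - (c / A + d) = - c * (X - A) / (X * A)"
        using XA by (simp add: field_simps)
      have "- (- c / X\<^sup>2) / (c / X + d - (c / A + d))\<^sup>2 * (- c / A\<^sup>2) = - 1 / (X - A)\<^sup>2"
        unfolding e by (rule kernel_algebra) (use XA reciprocal(1) in auto)
      then show ?thesis unfolding Fin der[OF x] der[OF a] reciprocal(4)[OF x] reciprocal(4)[OF a] gcoef.simps XA(3)
        by (simp add: X_def A_def power2_eq_square[of "x - a"])
    next
      case Infty
      have "\<forall>\<^sub>F w in nhds 0. 1 - b * w \<noteq> 0"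
      proof -
        have "open {w. 1 - b * w \<noteq> 0}" by (intro open_Collect_neq continuous_intros)
        then have "\<forall>\<^sub>F w in nhds 0. w \<in> {w. 1 - b * w \<noteq> 0}" by (rule eventually_nhds_in_open) auto
        then show ?thesis by simp
      qed
      then have "\<forall>\<^sub>F w in nhds 0. (u \<circ> par Infty) w = c * w / (1 - b * w) + d"
      proof eventually_elim
        case (elim w)
        show ?case
        proof (cases "w = 0")
          case False
          then have "1 / w \<noteq> b" using elim by (auto simp: field_simps)
          moreover have "1 / w - b = (1 - b * w) / w" using False by (simp add: field_simps)
          ultimately show ?thesis using False by (simp add: reciprocal(4))
        qed (simp add: reciprocal(3))
      qed
      then have "deriv (u \<circ> par Infty) 0 = deriv (\<lambda>w. c * w / (1 - b * w) + d) 0"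
        by (rule deriv_cong_ev) simp
      also have "\<dots> = c"
        by (intro DERIV_imp_deriv) (auto intro!: derivative_eq_intros)
      finally show ?thesis using Infty x reciprocal(1)
        by (simp add: der reciprocal(3,4) power_divide) (simp add: power2_eq_square)
    qed
  qed
qed

lemma reciprocal_simple_pole:
  "(\<lambda>w::complex. 1 / w) nicely_meromorphic_on {0}" "is_pole (\<lambda>w::complex. 1 / w) 0"
  "zorder (\<lambda>w::complex. 1 / w) 0 = -1"
proof -
  show p: "is_pole (\<lambda>w::complex. 1 / w) 0"
    using is_pole_inverse[of 0] by (simp add: inverse_eq_divide)
  have "(\<lambda>w::complex. 1 / w) meromorphic_on {0}" by (intro meromorphic_intros)
  then show "(\<lambda>w::complex. 1 / w) nicely_meromorphic_on {0}"
    using p by (simp add: nicely_meromorphic_on_def)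
  show "zorder (\<lambda>w::complex. 1 / w) 0 = -1"
    by (rule zorder_eqI[of UNIV 0 "\<lambda>_. 1"]) (auto simp: power_int_minus inverse_eq_divide)
qed

lemma coordinateI:
  assumes "\<And>q. q \<noteq> p \<Longrightarrow> (u \<circ> par q) analytic_on {0}" "u \<circ> par p = (\<lambda>w. 1 / w)"
  shows "coordinate u" "\<And>q. fun_pole u q \<longleftrightarrow> q = p"
proof -
  show *: "fun_pole u q \<longleftrightarrow> q = p" for q
    using assms reciprocal_simple_pole analytic_at_imp_no_pole by (auto simp: fun_pole_def)
  have "(u \<circ> par q) nicely_meromorphic_on {0}" for q
    using assms reciprocal_simple_pole by (cases "q = p") (auto intro: analytic_on_imp_nicely_meromorphic_on)
  then show "coordinate u" unfolding coordinate_def mero_fun_def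
    using * assms(2) reciprocal_simple_pole(3) by auto
qed

text \<open>Without a coordinate regular at \<open>z\<close> the definite description of \<open>e_form z\<close> would not determine a
  form; \<open>x\<close> and \<open>1 / x\<close> suffice.\<close>

lemma coordinate_exists: "\<exists>u. coordinate u \<and> \<not> fun_pole u z"
proof (cases z)
  case (Fin a)
  define u where "u = (\<lambda>p. case p of Fin x \<Rightarrow> x | Infty \<Rightarrow> 0)"
  have 1: "(u \<circ> par q) analytic_on {0}" if "q \<noteq> Infty" for q
  proof -
    obtain x where x: "q = Fin x" using \<open>q \<noteq> Infty\<close> by (cases q) auto
    have "(\<lambda>w. x + w) analytic_on {0}" by (intro analytic_intros)
    then show ?thesis by (simp add: x u_def o_def)
  qed
  have 2: "u \<circ> par Infty = (\<lambda>w. 1 / w)" by (auto simp: u_def fun_eq_iff)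
  show ?thesis using coordinateI[OF 1 2] Fin by blast
next
  case Infty
  define u where "u = (\<lambda>p. case p of Fin x \<Rightarrow> 1 / x | Infty \<Rightarrow> 0)"
  have 1: "(u \<circ> par q) analytic_on {0}" if "q \<noteq> Fin 0" for q
  proof (cases q)
    case (Fin x)
    then have "(\<lambda>w. 1 / (x + w)) analytic_on {0}" using that by (intro analytic_intros) auto
    then show ?thesis by (simp add: Fin u_def o_def)
  next
    case Infty
    have "u \<circ> par Infty = (\<lambda>w. w)" by (auto simp: u_def fun_eq_iff)
    then show ?thesis by (simp add: Infty)
  qed
  have 2: "u \<circ> par (Fin 0) = (\<lambda>w. 1 / w)" by (auto simp: u_def fun_eq_iff)
  show ?thesis using coordinateI[OF 1 2] Infty by blast
qed

theorem e_form_eq: "e_form z = gform z 0"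
  unfolding e_form_def
proof (rule the_equality)
  show "\<forall>u. coordinate u \<and> \<not> fun_pole u z \<longrightarrow> gform z 0 =
      mform_of (\<lambda>p. - deriv (u \<circ> par p) 0 / (u p - u z)\<^sup>2 * deriv (u \<circ> par z) 0)"
    using kernel_of_coordinate by simp
  fix \<epsilon>
  assume \<epsilon>: "\<forall>u. coordinate u \<and> \<not> fun_pole u z \<longrightarrow> \<epsilon> =
      mform_of (\<lambda>p. - deriv (u \<circ> par p) 0 / (u p - u z)\<^sup>2 * deriv (u \<circ> par z) 0)"
  obtain u where u: "coordinate u" "\<not> fun_pole u z" using coordinate_exists by blast
  then show "\<epsilon> = gform z 0" using \<epsilon> kernel_of_coordinate[OF u] by simp
qed

section \<open>Creation and annihilation operators\<close>

interpretation W: sym_space scale_form "KK D" for D by (rule sym_space_KK)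

abbreviation cl :: "pline set \<Rightarrow> mform cpoly \<Rightarrow> fock" where
  "cl D \<equiv> cls scale_form (KK D)"

lemma WW_cases:
  assumes "\<xi> \<in> carrier (WW D)"
  obtains P where "P \<in> polys (KK D)" "\<xi> = cl D P"
  using assms W.cls_cases unfolding WW_def by blast

lemma cl_carrier: "P \<in> polys (KK D) \<Longrightarrow> cl D P \<in> carrier (WW D)"
  by (simp add: WW_def)

lemma cl_add: "P \<in> polys (KK D) \<Longrightarrow> R \<in> polys (KK D) \<Longrightarrow> cl D P \<oplus>\<^bsub>WW D\<^esub> cl D R = cl D (P + R)"
  by (simp add: WW_def W.cls_add)

lemma cl_mult: "P \<in> polys (KK D) \<Longrightarrow> R \<in> polys (KK D) \<Longrightarrow> cl D P \<otimes>\<^bsub>WW D\<^esub> cl D R = cl D (P * R)"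
  by (simp add: WW_def W.cls_mult)

lemma vacuum_cl: "vacuum D = cl D 1"
  by (simp add: vacuum_def WW_def W.cls_1)

lemma zero_cl: "\<zero>\<^bsub>WW D\<^esub> = cl D 0"
  by (simp add: WW_def W.cls_0)

lemma W_incl_cl: "W_incl D \<alpha> = cl D (pvar \<alpha>)"
  by (simp add: W_incl_def cls_def)

lemma W_scale_cl: "P \<in> polys (KK D) \<Longrightarrow> W_scale D c (cl D P) = cl D (pconst c * P)"
  unfolding W_scale_def W_const_def cls_def[symmetric] by (rule cl_mult) auto

lemma vac_comp_cl: "vac_comp D (cl D P) = cterm P"
proof -
  have "cterm X = cterm P" if "X \<in> cl D P" for X
    using W.cterm_J[of "X - P"] that by (simp add: W.mem_cls lookup_minus)
  then have "cterm ` cl D P \<subseteq> {cterm P}" by blast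
  moreover have "cterm P \<in> cterm ` cl D P" by (rule imageI, rule W.cls_self)
  ultimately have "cterm ` cl D P = {cterm P}" by blast
  then show ?thesis by (simp add: vac_comp_def)
qed

lemma e_op_cl: "z \<in> D \<Longrightarrow> P \<in> polys (KK D) \<Longrightarrow> e_op D z (cl D P) = cl D (pvar (gform z 0) * P)"
  unfolding e_op_def W_incl_cl e_form_eq by (rule cl_mult) (auto intro: gform_KK)

lemma derivation_exists:
  assumes lin: "lin_on scale_form (KK D) \<mu>"
  shows "\<exists>d. derivation_on_W D d \<and> (\<forall>P\<in>polys (KK D). d (cl D P) = cl D (cder \<mu> P))"
proof -
  define rep where "rep = (\<lambda>\<xi>. SOME P. P \<in> polys (KK D) \<and> \<xi> = cl D P)"
  define d where "d = restrict (\<lambda>\<xi>. cl D (cder \<mu> (rep \<xi>))) (carrier (WW D))"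
  have d: "d (cl D P) = cl D (cder \<mu> P)" if "P \<in> polys (KK D)" for P
  proof -
    have r: "rep (cl D P) \<in> polys (KK D) \<and> cl D P = cl D (rep (cl D P))"
      unfolding rep_def by (rule someI) (use that in auto)
    then have "P - rep (cl D P) \<in> sym_ideal scale_form (KK D)" by (simp add: W.cls_eq_iff)
    then have "cder \<mu> P - cder \<mu> (rep (cl D P)) \<in> sym_ideal scale_form (KK D)"
      using W.cder_J[OF lin] by (simp flip: pder_diff)
    then have "cl D (cder \<mu> P) = cl D (cder \<mu> (rep (cl D P)))" by (simp add: W.cls_eq_iff)
    then show ?thesis using that by (simp add: d_def cl_carrier)
  qed
  note [simp] = cl_add cl_mult W_scale_cl cl_carrier cder_polys polys_add polys_mult d
  have "derivation_on_W D d"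
    unfolding derivation_on_W_def
  proof (intro conjI ballI allI)
    show "d \<in> carrier (WW D) \<rightarrow>\<^sub>E carrier (WW D)"
    proof (rule PiE_I)
      fix \<xi> assume "\<xi> \<in> carrier (WW D)"
      then show "d \<xi> \<in> carrier (WW D)" by (elim WW_cases) simp
    qed (simp add: d_def)
  next
    fix \<xi> \<psi> assume "\<xi> \<in> carrier (WW D)" "\<psi> \<in> carrier (WW D)"
    then show "d (\<xi> \<oplus>\<^bsub>WW D\<^esub> \<psi>) = d \<xi> \<oplus>\<^bsub>WW D\<^esub> d \<psi>"
      "d (\<xi> \<otimes>\<^bsub>WW D\<^esub> \<psi>) = (d \<xi> \<otimes>\<^bsub>WW D\<^esub> \<psi>) \<oplus>\<^bsub>WW D\<^esub> (\<xi> \<otimes>\<^bsub>WW D\<^esub> d \<psi>)"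
      by (auto elim!: WW_cases simp: pder_add pder_mult)
  next
    fix c \<xi> assume "\<xi> \<in> carrier (WW D)"
    then show "d (W_scale D c \<xi>) = W_scale D c (d \<xi>)"
      by (auto elim!: WW_cases simp: pder_const_times)
  qed
  then show ?thesis using d by blast
qed

lemma derivation_unique:
  assumes d: "derivation_on_W D d" "d (vacuum D) = \<zero>\<^bsub>WW D\<^esub>"
    and d': "derivation_on_W D d'" "d' (vacuum D) = \<zero>\<^bsub>WW D\<^esub>"
    and eq: "\<And>\<alpha>. \<alpha> \<in> KK D \<Longrightarrow> d (W_incl D \<alpha>) = d' (W_incl D \<alpha>)"
  shows "d = d'"
proof
  fix \<xi>
  show "d \<xi> = d' \<xi>"
  proof (cases "\<xi> \<in> carrier (WW D)")
    case True
    then obtain P where P: "P \<in> polys (KK D)" "\<xi> = cl D P" by (rule WW_cases)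
    from P(1) have "d (cl D P) = d' (cl D P)"
    proof (induction rule: cpoly_induct)
      case (const c)
      have e: "cl D (pconst c) = W_scale D c (vacuum D)" by (simp add: vacuum_cl W_scale_cl)
      have "vacuum D \<in> carrier (WW D)" by (simp add: vacuum_cl cl_carrier)
      then show ?case using d d' unfolding e derivation_on_W_def by simp
    next
      case (add P R)
      then show ?case using d(1) d'(1) cl_carrier unfolding derivation_on_W_def
        by (simp add: cl_add[symmetric])
    next
      case (var v P)
      have e: "cl D (pvar v * P) = W_incl D v \<otimes>\<^bsub>WW D\<^esub> cl D P"
        unfolding W_incl_cl using var by (intro cl_mult[symmetric]) auto
      have "W_incl D v \<in> carrier (WW D)" "cl D P \<in> carrier (WW D)"
        using var by (simp_all add: W_incl_cl cl_carrier)
      then show ?case using d(1) d'(1) var eq[of v] unfolding e derivation_on_W_def by simp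
    qed
    then show ?thesis using P by simp
  next
    case False
    then show ?thesis using d(1) d'(1) unfolding derivation_on_W_def by (metis PiE_arb)
  qed
qed

abbreviation ev_der :: "pline \<Rightarrow> mform cpoly \<Rightarrow> mform cpoly" where
  "ev_der y \<equiv> cder (\<lambda>\<alpha>. - coeff \<alpha> y)"

lemma lin_on_neg_coeff: "y \<notin> D \<Longrightarrow> lin_on scale_form (KK D) (\<lambda>\<alpha>. - coeff \<alpha> y)"
  using lin_on_cmult[OF lin_on_coeff, of y D "-1"] by simp

lemma i_op_cl:
  assumes y: "y \<notin> D" and P: "P \<in> polys (KK D)"
  shows "i_op D y (cl D P) = cl D (ev_der y P)"
proof -
  obtain d where d: "derivation_on_W D d" "\<And>P. P \<in> polys (KK D) \<Longrightarrow> d (cl D P) = cl D (ev_der y P)"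
    using derivation_exists[OF lin_on_neg_coeff[OF y]] by blast
  have vac: "d (vacuum D) = \<zero>\<^bsub>WW D\<^esub>" by (simp add: vacuum_cl d(2) zero_cl)
  have gen: "\<forall>\<alpha>\<in>KK D. d (W_incl D \<alpha>) = W_scale D (- coeff \<alpha> y) (vacuum D)"
    by (simp add: W_incl_cl d(2) vacuum_cl W_scale_cl)
  have "i_op D y = d"
    unfolding i_op_def
  proof (rule the_equality)
    fix d' assume "derivation_on_W D d' \<and> d' (vacuum D) = \<zero>\<^bsub>WW D\<^esub> \<and>
     (\<forall>\<alpha>\<in>KK D. d' (W_incl D \<alpha>) = W_scale D (- coeff \<alpha> y) (vacuum D))"
    then show "d' = d" using gen vac d(1) by (intro derivation_unique[of D]) auto
  qed (use d vac gen in auto)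
  then show ?thesis using d(2) P by simp
qed

text \<open>The number that the list of points \<open>ys\<close> assigns to a representative of an element of \<open>W\<close> when the
  operators \<open>i(y)\<close> and then the vacuum component are applied: up to sign, the value at \<open>ys\<close> of a
  symmetric polydifferential.  These numbers define the topology in which sections are
  differentiated.\<close>

definition pvals :: "pline list \<Rightarrow> mform cpoly \<Rightarrow> complex" where
  "pvals ys P = cterm (foldr ev_der ys P)"

lemma foldr_ev_der_polys: "P \<in> polys V \<Longrightarrow> foldr ev_der ys P \<in> polys V"
  by (induction ys) (auto intro: cder_polys)

lemma vac_comp_foldr:
  assumes "set ys \<subseteq> - D" "P \<in> polys (KK D)"
  shows "vac_comp D (foldr (i_op D) ys (cl D P)) = pvals ys P"
proof -
  have "foldr (i_op D) ys (cl D P) = cl D (foldr ev_der ys P)"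
    using assms(1) by (induction ys) (auto simp: i_op_cl foldr_ev_der_polys[OF assms(2)])
  then show ?thesis by (simp add: vac_comp_cl pvals_def)
qed

lemma pvals_add: "pvals ys (P + R) = pvals ys P + pvals ys R"
proof -
  have "foldr ev_der ys (P + R) = foldr ev_der ys P + foldr ev_der ys R"
    by (induction ys) (simp_all add: pder_add)
  then show ?thesis by (simp add: pvals_def lookup_add)
qed

lemma pvals_scale: "pvals ys (pconst c * P) = c * pvals ys P"
proof -
  have "foldr ev_der ys (pconst c * P) = pconst c * foldr ev_der ys P"
    by (induction ys) (simp_all add: pder_const_times)
  then show ?thesis by (simp add: pvals_def cterm_const_times)
qed

lemma pvals_sum: "pvals ys (\<Sum>i\<in>A. pconst (c i) * f i) = (\<Sum>i\<in>A. c i * pvals ys (f i))"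
proof -
  have "pvals ys 0 = 0" using pvals_scale[of ys 0 0] by simp
  then show ?thesis
    by (induction A rule: infinite_finite_induct) (simp_all add: pvals_add pvals_scale)
qed

text \<open>The product rule.  What matters is that the coefficients and points do not depend on
  \<open>\<alpha>\<close>, so that a family \<open>\<alpha>\<close> can be differentiated under the functional.\<close>

lemma pvals_var_times:
  "\<exists>(n::nat) c y. (\<forall>i<n. y i \<in> set ys) \<and> (\<forall>\<alpha>. pvals ys (pvar \<alpha> * P) = (\<Sum>i<n. c i * coeff \<alpha> (y i)))"
proof (induction ys arbitrary: P rule: rev_induct)
  case Nil
  show ?case by (intro exI[of _ 0]) (simp add: pvals_def)
next
  case (snoc x ys)
  obtain n :: nat and c y where n: "\<And>i. i < n \<Longrightarrow> y i \<in> set ys"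
    "\<And>\<alpha>. pvals ys (pvar \<alpha> * ev_der x P) = (\<Sum>i<n. c i * coeff \<alpha> (y i))"
    using snoc by blast
  have step: "pvals (ys @ [x]) R = pvals ys (ev_der x R)" for R by (simp add: pvals_def)
  have "pvals (ys @ [x]) (pvar \<alpha> * P) = (\<Sum>i<Suc n. (c(n := - pvals ys P)) i * coeff \<alpha> ((y(n := x)) i))" for \<alpha>
  proof -
    have "(\<Sum>i<n. (c(n := - pvals ys P)) i * coeff \<alpha> ((y(n := x)) i)) = (\<Sum>i<n. c i * coeff \<alpha> (y i))"
      by (intro sum.cong) auto
    then show ?thesis by (simp add: step pder_var_times pvals_add pvals_scale n(2))
  qed
  moreover have "\<forall>i<Suc n. (y(n := x)) i \<in> set (ys @ [x])" using n(1) by (auto simp: less_Suc_eq)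
  ultimately show ?case by blast
qed

definition partial :: "'v \<Rightarrow> 'v cpoly \<Rightarrow> 'v cpoly" where
  "partial v = cder (\<lambda>u. if u = v then 1 else 0)"

lemma partial_polys: "P \<in> polys V \<Longrightarrow> partial v P \<in> polys V"
  unfolding partial_def by (rule cder_polys)

text \<open>A constant-coefficient derivation of a fixed polynomial is a finite combination of partial
  derivatives, with coefficients the values of the functional at the variables that occur.  It makes
  \<open>i(y) \<xi>\<close>, for fixed \<open>\<xi>\<close>, a finite sum of scalar sections times fixed vectors.\<close>

lemma cder_partial:
  assumes "finite U" "P \<in> polys U"
  shows "cder \<mu> P = (\<Sum>v\<in>U. pconst (\<mu> v) * partial v P)"
proof -
  have "cder \<mu> P = pder (\<lambda>u. \<Sum>v\<in>U. pconst (\<mu> v) * pconst (if u = v then 1 else 0)) P"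
  proof (rule pder_cong[OF assms(2)])
    fix u assume u: "u \<in> U"
    have "(\<Sum>v\<in>U. pconst (\<mu> v) * pconst (if u = v then 1 else 0)) = (\<Sum>v\<in>U. if v = u then pconst (\<mu> u) else 0)"
      by (intro sum.cong) auto
    also have "\<dots> = pconst (\<mu> u)" using u assms(1) by simp
    finally show "pconst (\<mu> u) = (\<Sum>v\<in>U. pconst (\<mu> v) * pconst (if u = v then 1 else 0))" ..
  qed
  then show ?thesis by (simp only: pder_fun_sum pder_fun_times partial_def)
qed

text \<open>Evaluations at points outside \<open>D\<close> separate \<open>KK D\<close> because some open set lies outside \<open>D\<close>, so the
  criterion for vanishing in a symmetric algebra applies.  This makes derivatives of operator-valued
  sections unique.\<close>

lemma fock_eqI:
  assumes U: "open U" "U \<noteq> {}" "U \<inter> D = {}"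
    and c: "\<xi> \<in> carrier (WW D)" "\<psi> \<in> carrier (WW D)"
    and eq: "\<And>ys. set ys \<subseteq> - D \<Longrightarrow> vac_comp D (foldr (i_op D) ys \<xi>) = vac_comp D (foldr (i_op D) ys \<psi>)"
  shows "\<xi> = \<psi>"
proof -
  obtain P where P: "P \<in> polys (KK D)" "\<xi> = cl D P" by (rule WW_cases[OF c(1)])
  obtain R where R: "R \<in> polys (KK D)" "\<psi> = cl D R" by (rule WW_cases[OF c(2)])
  let ?L = "(\<lambda>y \<alpha>. - coeff \<alpha> y) ` (- D)"
  have "P - R \<in> sym_ideal scale_form (KK D)"
  proof (rule W.J_criterion[where \<Lambda> = ?L])
    show "lin_on scale_form (KK D) \<mu>" if "\<mu> \<in> ?L" for \<mu> using that lin_on_neg_coeff by auto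
    show "\<alpha> = 0" if "\<forall>\<mu>\<in>?L. \<mu> \<alpha> = 0" for \<alpha>
      by (rule KK_separated[OF U(1,2)]) (use that U(3) in auto)
    show "P - R \<in> polys (KK D)" using P R by auto
    fix \<mu>s assume "set \<mu>s \<subseteq> ?L"
    then obtain ys where ys: "set ys \<subseteq> - D" "\<mu>s = map (\<lambda>y \<alpha>. - coeff \<alpha> y) ys"
    proof (induction \<mu>s arbitrary: thesis)
      case Nil
      then show ?case by (metis empty_subsetI list.set(1) list.simps(8))
    next
      case (Cons \<mu> \<mu>s)
      then obtain ys where "set ys \<subseteq> - D" "\<mu>s = map (\<lambda>y \<alpha>. - coeff \<alpha> y) ys" by auto
      moreover obtain y where "y \<in> - D" "\<mu> = (\<lambda>\<alpha>. - coeff \<alpha> y)" using Cons.prems(2) by auto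
      ultimately show ?case using Cons.prems(1)[of "y # ys"] by simp
    qed
    have "cterm (foldr cder \<mu>s Q) = pvals ys Q" for Q
      unfolding ys(2) pvals_def foldr_map o_def ..
    moreover have "pvals ys (P - R) = pvals ys P - pvals ys R"
      using pvals_add[of ys P "pconst (-1) * R"] pvals_scale[of ys "-1" R] by (simp add: pconst_uminus)
    moreover have "pvals ys P = pvals ys R"
      using eq[OF ys(1)] by (simp add: P R vac_comp_foldr[OF ys(1)])
    ultimately show "cterm (foldr cder \<mu>s (P - R)) = 0" by simp
  qed
  then show ?thesis using P R by (simp add: W.cls_eq_iff)
qed

section \<open>Lie derivatives of the operators\<close>

lemma lie_op_eqI:
  assumes U: "open U" "U \<noteq> {}" "U \<inter> D = {}"
    and d: "W_has_derivative D (\<lambda>w. W_scale D (X (par p w)) (A (par p w) \<xi>)) \<psi> 0"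
  shows "lie_op D X A p \<xi> = \<psi>"
  unfolding lie_op_def
proof (rule the_equality)
  show "W_has_derivative D (\<lambda>w. W_scale D (X (par p w)) (A (par p w) \<xi>)) \<psi> 0" by (rule d)
next
  fix \<psi>' assume d': "W_has_derivative D (\<lambda>w. W_scale D (X (par p w)) (A (par p w) \<xi>)) \<psi>' 0"
  show "\<psi>' = \<psi>"
  proof (rule fock_eqI[OF U])
    show "\<psi>' \<in> carrier (WW D)" "\<psi> \<in> carrier (WW D)" using d d' by (auto simp: W_has_derivative_def)
    show "vac_comp D (foldr (i_op D) ys \<psi>') = vac_comp D (foldr (i_op D) ys \<psi>)" if "set ys \<subseteq> - D" for ys
      using d d' that unfolding W_has_derivative_def by (blast intro: DERIV_unique)
  qed
qed

text \<open>The Lie derivative of an operator-valued section is found by guessing it: it suffices that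
  on a neighbourhood of \<open>z\<close> each number \<open>pvals ys\<close> is a finite combination of scalar sections
  regular at \<open>z\<close>, and that the guess has the combination of their Lie derivatives as its number.\<close>

lemma lie_op_sections:
  assumes U: "open U" "U \<noteq> {}" "U \<inter> D = {}" and E: "open E" "z \<in> E"
    and X: "regular_vector_field X"
    and A: "\<And>x. x \<in> E \<Longrightarrow> A x \<xi> = cl D (Q x)" "\<And>x. x \<in> E \<Longrightarrow> Q x \<in> polys (KK D)"
    and Q': "Q' \<in> polys (KK D)"
    and vals: "\<And>ys. set ys \<subseteq> - D \<Longrightarrow> \<exists>(I::'i set) c \<omega>. (\<forall>i\<in>I. regular_at (\<omega> i) z) \<and>
       (\<forall>x\<in>E. pvals ys (Q x) = (\<Sum>i\<in>I. c i * \<omega> i x)) \<and>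
       pvals ys Q' = (\<Sum>i\<in>I. c i * lie_section X (\<omega> i) z)"
  shows "lie_op D X A z \<xi> = cl D Q'"
proof (rule lie_op_eqI[OF U])
  show "W_has_derivative D (\<lambda>w. W_scale D (X (par z w)) (A (par z w) \<xi>)) (cl D Q') 0"
    unfolding W_has_derivative_def
  proof (intro conjI allI impI)
    show "cl D Q' \<in> carrier (WW D)" by (rule cl_carrier[OF Q'])
    fix ys assume ys: "set ys \<subseteq> - D"
    obtain I :: "'i set" and c \<omega> where I: "\<And>i. i \<in> I \<Longrightarrow> regular_at (\<omega> i) z"
      "\<And>x. x \<in> E \<Longrightarrow> pvals ys (Q x) = (\<Sum>i\<in>I. c i * \<omega> i x)"
      "pvals ys Q' = (\<Sum>i\<in>I. c i * lie_section X (\<omega> i) z)"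
      using vals[OF ys] by metis
    have "((\<lambda>w. \<Sum>i\<in>I. c i * (X (par z w) * \<omega> i (par z w))) has_field_derivative
        (\<Sum>i\<in>I. c i * lie_section X (\<omega> i) z)) (at 0)"
      by (intro DERIV_sum DERIV_cmult lie_section_derivative X I)
    moreover have "\<forall>\<^sub>F w in nhds 0. (\<Sum>i\<in>I. c i * (X (par z w) * \<omega> i (par z w))) =
       vac_comp D (foldr (i_op D) ys (W_scale D (X (par z w)) (A (par z w) \<xi>)))"
      using open_plineD[OF E]
    proof eventually_elim
      case (elim w)
      have Q: "pconst (X (par z w)) * Q (par z w) \<in> polys (KK D)" using A(2)[OF elim] by auto
      have "vac_comp D (foldr (i_op D) ys (W_scale D (X (par z w)) (A (par z w) \<xi>)))
          = X (par z w) * pvals ys (Q (par z w))"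
        unfolding A(1)[OF elim] W_scale_cl[OF A(2)[OF elim]] vac_comp_foldr[OF ys Q] pvals_scale ..
      then show ?case by (simp add: I(2)[OF elim] sum_distrib_left mult.left_commute)
    qed
    ultimately show "((\<lambda>w. vac_comp D (foldr (i_op D) ys (W_scale D (X (par z w)) (A (par z w) \<xi>))))
        has_field_derivative vac_comp D (foldr (i_op D) ys (cl D Q'))) (at 0)"
      unfolding vac_comp_foldr[OF ys Q'] I(3) by (subst (asm) DERIV_cong_ev) auto
  qed
qed

lemma gcoef_sym: "z \<noteq> y \<Longrightarrow> gcoef z k y = jet z k (gcoef y 0)"
  using jet_gcoef_sym[of z y 0 k] by simp

context
  fixes D D' :: "pline set" and X :: "pline \<Rightarrow> complex"
  assumes op: "open D" "open D'" and ne: "D \<noteq> {}" "D' \<noteq> {}" and disj: "D \<inter> D' = {}"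
    and X: "regular_vector_field X"
begin

text \<open>The form that the \<open>N\<close>-fold Lie derivative of \<open>e\<^sub>z\<close> in \<open>z\<close> has to be, characterised by its values
  outside \<open>D\<close>.  By symmetry of the kernel these are values of Lie derivatives of sections
  \<open>gcoef y 0\<close> in the variable \<open>z\<close>.\<close>

definition lie_form :: "nat \<Rightarrow> pline \<Rightarrow> mform \<Rightarrow> bool" where
  "lie_form N z \<alpha> \<longleftrightarrow> \<alpha> \<in> KK D \<and> (\<forall>y. y \<notin> D \<longrightarrow> coeff \<alpha> y = (lie_section X ^^ N) (gcoef y 0) z)"

text \<open>The combination of jets that computes the iterated Lie derivative at \<open>z\<close> is applied to the kernel.
  The second conclusion says that pairing with this form computes the iterated Lie derivative of any
  regular section, for every bilinear form that is correct on the spanning forms.\<close>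

lemma lie_form_exists:
  assumes z: "z \<in> D"
  obtains \<alpha> where "lie_form N z \<alpha>"
    "\<And>b \<alpha>'. lin_on scale_form (KK D) (b \<alpha>') \<Longrightarrow> regular_at (coeff \<alpha>') z \<Longrightarrow> (\<And>k. b \<alpha>' (gform z k) = jet z k (coeff \<alpha>'))
      \<Longrightarrow> b \<alpha>' \<alpha> = (lie_section X ^^ N) (coeff \<alpha>') z"
proof -
  obtain n :: nat and c where c: "\<And>\<omega>. regular_at \<omega> z \<Longrightarrow>
      (lie_section X ^^ N) \<omega> z = (\<Sum>k\<le>n. c k * jet z k \<omega>)"
    using jet_lie_iter[OF X, of z 0 N] by auto
  define \<alpha> where "\<alpha> = (\<Sum>k\<le>n. scale_form (c k) (gform z k))"
  have KK: "(\<Sum>k\<le>m. scale_form (c k) (gform z k)) \<in> KK D" for m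
    using z by (intro mform.subspace_sum[OF KK_subspace] mform.subspace_scale[OF KK_subspace] gform_KK)
  have sum: "\<phi> (\<Sum>k\<le>m. scale_form (c k) (gform z k)) = (\<Sum>k\<le>m. c k * \<phi> (gform z k))"
    if "lin_on scale_form (KK D) \<phi>" for \<phi> m
  proof (induction m)
    case (Suc m)
    have "scale_form (c (Suc m)) (gform z (Suc m)) \<in> KK D"
      using z by (intro mform.subspace_scale[OF KK_subspace] gform_KK)
    then show ?case using that KK[of m] Suc gform_KK[OF z] unfolding lin_on_def by simp
  qed (use that gform_KK[OF z] in \<open>simp add: lin_on_def\<close>)
  have "coeff \<alpha> y = (lie_section X ^^ N) (gcoef y 0) z" if y: "y \<notin> D" for y
  proof -
    have zy: "z \<noteq> y" using z y by auto
    have "coeff \<alpha> y = (\<Sum>k\<le>n. c k * gcoef z k y)"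
      unfolding \<alpha>_def using sum[OF lin_on_coeff[OF y]] by simp
    also have "\<dots> = (\<Sum>k\<le>n. c k * jet z k (gcoef y 0))" using gcoef_sym[OF zy] by simp
    also have "\<dots> = (lie_section X ^^ N) (gcoef y 0) z" by (rule c[symmetric]) (rule regular_gcoef[OF zy])
    finally show ?thesis .
  qed
  then have "lie_form N z \<alpha>" using KK by (simp add: lie_form_def \<alpha>_def)
  moreover have "b \<alpha>' \<alpha> = (lie_section X ^^ N) (coeff \<alpha>') z"
    if "lin_on scale_form (KK D) (b \<alpha>')" "regular_at (coeff \<alpha>') z" "\<And>k. b \<alpha>' (gform z k) = jet z k (coeff \<alpha>')" for b \<alpha>'
    unfolding \<alpha>_def sum[OF that(1)] c[OF that(2)] using that(3) by simp
  ultimately show ?thesis using that by blast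
qed

lemma lie_form_unique:
  assumes "lie_form N z \<alpha>" "lie_form N z \<beta>"
  shows "\<alpha> = \<beta>"
proof -
  have "\<alpha> - \<beta> = 0"
  proof (rule KK_separated[OF op(2) ne(2)])
    fix y assume "y \<in> D'"
    then have y: "y \<notin> D" using disj by auto
    have r: "regular_at (coeff \<alpha>) y" "regular_at (coeff \<beta>) y"
      using assms KK_regular[OF _ y] by (simp_all add: lie_form_def)
    have e: "\<alpha> - \<beta> = \<alpha> + scale_form (-1) \<beta>" by simp
    show "coeff (\<alpha> - \<beta>) y = 0"
      unfolding e coeff_add[OF r(1) regular_scale[OF r(2)]] coeff_scale[OF r(2)]
      using assms y by (simp add: lie_form_def)
  qed
  then show ?thesis by simp
qed

lemma lie_op_e:
  assumes "z \<in> D" "P \<in> polys (KK D)" "lie_form N z \<alpha>"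
  shows "(lie_op D X ^^ N) (e_op D) z (cl D P) = cl D (pvar \<alpha> * P)"
  using assms
proof (induction N arbitrary: z \<alpha>)
  case 0
  have "gcoef z 0 y = gcoef y 0 z" if "y \<notin> D" for y
    using gcoef_sym[of z y 0] 0(1) that by (cases "z = y") auto
  then have "lie_form 0 z (gform z 0)"
    using 0(1) by (auto simp: lie_form_def gform_KK)
  then have "\<alpha> = gform z 0" using 0(3) lie_form_unique by blast
  then show ?case using 0 by (simp add: e_op_cl)
next
  case (Suc N)
  define lf where "lf = (\<lambda>z. SOME \<alpha>. lie_form N z \<alpha>)"
  have lf: "lie_form N x (lf x)" if "x \<in> D" for x
    unfolding lf_def using lie_form_exists[OF that, of N] by (metis someI)
  show ?case unfolding funpow.simps o_apply
  proof (rule lie_op_sections[OF op(2) ne(2) _ op(1) Suc.prems(1) X, where Q = "\<lambda>x. pvar (lf x) * P"])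
    show "D' \<inter> D = {}" using disj by auto
    show "(lie_op D X ^^ N) (e_op D) x (cl D P) = cl D (pvar (lf x) * P)" if "x \<in> D" for x
      by (rule Suc.IH[OF that Suc.prems(2) lf[OF that]])
    show "pvar (lf x) * P \<in> polys (KK D)" if "x \<in> D" for x
      using lf[OF that] Suc.prems(2) by (auto simp: lie_form_def)
    show "pvar \<alpha> * P \<in> polys (KK D)"
      using Suc.prems by (auto simp: lie_form_def)
    fix ys assume ys: "set ys \<subseteq> - D"
    obtain n :: nat and c y where n: "\<And>i. i < n \<Longrightarrow> y i \<in> set ys"
      "\<And>\<alpha>. pvals ys (pvar \<alpha> * P) = (\<Sum>i<n. c i * coeff \<alpha> (y i))"
      using pvals_var_times[of ys P] by blast
    have yD: "y i \<notin> D" if "i < n" for i using n(1)[OF that] ys by auto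
    show "\<exists>(I :: nat set) c \<omega>. (\<forall>i\<in>I. regular_at (\<omega> i) z) \<and>
       (\<forall>x\<in>D. pvals ys (pvar (lf x) * P) = (\<Sum>i\<in>I. c i * \<omega> i x)) \<and>
       pvals ys (pvar \<alpha> * P) = (\<Sum>i\<in>I. c i * lie_section X (\<omega> i) z)"
    proof (intro exI conjI ballI)
      fix i assume i: "i \<in> {..<n}"
      then have "z \<noteq> y i" using Suc.prems(1) yD by auto
      then show "regular_at ((lie_section X ^^ N) (gcoef (y i) 0)) z"
        by (intro regular_at_lie_iter[OF X] regular_gcoef)
    next
      fix x assume "x \<in> D"
      then show "pvals ys (pvar (lf x) * P) = (\<Sum>i\<in>{..<n}. c i * (lie_section X ^^ N) (gcoef (y i) 0) x)"
        unfolding n(2) using lf yD by (intro sum.cong) (auto simp: lie_form_def)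
    next
      show "pvals ys (pvar \<alpha> * P) = (\<Sum>i\<in>{..<n}. c i * lie_section X ((lie_section X ^^ N) (gcoef (y i) 0)) z)"
        unfolding n(2) using Suc.prems(3) yD by (intro sum.cong) (auto simp: lie_form_def)
    qed
  qed
qed

lemma lie_op_i:
  assumes "z \<in> D" "P' \<in> polys (KK D')"
  shows "(lie_op D' X ^^ N) (i_op D') z (cl D' P') = cl D' (cder (\<lambda>\<alpha>. - (lie_section X ^^ N) (coeff \<alpha>) z) P')"
  using assms
proof (induction N arbitrary: z)
  case 0
  then have "z \<notin> D'" using disj by auto
  then show ?case using 0 by (simp add: i_op_cl)
next
  case (Suc N)
  obtain U where U: "finite U" "U \<subseteq> KK D'" "P' \<in> polys U"
    using polys_finite_support[OF Suc.prems(2)] .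
  show ?case unfolding funpow.simps o_apply
  proof (rule lie_op_sections[OF op(1) ne(1) disj op(1) Suc.prems(1) X,
        where Q = "\<lambda>x. cder (\<lambda>\<alpha>. - (lie_section X ^^ N) (coeff \<alpha>) x) P'"])
    show "(lie_op D' X ^^ N) (i_op D') x (cl D' P') = cl D' (cder (\<lambda>\<alpha>. - (lie_section X ^^ N) (coeff \<alpha>) x) P')"
      if "x \<in> D" for x by (rule Suc.IH[OF that Suc.prems(2)])
    show "cder (\<lambda>\<alpha>. - (lie_section X ^^ N) (coeff \<alpha>) x) P' \<in> polys (KK D')" for x
      by (rule cder_polys[OF Suc.prems(2)])
    show "cder (\<lambda>\<alpha>. - lie_section X ((lie_section X ^^ N) (coeff \<alpha>)) z) P' \<in> polys (KK D')"
      by (rule cder_polys[OF Suc.prems(2)])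
    fix ys assume ys: "set ys \<subseteq> - D'"
    have e: "pvals ys (cder \<mu> P') = (\<Sum>v\<in>U. \<mu> v * pvals ys (partial v P'))" for \<mu>
      by (simp only: cder_partial[OF U(1,3)] pvals_sum)
    show "\<exists>(I :: mform set) c \<omega>. (\<forall>i\<in>I. regular_at (\<omega> i) z) \<and>
       (\<forall>x\<in>D. pvals ys (cder (\<lambda>\<alpha>. - (lie_section X ^^ N) (coeff \<alpha>) x) P') = (\<Sum>i\<in>I. c i * \<omega> i x)) \<and>
       pvals ys (cder (\<lambda>\<alpha>. - lie_section X ((lie_section X ^^ N) (coeff \<alpha>)) z) P')
         = (\<Sum>i\<in>I. c i * lie_section X (\<omega> i) z)"
    proof (intro exI conjI ballI)
      fix v assume "v \<in> U"
      then show "regular_at ((lie_section X ^^ N) (coeff v)) z"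
        using U(2) Suc.prems(1) disj by (intro regular_at_lie_iter[OF X] KK_regular[of _ D']) auto
    next
      show "pvals ys (cder (\<lambda>\<alpha>. - (lie_section X ^^ N) (coeff \<alpha>) x) P') =
        (\<Sum>v\<in>U. (- pvals ys (partial v P')) * (lie_section X ^^ N) (coeff v) x)" for x
        unfolding e by (intro sum.cong) auto
      show "pvals ys (cder (\<lambda>\<alpha>. - lie_section X ((lie_section X ^^ N) (coeff \<alpha>)) z) P') =
        (\<Sum>v\<in>U. (- pvals ys (partial v P')) * lie_section X ((lie_section X ^^ N) (coeff v)) z)"
        unfolding e by (intro sum.cong) auto
    qed
  qed
qed

end

section \<open>Bilinear pairings\<close>

definition flip :: "('a \<times> 'b \<Rightarrow> 'c) \<Rightarrow> 'b \<times> 'a \<Rightarrow> 'c" where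
  "flip B = (\<lambda>(x, y). B (y, x))"

lemma flip_apply [simp]: "flip B (x, y) = B (y, x)"
  by (simp add: flip_def)

text \<open>Exchanging \<open>D\<close> and \<open>D'\<close> turns each half of the required properties into the other one.\<close>

lemma bilinear_flip: "bilinear_pairing D' D B \<Longrightarrow> bilinear_pairing D D' (flip B)"
  unfolding bilinear_pairing_def by (auto simp: flip_def PiE_def extensional_def)

context
  fixes D D' :: "pline set" and B :: "fock \<times> fock \<Rightarrow> complex"
  assumes B: "bilinear_pairing D' D B"
begin

lemma pairing_add_left:
  assumes "P' \<in> polys (KK D')" "R' \<in> polys (KK D')" "P \<in> polys (KK D)"
  shows "B (cl D' (P' + R'), cl D P) = B (cl D' P', cl D P) + B (cl D' R', cl D P)"
  using B assms unfolding bilinear_pairing_def cl_add[OF assms(1,2), symmetric]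
  by (simp add: cl_carrier)

lemma pairing_scale_left:
  assumes "P' \<in> polys (KK D')" "P \<in> polys (KK D)"
  shows "B (cl D' (pconst c * P'), cl D P) = c * B (cl D' P', cl D P)"
  using B assms unfolding bilinear_pairing_def W_scale_cl[OF assms(1), symmetric]
  by (simp add: cl_carrier)

lemma pairing_add_right:
  assumes "P' \<in> polys (KK D')" "P \<in> polys (KK D)" "R \<in> polys (KK D)"
  shows "B (cl D' P', cl D (P + R)) = B (cl D' P', cl D P) + B (cl D' P', cl D R)"
  using B assms unfolding bilinear_pairing_def cl_add[OF assms(2,3), symmetric]
  by (simp add: cl_carrier)

lemma pairing_scale_right:
  assumes "P' \<in> polys (KK D')" "P \<in> polys (KK D)"
  shows "B (cl D' P', cl D (pconst c * P)) = c * B (cl D' P', cl D P)"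
  using B assms unfolding bilinear_pairing_def W_scale_cl[OF assms(2), symmetric]
  by (simp add: cl_carrier)

lemma pairing_0_left: "P \<in> polys (KK D) \<Longrightarrow> B (cl D' 0, cl D P) = 0"
  using pairing_scale_left[of 0 P 0] by simp

lemma pairing_sum_left:
  assumes "P \<in> polys (KK D)" "\<And>i. i \<in> A \<Longrightarrow> f i \<in> polys (KK D')"
  shows "B (cl D' (\<Sum>i\<in>A. pconst (c i) * f i), cl D P) = (\<Sum>i\<in>A. c i * B (cl D' (f i), cl D P))"
  using assms(2)
proof (induction A rule: infinite_finite_induct)
  case (insert a A)
  then have "(\<Sum>i\<in>A. pconst (c i) * f i) \<in> polys (KK D')" "pconst (c a) * f a \<in> polys (KK D')" "f a \<in> polys (KK D')"
    by (auto intro!: polys_sum polys_mult)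
  then show ?case using insert by (simp add: pairing_add_left pairing_scale_left assms(1))
qed (simp_all add: pairing_0_left assms(1))

lemma pairing_cder:
  assumes "P \<in> polys (KK D)" "P' \<in> polys (KK D')" "finite U" "P' \<in> polys U"
  shows "B (cl D' (cder \<mu> P'), cl D P) = (\<Sum>v\<in>U. \<mu> v * B (cl D' (partial v P'), cl D P))"
  unfolding cder_partial[OF assms(3,4)]
  by (rule pairing_sum_left[OF assms(1)]) (rule partial_polys[OF assms(2)])

lemma pairing_var_lin:
  assumes P: "P \<in> polys (KK D)" and P': "P' \<in> polys (KK D')"
  shows "lin_on scale_form (KK D) (\<lambda>\<alpha>. B (cl D' P', cl D (pvar \<alpha> * P)))"
  unfolding lin_on_def
proof (intro conjI ballI allI)
  fix \<alpha> \<beta> assume ab: "\<alpha> \<in> KK D" "\<beta> \<in> KK D"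
  have "(pvar (\<alpha> + \<beta>) - pvar \<alpha> - pvar \<beta>) * P \<in> sym_ideal scale_form (KK D)"
    by (intro W.J_mult' W.J_var_add ab P)
  then have "cl D (pvar (\<alpha> + \<beta>) * P) = cl D (pvar \<alpha> * P + pvar \<beta> * P)"
    by (simp add: W.cls_eq_iff algebra_simps)
  then show "B (cl D' P', cl D (pvar (\<alpha> + \<beta>) * P)) = B (cl D' P', cl D (pvar \<alpha> * P)) + B (cl D' P', cl D (pvar \<beta> * P))"
    using ab P P' by (simp add: pairing_add_right polys_mult)
next
  fix c \<alpha> assume a: "\<alpha> \<in> KK D"
  have "(pvar (scale_form c \<alpha>) - pconst c * pvar \<alpha>) * P \<in> sym_ideal scale_form (KK D)"
    by (intro W.J_mult' W.J_var_scl a P)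
  then have "cl D (pvar (scale_form c \<alpha>) * P) = cl D (pconst c * (pvar \<alpha> * P))"
    by (simp add: W.cls_eq_iff algebra_simps)
  then show "B (cl D' P', cl D (pvar (scale_form c \<alpha>) * P)) = c * B (cl D' P', cl D (pvar \<alpha> * P))"
    using a P P' by (simp add: pairing_scale_right polys_mult)
qed

end

section \<open>Uniqueness of the pairing\<close>

text \<open>The equality of the outer terms in the chain for the Lie derivatives; together with its flipped
  version it already determines the pairing up to its value on the vacuum vectors.\<close>

definition adjoint_ops :: "pline set \<Rightarrow> pline set \<Rightarrow> (fock \<times> fock \<Rightarrow> complex) \<Rightarrow> bool" where
  "adjoint_ops D' D B \<longleftrightarrow> (\<forall>X N. regular_vector_field X \<longrightarrow>
     (\<forall>z\<in>D. \<forall>\<xi>\<in>carrier (WW D). \<forall>\<xi>'\<in>carrier (WW D').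
       B (\<xi>', (lie_op D X ^^ N) (e_op D) z \<xi>) = - B ((lie_op D' X ^^ N) (i_op D') z \<xi>', \<xi>)))"

text \<open>One side of the required properties; the other side is \<open>half_adjoint D D' (flip B)\<close>.\<close>

definition half_adjoint :: "pline set \<Rightarrow> pline set \<Rightarrow> (fock \<times> fock \<Rightarrow> complex) \<Rightarrow> bool" where
  "half_adjoint D' D B \<longleftrightarrow> (\<forall>\<xi>\<in>carrier (WW D). \<forall>\<xi>'\<in>carrier (WW D').
     (\<forall>z\<in>D. B (\<xi>', e_op D z \<xi>) = - B (i_op D' z \<xi>', \<xi>)) \<and>
     (\<forall>X N. regular_vector_field X \<longrightarrow> (\<forall>z\<in>D.
        B (\<xi>', (lie_op D X ^^ N) (e_op D) z \<xi>)
          = (lie_section X ^^ N) (\<lambda>y. B (\<xi>', e_op D y \<xi>)) z \<and>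
        (lie_section X ^^ N) (\<lambda>y. B (\<xi>', e_op D y \<xi>)) z
          = - (lie_section X ^^ N) (\<lambda>y. B (i_op D' y \<xi>', \<xi>)) z \<and>
        - (lie_section X ^^ N) (\<lambda>y. B (i_op D' y \<xi>', \<xi>)) z
          = - B ((lie_op D' X ^^ N) (i_op D') z \<xi>', \<xi>))))"

lemma half_adjoint_imp_adjoint_ops: "half_adjoint D' D B \<Longrightarrow> adjoint_ops D' D B"
  unfolding half_adjoint_def adjoint_ops_def by simp

text \<open>The fields \<open>d/dx\<close> and \<open>- x\<^sup>2 d/dx\<close> are regular on the projective line and constant in the standard
  charts at finite points and at infinity.  For a constant field the iterated Lie derivatives are the
  jets themselves.\<close>

lemma flat_vector_field:
  obtains X where "regular_vector_field X"
    "\<And>\<omega> k. regular_at \<omega> z \<Longrightarrow> (lie_section X ^^ k) \<omega> z = jet z k \<omega>"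
proof -
  have "\<exists>X. regular_vector_field X \<and> (\<forall>w. pull_vec z X w = 1)"
  proof (cases z)
    case (Fin a)
    define X :: "pline \<Rightarrow> complex" where "X = (\<lambda>p. case p of Fin x \<Rightarrow> 1 | Infty \<Rightarrow> 0)"
    have 1: "pull_vec (Fin b) X w = 1" for b w by (simp add: pull_vec_def X_def)
    have 2: "pull_vec Infty X = (\<lambda>w. - (w\<^sup>2))" by (auto simp: pull_vec_def X_def fun_eq_iff)
    have "pull_vec p X analytic_on {0}" for p
    proof (cases p)
      case Infty
      then show ?thesis unfolding 2 Infty by (intro analytic_intros)
    qed (simp add: 1[abs_def])
    then show ?thesis using 1 Fin by (auto simp: regular_vector_field_def)
  next
    case Infty
    define X :: "pline \<Rightarrow> complex" where "X = (\<lambda>p. case p of Fin x \<Rightarrow> - (x\<^sup>2) | Infty \<Rightarrow> 1)"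
    have 1: "pull_vec (Fin b) X = (\<lambda>w. - ((b + w)\<^sup>2))" for b by (auto simp: pull_vec_def X_def fun_eq_iff)
    have 2: "pull_vec Infty X w = 1" for w
      by (simp add: pull_vec_def X_def power_divide)
    have "pull_vec p X analytic_on {0}" for p
    proof (cases p)
      case (Fin b)
      then show ?thesis unfolding 1 Fin by (intro analytic_intros)
    qed (simp add: 2[abs_def])
    then show ?thesis using 2 Infty by (auto simp: regular_vector_field_def)
  qed
  then obtain X where X: "regular_vector_field X" "\<And>w. pull_vec z X w = 1" by blast
  have step: "jet z m (lie_section X \<omega>) = jet z (Suc m) \<omega>" if "regular_at \<omega> z" for \<omega> m
  proof -
    have "jet z m (lie_section X \<omega>) = (deriv ^^ m) (deriv (pull z \<omega>)) 0"
      unfolding jet_def using pull_lie_section[OF X(1) that] X(2) by (intro higher_deriv_cong_ev) auto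
    then show ?thesis by (simp only: jet_def funpow_Suc_right o_apply)
  qed
  have "jet z m ((lie_section X ^^ k) \<omega>) = jet z (m + k) \<omega>" if "regular_at \<omega> z" for \<omega> m k
  proof (induction k arbitrary: m)
    case (Suc k)
    show ?case using step[OF regular_at_lie_iter[OF X(1) that], of m k] Suc[of "Suc m"] by simp
  qed simp
  from this[of _ 0] show ?thesis using that[OF X(1)] by simp
qed

text \<open>Multiplication by a spanning form is an iterated Lie derivative of \<open>e(z)\<close> and can therefore be
  moved to the other side.  There it becomes a derivation that does not depend on the
  pairing, which allows two pairings to be compared.\<close>

lemma adjoint_ops_gform:
  assumes op: "open D" "open D'" and ne: "D \<noteq> {}" "D' \<noteq> {}" and disj: "D \<inter> D' = {}"
    and z: "z \<in> D"
  obtains \<mu> where "\<And>B P P'. adjoint_ops D' D B \<Longrightarrow> P \<in> polys (KK D) \<Longrightarrow> P' \<in> polys (KK D') \<Longrightarrow>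
    B (cl D' P', cl D (pvar (gform z k) * P)) = - B (cl D' (cder \<mu> P'), cl D P)"
proof -
  obtain X where X: "regular_vector_field X"
    "\<And>\<omega> k. regular_at \<omega> z \<Longrightarrow> (lie_section X ^^ k) \<omega> z = jet z k \<omega>"
    using flat_vector_field[of z] by blast
  have "gcoef z k y = (lie_section X ^^ k) (gcoef y 0) z" if "y \<notin> D" for y
  proof -
    have "z \<noteq> y" using that z by auto
    then show ?thesis using gcoef_sym X(2)[OF regular_gcoef] by simp
  qed
  then have lf: "lie_form D X k z (gform z k)"
    using z by (simp add: lie_form_def[OF op ne disj X(1)] gform_KK)
  show ?thesis
  proof (rule that)
    fix B P P' assume B: "adjoint_ops D' D B" and P: "P \<in> polys (KK D)" and P': "P' \<in> polys (KK D')"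
    show "B (cl D' P', cl D (pvar (gform z k) * P)) =
        - B (cl D' (cder (\<lambda>\<alpha>. - (lie_section X ^^ k) (coeff \<alpha>) z) P'), cl D P)"
      using B[unfolded adjoint_ops_def, rule_format, OF X(1) z cl_carrier[OF P] cl_carrier[OF P'], of k]
      unfolding lie_op_e[OF op ne disj X(1) z P lf] lie_op_i[OF op ne disj X(1) z P'] .
  qed
qed

text \<open>A generator moved to the other side becomes a derivation, which annihilates the vacuum.\<close>

lemma pairing_vacuum:
  assumes op: "open D" "open D'" and ne: "D \<noteq> {}" "D' \<noteq> {}" and disj: "D \<inter> D' = {}"
    and B: "bilinear_pairing D' D B" "adjoint_ops D' D B" and P: "P \<in> polys (KK D)"
  shows "B (vacuum D', cl D P) = cterm P * B (vacuum D', vacuum D)"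
  using P
proof (induction rule: cpoly_induct)
  case (const c)
  then show ?case using pairing_scale_right[OF B(1), of 1 1 c] by (simp add: vacuum_cl)
next
  case (add P R)
  then show ?case using pairing_add_right[OF B(1), of 1 P R] by (simp add: vacuum_cl lookup_add distrib_right)
next
  case (var \<alpha> P)
  have "B (cl D' 1, cl D (pvar \<alpha> * P)) = 0"
  proof (rule lin_on_gform_unique[OF pairing_var_lin[OF B(1) var(2) polys_1] _ _ var(1)])
    fix z k assume "z \<in> D"
    then obtain \<mu> where "B (cl D' 1, cl D (pvar (gform z k) * P)) = - B (cl D' (cder \<mu> 1), cl D P)"
      using adjoint_ops_gform[OF op ne disj] B(2) var(2) polys_1 by metis
    then show "B (cl D' 1, cl D (pvar (gform z k) * P)) = 0"
      by (simp add: pairing_0_left[OF B(1) var(2)])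
  qed (simp add: lin_on_def)
  then show ?case by (simp add: vacuum_cl)
qed

lemma pairing_unique:
  assumes op: "open D" "open D'" and ne: "D \<noteq> {}" "D' \<noteq> {}" and disj: "D \<inter> D' = {}"
    and B: "bilinear_pairing D' D B" "adjoint_ops D' D B" "adjoint_ops D D' (flip B)"
    and C: "bilinear_pairing D' D C" "adjoint_ops D' D C" "adjoint_ops D D' (flip C)"
    and vac: "B (vacuum D', vacuum D) = C (vacuum D', vacuum D)"
  shows "B = C"
proof
  have disj': "D' \<inter> D = {}" using disj by auto
  have 1: "B (cl D' P', vacuum D) = C (cl D' P', vacuum D)" if "P' \<in> polys (KK D')" for P'
    using pairing_vacuum[OF op(2,1) ne(2,1) disj' bilinear_flip[OF B(1)] B(3) that]
      pairing_vacuum[OF op(2,1) ne(2,1) disj' bilinear_flip[OF C(1)] C(3) that] vac by simp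
  have main: "\<forall>P'\<in>polys (KK D'). B (cl D' P', cl D P) = C (cl D' P', cl D P)" if "P \<in> polys (KK D)" for P
    using that
  proof (induction rule: cpoly_induct)
    case (const c)
    then show ?case
      using 1 pairing_scale_right[OF B(1), of _ 1 c] pairing_scale_right[OF C(1), of _ 1 c]
      by (simp add: vacuum_cl)
  next
    case (add P R)
    then show ?case by (simp add: pairing_add_right[OF B(1)] pairing_add_right[OF C(1)])
  next
    case (var \<alpha> P)
    show ?case
    proof
      fix P' assume P': "P' \<in> polys (KK D')"
      show "B (cl D' P', cl D (pvar \<alpha> * P)) = C (cl D' P', cl D (pvar \<alpha> * P))"
      proof (rule lin_on_gform_unique[OF pairing_var_lin[OF B(1) var(2) P'] pairing_var_lin[OF C(1) var(2) P'] _ var(1)])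
        fix z k assume z: "z \<in> D"
        obtain \<mu> where \<mu>: "\<And>B P P'. adjoint_ops D' D B \<Longrightarrow> P \<in> polys (KK D) \<Longrightarrow> P' \<in> polys (KK D') \<Longrightarrow>
            B (cl D' P', cl D (pvar (gform z k) * P)) = - B (cl D' (cder \<mu> P'), cl D P)"
          using adjoint_ops_gform[OF op ne disj z] by blast
        show "B (cl D' P', cl D (pvar (gform z k) * P)) = C (cl D' P', cl D (pvar (gform z k) * P))"
          unfolding \<mu>[OF B(2) var(2) P'] \<mu>[OF C(2) var(2) P'] using bspec[OF var(3) cder_polys[OF P', of \<mu>]] by simp
      qed
    qed
  qed
  fix x
  show "B x = C x"
  proof (cases "x \<in> carrier (WW D') \<times> carrier (WW D)")
    case True
    then obtain \<xi>' \<xi> where x: "x = (\<xi>', \<xi>)" "\<xi>' \<in> carrier (WW D')" "\<xi> \<in> carrier (WW D)" by auto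
    obtain P' where P': "P' \<in> polys (KK D')" "\<xi>' = cl D' P'" by (rule WW_cases[OF x(2)])
    obtain P where P: "P \<in> polys (KK D)" "\<xi> = cl D P" by (rule WW_cases[OF x(3)])
    show ?thesis unfolding x(1) P(2) P'(2) using main[OF P(1)] P'(1) by (rule bspec)
  next
    case False
    show ?thesis
      using PiE_arb[OF conjunct1[OF B(1)[unfolded bilinear_pairing_def]] False]
        PiE_arb[OF conjunct1[OF C(1)[unfolded bilinear_pairing_def]] False] by simp
  qed
qed

section \<open>Existence of the pairing\<close>

context
  fixes D D' :: "pline set" and B :: "fock \<times> fock \<Rightarrow> complex" and b :: "mform \<Rightarrow> mform \<Rightarrow> complex"
  assumes op: "open D" "open D'" and ne: "D \<noteq> {}" "D' \<noteq> {}" and disj: "D \<inter> D' = {}"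
    and B: "bilinear_pairing D' D B"
    and adj: "\<And>\<alpha> P P'. \<alpha> \<in> KK D \<Longrightarrow> P \<in> polys (KK D) \<Longrightarrow> P' \<in> polys (KK D') \<Longrightarrow>
      B (cl D' P', cl D (pvar \<alpha> * P)) = B (cl D' (cder (\<lambda>\<alpha>'. b \<alpha>' \<alpha>) P'), cl D P)"
    and lin: "\<And>\<alpha>'. \<alpha>' \<in> KK D' \<Longrightarrow> lin_on scale_form (KK D) (b \<alpha>')"
    and bg: "\<And>\<alpha>' z k. \<alpha>' \<in> KK D' \<Longrightarrow> z \<in> D \<Longrightarrow> b \<alpha>' (gform z k) = jet z k (coeff \<alpha>')"
begin

lemma e_adjoint_i:
  assumes z: "z \<in> D" and \<xi>: "\<xi> \<in> carrier (WW D)" and \<xi>': "\<xi>' \<in> carrier (WW D')"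
  shows "B (\<xi>', e_op D z \<xi>) = - B (i_op D' z \<xi>', \<xi>)"
proof -
  obtain P where P: "P \<in> polys (KK D)" "\<xi> = cl D P" by (rule WW_cases[OF \<xi>])
  obtain P' where P': "P' \<in> polys (KK D')" "\<xi>' = cl D' P'" by (rule WW_cases[OF \<xi>'])
  have zD': "z \<notin> D'" using z disj by auto
  obtain U where U: "finite U" "U \<subseteq> KK D'" "P' \<in> polys U" using polys_finite_support[OF P'(1)] .
  have "B (\<xi>', e_op D z \<xi>) = B (cl D' (cder (\<lambda>\<alpha>'. b \<alpha>' (gform z 0)) P'), cl D P)"
    unfolding P(2) P'(2) e_op_cl[OF z P(1)] by (rule adj[OF gform_KK[OF z] P(1) P'(1)])
  also have "\<dots> = (\<Sum>v\<in>U. coeff v z * B (cl D' (partial v P'), cl D P))"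
    unfolding pairing_cder[OF B P(1) P'(1) U(1,3)] using U(2) bg[OF _ z, of _ 0] by (intro sum.cong) auto
  also have "\<dots> = - (\<Sum>v\<in>U. (- coeff v z) * B (cl D' (partial v P'), cl D P))"
    by (simp add: sum_negf)
  also have "\<dots> = - B (i_op D' z \<xi>', \<xi>)"
    unfolding P(2) P'(2) i_op_cl[OF zD' P'(1)] pairing_cder[OF B P(1) P'(1) U(1,3)] ..
  finally show ?thesis .
qed

lemma lie_adjoint:
  assumes X: "regular_vector_field X"
    and z: "z \<in> D" and \<xi>: "\<xi> \<in> carrier (WW D)" and \<xi>': "\<xi>' \<in> carrier (WW D')"
  shows "B (\<xi>', (lie_op D X ^^ N) (e_op D) z \<xi>) = (lie_section X ^^ N) (\<lambda>y. B (\<xi>', e_op D y \<xi>)) z"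
    and "(lie_section X ^^ N) (\<lambda>y. B (\<xi>', e_op D y \<xi>)) z = - (lie_section X ^^ N) (\<lambda>y. B (i_op D' y \<xi>', \<xi>)) z"
    and "- (lie_section X ^^ N) (\<lambda>y. B (i_op D' y \<xi>', \<xi>)) z = - B ((lie_op D' X ^^ N) (i_op D') z \<xi>', \<xi>)"
proof -
  obtain P where P: "P \<in> polys (KK D)" "\<xi> = cl D P" by (rule WW_cases[OF \<xi>])
  obtain P' where P': "P' \<in> polys (KK D')" "\<xi>' = cl D' P'" by (rule WW_cases[OF \<xi>'])
  obtain U where U: "finite U" "U \<subseteq> KK D'" "P' \<in> polys U" using polys_finite_support[OF P'(1)] .
  define \<beta> where "\<beta> = (\<lambda>v. B (cl D' (partial v P'), cl D P))"
  have exp: "B (cl D' (cder \<mu> P'), cl D P) = (\<Sum>v\<in>U. \<mu> v * \<beta> v)" for \<mu>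
    unfolding \<beta>_def by (rule pairing_cder[OF B P(1) P'(1) U(1,3)])
  define r where "r = (\<Sum>v\<in>U. \<beta> v * (lie_section X ^^ N) (coeff v) z)"
  have reg: "regular_at (coeff v) y" if "v \<in> U" "y \<in> D" for v y
    using U(2) that disj by (intro KK_regular[of _ D']) auto
  have i: "B (i_op D' y \<xi>', \<xi>) = (\<Sum>v\<in>U. (- \<beta> v) * coeff v y)" if y: "y \<in> D" for y
  proof -
    have yD': "y \<notin> D'" using y disj by auto
    show ?thesis unfolding P(2) P'(2) i_op_cl[OF yD' P'(1)] exp by (intro sum.cong) auto
  qed
  have e: "B (\<xi>', e_op D y \<xi>) = (\<Sum>v\<in>U. \<beta> v * coeff v y)" if y: "y \<in> D" for y
    using e_adjoint_i[OF y \<xi> \<xi>'] i[OF y] by (simp add: sum_negf)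
  have le: "(lie_section X ^^ N) (\<lambda>y. B (\<xi>', e_op D y \<xi>)) z = r"
    unfolding r_def by (rule trans[OF lie_iter_cong[OF op(1) e z] lie_iter_sum[OF op(1) X reg z]])
  have "(lie_section X ^^ N) (\<lambda>y. B (i_op D' y \<xi>', \<xi>)) z = (\<Sum>v\<in>U. (- \<beta> v) * (lie_section X ^^ N) (coeff v) z)"
    by (rule trans[OF lie_iter_cong[OF op(1) i z] lie_iter_sum[OF op(1) X reg z]])
  then have li: "(lie_section X ^^ N) (\<lambda>y. B (i_op D' y \<xi>', \<xi>)) z = - r"
    by (simp add: r_def sum_negf)
  have oi: "B ((lie_op D' X ^^ N) (i_op D') z \<xi>', \<xi>) = - r"
    unfolding P(2) P'(2) lie_op_i[OF op ne disj X z P'(1)] exp r_def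
    by (simp add: sum_negf mult.commute)
  obtain \<alpha> where \<alpha>: "lie_form D X N z \<alpha>"
    "\<And>b \<alpha>'. lin_on scale_form (KK D) (b \<alpha>') \<Longrightarrow> regular_at (coeff \<alpha>') z \<Longrightarrow> (\<And>k. b \<alpha>' (gform z k) = jet z k (coeff \<alpha>'))
      \<Longrightarrow> b \<alpha>' \<alpha> = (lie_section X ^^ N) (coeff \<alpha>') z"
    using lie_form_exists[OF op ne disj X z, of N] by blast
  have \<alpha>KK: "\<alpha> \<in> KK D" using \<alpha>(1) lie_form_def[OF op ne disj X] by blast
  have "B (\<xi>', (lie_op D X ^^ N) (e_op D) z \<xi>) = (\<Sum>v\<in>U. b v \<alpha> * \<beta> v)"
    unfolding P(2) P'(2) lie_op_e[OF op ne disj X z P(1) \<alpha>(1)] adj[OF \<alpha>KK P(1) P'(1)] exp ..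
  also have "\<dots> = r"
    unfolding r_def
  proof (rule sum.cong[OF refl])
    fix v assume v: "v \<in> U"
    then have "v \<in> KK D'" using U(2) by auto
    then have "b v \<alpha> = (lie_section X ^^ N) (coeff v) z"
      using lin bg[OF _ z] reg[OF v z] by (intro \<alpha>(2)) auto
    then show "b v \<alpha> * \<beta> v = \<beta> v * (lie_section X ^^ N) (coeff v) z" by simp
  qed
  finally have oe: "B (\<xi>', (lie_op D X ^^ N) (e_op D) z \<xi>) = r" .
  show "B (\<xi>', (lie_op D X ^^ N) (e_op D) z \<xi>) = (lie_section X ^^ N) (\<lambda>y. B (\<xi>', e_op D y \<xi>)) z"
    and "(lie_section X ^^ N) (\<lambda>y. B (\<xi>', e_op D y \<xi>)) z = - (lie_section X ^^ N) (\<lambda>y. B (i_op D' y \<xi>', \<xi>)) z"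
    and "- (lie_section X ^^ N) (\<lambda>y. B (i_op D' y \<xi>', \<xi>)) z = - B ((lie_op D' X ^^ N) (i_op D') z \<xi>', \<xi>)"
    unfolding oe le li oi by simp_all
qed

text \<open>One half of the required properties, for any extension of a bilinear form that is correct on the
  spanning forms; the other half is obtained by flipping.\<close>

lemma half_adjointI: "half_adjoint D' D B"
  unfolding half_adjoint_def
  by (intro ballI conjI allI impI; (rule e_adjoint_i lie_adjoint; assumption))

end

lemma pairing_exists:
  assumes disj: "D \<inter> D' = {}"
  obtains B where "bilinear_pairing D' D B" "B (vacuum D', vacuum D) = 1"
    "\<And>\<alpha> P P'. \<alpha> \<in> KK D \<Longrightarrow> P \<in> polys (KK D) \<Longrightarrow> P' \<in> polys (KK D') \<Longrightarrow>
      B (cl D' P', cl D (pvar \<alpha> * P)) = B (cl D' (cder (\<lambda>\<alpha>'. form_pair D' \<alpha>' \<alpha>) P'), cl D P)"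
    "\<And>\<alpha>' P P'. \<alpha>' \<in> KK D' \<Longrightarrow> P \<in> polys (KK D) \<Longrightarrow> P' \<in> polys (KK D') \<Longrightarrow>
      B (cl D' (pvar \<alpha>' * P'), cl D P) = B (cl D' P', cl D (cder (form_pair D' \<alpha>') P))"
proof -
  interpret sym_pair scale_form "KK D'" scale_form "KK D" "form_pair D'"
    by (rule sym_pair_forms[OF disj])
  note [simp] = spair_cls cl_add W_scale_cl polys_add polys_mult cder_polys
  have "bilinear_pairing D' D spair"
    unfolding bilinear_pairing_def
  proof (intro conjI ballI allI)
    show "spair \<in> carrier (WW D') \<times> carrier (WW D) \<rightarrow>\<^sub>E UNIV"
      by (simp add: spair_def WW_def)
  next
    fix \<xi>' \<psi>' \<xi> assume "\<xi>' \<in> carrier (WW D')" "\<psi>' \<in> carrier (WW D')" "\<xi> \<in> carrier (WW D)"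
    then show "spair (\<xi>' \<oplus>\<^bsub>WW D'\<^esub> \<psi>', \<xi>) = spair (\<xi>', \<xi>) + spair (\<psi>', \<xi>)"
      by (elim WW_cases) (simp add: ppair_add_left)
  next
    fix c \<xi>' \<xi> assume "\<xi>' \<in> carrier (WW D')" "\<xi> \<in> carrier (WW D)"
    then show "spair (W_scale D' c \<xi>', \<xi>) = c * spair (\<xi>', \<xi>)" "spair (\<xi>', W_scale D c \<xi>) = c * spair (\<xi>', \<xi>)"
      by (elim WW_cases; simp add: ppair_scale_left ppair_scale)+
  next
    fix \<xi>' \<xi> \<psi> assume "\<xi>' \<in> carrier (WW D')" "\<xi> \<in> carrier (WW D)" "\<psi> \<in> carrier (WW D)"
    then show "spair (\<xi>', \<xi> \<oplus>\<^bsub>WW D\<^esub> \<psi>) = spair (\<xi>', \<xi>) + spair (\<xi>', \<psi>)"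
      by (elim WW_cases) (simp add: ppair_add)
  qed
  moreover have "spair (vacuum D', vacuum D) = 1"
    using ppair_const[of "form_pair D'" 1 1] by (simp add: vacuum_cl)
  ultimately show ?thesis
    by (rule that) (simp_all add: ppair_var ppair_var_left)
qed

text \<open>The symmetry between \<open>D\<close> and \<open>D'\<close> reduces the properties to two instances of \<open>half_adjoint\<close>; the
  pairing of forms serves for both because it is correct on the spanning forms in either
  argument.\<close>

theorem proposition7p1:
  fixes \<gamma> :: "real \<Rightarrow> pline" and D D' :: "pline set"
  assumes "smooth_simple_closed_curve \<gamma>"
    and "components (- range \<gamma>) = {D, D'}" and "D \<noteq> D'"
  shows "\<exists>!B. bilinear_pairing D' D B \<and> B (vacuum D', vacuum D) = 1 \<and>
    (\<forall>\<xi>\<in>carrier (WW D). \<forall>\<xi>'\<in>carrier (WW D').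
      (\<forall>z\<in>D. B (\<xi>', e_op D z \<xi>) = - B (i_op D' z \<xi>', \<xi>)) \<and>
      (\<forall>z'\<in>D'. B (e_op D' z' \<xi>', \<xi>) = - B (\<xi>', i_op D z' \<xi>)) \<and>
      (\<forall>X N. regular_vector_field X \<longrightarrow>
        (\<forall>z\<in>D.
          B (\<xi>', (lie_op D X ^^ N) (e_op D) z \<xi>)
            = (lie_section X ^^ N) (\<lambda>y. B (\<xi>', e_op D y \<xi>)) z \<and>
          (lie_section X ^^ N) (\<lambda>y. B (\<xi>', e_op D y \<xi>)) z
            = - (lie_section X ^^ N) (\<lambda>y. B (i_op D' y \<xi>', \<xi>)) z \<and>
          - (lie_section X ^^ N) (\<lambda>y. B (i_op D' y \<xi>', \<xi>)) z
            = - B ((lie_op D' X ^^ N) (i_op D') z \<xi>', \<xi>)) \<and>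
        (\<forall>z'\<in>D'.
          B ((lie_op D' X ^^ N) (e_op D') z' \<xi>', \<xi>)
            = (lie_section X ^^ N) (\<lambda>y. B (e_op D' y \<xi>', \<xi>)) z' \<and>
          (lie_section X ^^ N) (\<lambda>y. B (e_op D' y \<xi>', \<xi>)) z'
            = - (lie_section X ^^ N) (\<lambda>y. B (\<xi>', i_op D y \<xi>)) z' \<and>
          - (lie_section X ^^ N) (\<lambda>y. B (\<xi>', i_op D y \<xi>)) z'
            = - B (\<xi>', (lie_op D X ^^ N) (i_op D) z' \<xi>))))"
    (is "\<exists>!B. ?P B")
proof -
  have "open (- range \<gamma>)" using closed_range_curve[OF assms(1)] by (simp add: open_Compl)
  note comp = two_components_open[OF this assms(2,3)]
  have op: "open D" "open D'" and ne: "D \<noteq> {}" "D' \<noteq> {}" and disj: "D \<inter> D' = {}" "D' \<inter> D = {}"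
    using comp by auto
  have P_iff: "?P B \<longleftrightarrow> bilinear_pairing D' D B \<and> B (vacuum D', vacuum D) = 1 \<and>
      half_adjoint D' D B \<and> half_adjoint D D' (flip B)" for B
    unfolding half_adjoint_def flip_apply
    by (rule iffI; elim conjE; intro conjI ballI allI impI; (assumption | (drule (1) bspec, drule (1) bspec, blast) | blast))
  show ?thesis unfolding P_iff
  proof (rule ex_ex1I)
    obtain B where B: "bilinear_pairing D' D B" "B (vacuum D', vacuum D) = 1"
      "\<And>\<alpha> P P'. \<alpha> \<in> KK D \<Longrightarrow> P \<in> polys (KK D) \<Longrightarrow> P' \<in> polys (KK D') \<Longrightarrow>
        B (cl D' P', cl D (pvar \<alpha> * P)) = B (cl D' (cder (\<lambda>\<alpha>'. form_pair D' \<alpha>' \<alpha>) P'), cl D P)"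
      "\<And>\<alpha>' P P'. \<alpha>' \<in> KK D' \<Longrightarrow> P \<in> polys (KK D) \<Longrightarrow> P' \<in> polys (KK D') \<Longrightarrow>
        B (cl D' (pvar \<alpha>' * P'), cl D P) = B (cl D' P', cl D (cder (form_pair D' \<alpha>') P))"
      using pairing_exists[OF disj(1)] by blast
    have "half_adjoint D' D B"
      by (rule half_adjointI[OF op ne disj(1) B(1), where b = "form_pair D'"])
         (simp_all add: B(3) form_pair_lin_right[OF disj(1)] form_pair_gform_right[OF disj(1)])
    moreover have "half_adjoint D D' (flip B)"
      by (rule half_adjointI[OF op(2,1) ne(2,1) disj(2) bilinear_flip[OF B(1)],
            where b = "\<lambda>\<alpha> \<alpha>'. form_pair D' \<alpha>' \<alpha>"])
         (simp_all add: B(4) form_pair_lin_left[OF disj(1)] form_pair_gform_left[OF disj(1)])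
    ultimately show "\<exists>B. bilinear_pairing D' D B \<and> B (vacuum D', vacuum D) = 1 \<and>
      half_adjoint D' D B \<and> half_adjoint D D' (flip B)" using B(1,2) by blast
  next
    fix B C
    assume "bilinear_pairing D' D B \<and> B (vacuum D', vacuum D) = 1 \<and> half_adjoint D' D B \<and> half_adjoint D D' (flip B)"
      and "bilinear_pairing D' D C \<and> C (vacuum D', vacuum D) = 1 \<and> half_adjoint D' D C \<and> half_adjoint D D' (flip C)"
    then show "B = C"
      by (intro pairing_unique[OF op ne disj(1)]) (simp_all add: half_adjoint_imp_adjoint_ops)
  qed
qed

end
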